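(* Let $\varphi\colon\mathbb{D}\to\mathbb{D}$ be an analytic map with $\varphi\in\mathit{VMOA}$. Then $C_\varphi$ is compact $\mathit{VMOA}\to\mathit{VMOA}$ if and only if it is compact $\mathcal{B}\to\mathit{VMOA}$.
   Context: $\mathbb{D}$ is the open unit disc, $\|\cdot\|_{H^2}$ the standard Hardy space norm, $\sigma_a(z)=(a-z)/(1-\bar a z)$ for $a\in\mathbb{D}$. $\mathit{BMOA}$ is the Banach space of analytic $f\colon\mathbb{D}\to\mathbb{C}$ with $|f|_*=\sup_{a\in\mathbb{D}}\|f\circ\sigma_a-f(a)\|_{H^2}<\infty$, normed by $\|f\|_*=|f(0)|+|f|_*$; $\mathit{VMOA}$ is its closed subspace of those $f$ with $\lim_{|a|\to1}\|f\circ\sigma_a-f(a)\|_{H^2}=0$. The Bloch space $\mathcal{B}$ is the Banach space of analytic $f\colon\mathbb{D}\to\mathbb{C}$ with finite norm $|f(0)|+\sup_{z\in\mathbb{D}}|f'(z)|(1-|z|^2)$. $C_\varphi f=f\circ\varphi$; when $\varphi\in\mathit{VMOA}$ it maps $\mathit{VMOA}$ boundedly into itself. "$C_\varphi$ is compact $X\to Y$" means that $C_\varphi$ maps $X$ into $Y$ and is a compact operator from $X$ to $Y$. *)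

theory Defs
  imports "HOL-Complex_Analysis.Complex_Analysis"
begin

abbreviation unit_disc :: "complex set"
  where "unit_disc \<equiv> ball 0 1"

text \<open>An analytic function on the disc is represented by the total function that vanishes off
  the disc. This makes the representation unique, so that the norms below separate points.\<close>

definition on_disc :: "(complex \<Rightarrow> complex) \<Rightarrow> complex \<Rightarrow> complex"
  where "on_disc f = (\<lambda>z. if z \<in> unit_disc then f z else 0)"

definition analytic_disc :: "(complex \<Rightarrow> complex) set"
  where "analytic_disc = {f. f holomorphic_on unit_disc \<and> (\<forall>z. z \<notin> unit_disc \<longrightarrow> f z = 0)}"

definition disc_aut :: "complex \<Rightarrow> complex \<Rightarrow> complex"
  where "disc_aut a z = (a - z) / (1 - cnj a * z)"

definition circle_mean :: "real \<Rightarrow> (complex \<Rightarrow> complex) \<Rightarrow> real"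
  where "circle_mean r f =
    sqrt (1 / (2 * pi) * integral {0..2 * pi} (\<lambda>t. (cmod (f (of_real r * cis t)))\<^sup>2))"

text \<open>The Hardy space norm, extended to all analytic functions on the disc with the value
  \<open>\<infinity>\<close> off the Hardy space.\<close>

definition H2_norm :: "(complex \<Rightarrow> complex) \<Rightarrow> ennreal"
  where "H2_norm f = (SUP r\<in>{0<..<1}. ennreal (circle_mean r f))"

definition mean_osc :: "(complex \<Rightarrow> complex) \<Rightarrow> complex \<Rightarrow> ennreal"
  where "mean_osc f a = H2_norm (\<lambda>z. f (disc_aut a z) - f a)"

definition bmoa_seminorm :: "(complex \<Rightarrow> complex) \<Rightarrow> ennreal"
  where "bmoa_seminorm f = (SUP a\<in>unit_disc. mean_osc f a)"

definition bmoa :: "(complex \<Rightarrow> complex) set"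
  where "bmoa = {f \<in> analytic_disc. bmoa_seminorm f < \<infinity>}"

definition bmoa_norm :: "(complex \<Rightarrow> complex) \<Rightarrow> real"
  where "bmoa_norm f = cmod (f 0) + enn2real (bmoa_seminorm f)"

text \<open>The filter is that of \<open>\<bar>a\<bar> \<rightarrow> 1\<close> from inside the disc.\<close>

definition vmoa :: "(complex \<Rightarrow> complex) set"
  where "vmoa = {f \<in> bmoa. (mean_osc f \<longlongrightarrow> 0) (filtercomap cmod (at_left 1))}"

definition bloch_seminorm :: "(complex \<Rightarrow> complex) \<Rightarrow> ennreal"
  where "bloch_seminorm f = (SUP z\<in>unit_disc. ennreal (cmod (deriv f z) * (1 - (cmod z)\<^sup>2)))"

definition bloch :: "(complex \<Rightarrow> complex) set"
  where "bloch = {f \<in> analytic_disc. bloch_seminorm f < \<infinity>}"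

definition bloch_norm :: "(complex \<Rightarrow> complex) \<Rightarrow> real"
  where "bloch_norm f = cmod (f 0) + enn2real (bloch_seminorm f)"

definition norm_dist :: "(('a \<Rightarrow> complex) \<Rightarrow> real) \<Rightarrow> ('a \<Rightarrow> complex) \<Rightarrow> ('a \<Rightarrow> complex) \<Rightarrow> real"
  where "norm_dist n f g = n (\<lambda>z. f z - g z)"

text \<open>A linear map from the normed space \<open>(X, nX)\<close> to the normed space \<open>(Y, nY)\<close>
  (both spaces of functions, with pointwise operations) that takes bounded sets to relatively
  compact sets. That \<open>norm_dist\<close> is a metric on each of the spaces used here is proved in
  \<open>Metric_space_bmoa\<close>, \<open>Metric_space_vmoa\<close> and \<open>Metric_space_bloch\<close> below.\<close>

definition compact_operator ::
  "('a \<Rightarrow> complex) set \<Rightarrow> (('a \<Rightarrow> complex) \<Rightarrow> real) \<Rightarrow> ('b \<Rightarrow> complex) set \<Rightarrow> (('b \<Rightarrow> complex) \<Rightarrow> real)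
    \<Rightarrow> (('a \<Rightarrow> complex) \<Rightarrow> 'b \<Rightarrow> complex) \<Rightarrow> bool"
  where "compact_operator X nX Y nY T \<longleftrightarrow>
    T ` X \<subseteq> Y \<and>
    (\<forall>f\<in>X. \<forall>g\<in>X. T (\<lambda>z. f z + g z) = (\<lambda>z. T f z + T g z)) \<and>
    (\<forall>c. \<forall>f\<in>X. T (\<lambda>z. c * f z) = (\<lambda>z. c * T f z)) \<and>
    (\<forall>S B. S \<subseteq> X \<and> (\<forall>f\<in>S. nX f \<le> B) \<longrightarrow>
      compactin (Metric_space.mtopology Y (norm_dist nY))
        (Metric_space.mtopology Y (norm_dist nY) closure_of (T ` S)))"

definition composition_op :: "(complex \<Rightarrow> complex) \<Rightarrow> (complex \<Rightarrow> complex) \<Rightarrow> complex \<Rightarrow> complex"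
  where "composition_op \<phi> f = on_disc (f \<circ> \<phi>)"

lemma disc_aut_in_disc:
  assumes "a \<in> unit_disc" "z \<in> unit_disc"
  shows "disc_aut a z \<in> unit_disc"
proof -
  have "disc_aut a z = - Moebius_function 0 a z"
    by (simp add: disc_aut_def Moebius_function_simple minus_divide_left)
  then show ?thesis
    using Moebius_function_norm_lt_1[of a z 0] assms by simp
qed

lemma disc_aut_0: "disc_aut 0 z = - z"
  by (simp add: disc_aut_def)

lemma analytic_disc_diff:
  "f \<in> analytic_disc \<Longrightarrow> g \<in> analytic_disc \<Longrightarrow> (\<lambda>z. f z - g z) \<in> analytic_disc"
  by (auto simp: analytic_disc_def intro!: holomorphic_intros)

lemma holomorphic_disc_aut:
  assumes "f holomorphic_on unit_disc" "a \<in> unit_disc"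
  shows "(\<lambda>z. f (disc_aut a z) - f a) holomorphic_on unit_disc"
proof -
  have "1 - cnj a * z \<noteq> 0" if "z \<in> unit_disc" for z
  proof -
    have "cmod (cnj a * z) < 1"
      using assms(2) that mult_strict_mono'[of "cmod a" 1 "cmod z" 1] by (simp add: norm_mult)
    then show ?thesis by (metis eq_iff_diff_eq_0 norm_one less_irrefl)
  qed
  then have "disc_aut a holomorphic_on unit_disc"
    unfolding disc_aut_def by (intro holomorphic_intros) auto
  then have "(f \<circ> disc_aut a) holomorphic_on unit_disc"
    by (rule holomorphic_on_compose_gen[OF _ assms(1)]) (use disc_aut_in_disc assms in blast)
  then show ?thesis
    by (intro holomorphic_intros) (simp add: o_def)
qed

lemma continuous_on_circle:
  assumes "f holomorphic_on unit_disc" "r \<in> {0<..<1}"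
  shows "continuous_on {0..2*pi} (\<lambda>t. f (of_real r * cis t))"
proof (rule continuous_on_compose2[OF holomorphic_on_imp_continuous_on[OF assms(1)]])
  show "continuous_on {0..2*pi} (\<lambda>t. complex_of_real r * cis t)"
    by (intro continuous_intros)
  show "(\<lambda>t. complex_of_real r * cis t) ` {0..2*pi} \<subseteq> unit_disc"
    using assms(2) by (auto simp: norm_mult)
qed

lemma integrable_circle:
  assumes "f holomorphic_on unit_disc" "r \<in> {0<..<1}"
  shows "(\<lambda>t. (cmod (f (of_real r * cis t)))\<^sup>2) integrable_on {0..2*pi}"
  by (intro integrable_continuous_interval continuous_intros continuous_on_circle assms)

lemma circle_mean_nonneg: "circle_mean r f \<ge> 0"
proof -
  have "integral {0..2*pi} (\<lambda>t. (cmod (f (of_real r * cis t)))\<^sup>2) \<ge> 0"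
    by (cases "(\<lambda>t. (cmod (f (of_real r * cis t)))\<^sup>2) integrable_on {0..2*pi}")
      (auto intro!: integral_nonneg simp: not_integrable_integral)
  then show ?thesis by (simp add: circle_mean_def)
qed

lemma norm_diff_square_le:
  fixes x y :: complex
  assumes "a > 0" "b > 0"
  shows "(cmod (x - y))\<^sup>2 \<le> (1 + b / a) * (cmod x)\<^sup>2 + (1 + a / b) * (cmod y)\<^sup>2"
proof -
  have "(cmod (x - y))\<^sup>2 \<le> (cmod x + cmod y)\<^sup>2"
    by (intro power_mono norm_triangle_ineq4) auto
  moreover have "0 \<le> (b * cmod x - a * cmod y)\<^sup>2 / (a * b)"
    using assms by simp
  moreover have "(b * cmod x - a * cmod y)\<^sup>2 / (a * b)
      = (1 + b / a) * (cmod x)\<^sup>2 + (1 + a / b) * (cmod y)\<^sup>2 - (cmod x + cmod y)\<^sup>2"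
    using assms by (simp add: field_simps power2_eq_square)
  ultimately show ?thesis by linarith
qed

lemma circle_mean_diff:
  assumes "f holomorphic_on unit_disc" "g holomorphic_on unit_disc" "r \<in> {0<..<1}"
  shows "circle_mean r (\<lambda>z. f z - g z) \<le> circle_mean r f + circle_mean r g"
proof -
  define I where "I = (\<lambda>h::complex\<Rightarrow>complex. integral {0..2*pi} (\<lambda>t. (cmod (h (of_real r * cis t)))\<^sup>2))"
  have Ile: "1 / (2*pi) * I h \<le> a\<^sup>2" if "circle_mean r h \<le> a" for h a
  proof -
    have "sqrt (1 / (2*pi) * I h) \<le> a"
      using that by (simp add: circle_mean_def I_def)
    then show ?thesis by (rule sqrt_le_D)
  qed
  have *: "circle_mean r (\<lambda>z. f z - g z) \<le> a + b"
    if a: "a > circle_mean r f" and b: "b > circle_mean r g" for a b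
  proof -
    have pos: "a > 0" "b > 0"
      using a b circle_mean_nonneg[of r f] circle_mean_nonneg[of r g] by linarith+
    have "I (\<lambda>z. f z - g z) \<le> integral {0..2*pi} (\<lambda>t.
        (1 + b / a) * (cmod (f (of_real r * cis t)))\<^sup>2 + (1 + a / b) * (cmod (g (of_real r * cis t)))\<^sup>2)"
      unfolding I_def
      by (intro integral_le integrable_circle[OF holomorphic_on_diff] integrable_add
          integrable_on_mult_right integrable_circle norm_diff_square_le pos assms)
    also have "\<dots> = (1 + b / a) * I f + (1 + a / b) * I g"
      unfolding I_def
      by (subst integral_add) (auto intro!: integrable_on_mult_right integrable_circle assms)
    finally have "1 / (2*pi) * I (\<lambda>z. f z - g z)
        \<le> 1 / (2*pi) * ((1 + b / a) * I f + (1 + a / b) * I g)"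
      by (intro mult_left_mono) auto
    also have "\<dots> = (1 + b / a) * (1 / (2*pi) * I f) + (1 + a / b) * (1 / (2*pi) * I g)"
      by (simp add: algebra_simps add_divide_distrib)
    also have "\<dots> \<le> (1 + b / a) * a\<^sup>2 + (1 + a / b) * b\<^sup>2"
      using pos a b by (intro add_mono mult_left_mono Ile) auto
    also have "\<dots> = (a + b)\<^sup>2"
      using pos by (simp add: field_simps power2_eq_square)
    finally show ?thesis
      using pos by (simp add: circle_mean_def I_def real_le_lsqrt)
  qed
  show ?thesis
  proof (rule field_le_epsilon)
    fix e :: real
    assume "e > 0"
    then show "circle_mean r (\<lambda>z. f z - g z) \<le> circle_mean r f + circle_mean r g + e"
      using *[of "circle_mean r f + e/2" "circle_mean r g + e/2"] by simp
  qed
qed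

lemma H2_norm_diff:
  assumes "f holomorphic_on unit_disc" "g holomorphic_on unit_disc"
  shows "H2_norm (\<lambda>z. f z - g z) \<le> H2_norm f + H2_norm g"
  unfolding H2_norm_def
proof (rule SUP_least)
  fix r :: real
  assume r: "r \<in> {0<..<1}"
  have "ennreal (circle_mean r (\<lambda>z. f z - g z)) \<le> ennreal (circle_mean r f) + ennreal (circle_mean r g)"
    using circle_mean_diff[OF assms r] circle_mean_nonneg
    by (simp add: ennreal_plus[symmetric] del: ennreal_plus)
  also have "\<dots> \<le> (SUP r\<in>{0<..<1}. ennreal (circle_mean r f)) + (SUP r\<in>{0<..<1}. ennreal (circle_mean r g))"
    by (intro add_mono SUP_upper r)
  finally show "ennreal (circle_mean r (\<lambda>z. f z - g z))
    \<le> (SUP r\<in>{0<..<1}. ennreal (circle_mean r f)) + (SUP r\<in>{0<..<1}. ennreal (circle_mean r g))" .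
qed

lemma H2_norm_eq_0:
  assumes f: "f holomorphic_on unit_disc" and "H2_norm f = 0" "z \<in> unit_disc" "z \<noteq> 0"
  shows "f z = 0"
proof -
  define r where "r = cmod z"
  have r: "r \<in> {0<..<1}"
    using assms by (auto simp: r_def)
  have "ennreal (circle_mean r f) \<le> H2_norm f"
    unfolding H2_norm_def by (intro SUP_upper r)
  then have "circle_mean r f = 0"
    using assms(2) circle_mean_nonneg[of r f] by (simp add: ennreal_eq_0_iff)
  then have "integral {0..2*pi} (\<lambda>t. (cmod (f (of_real r * cis t)))\<^sup>2) = 0"
    by (simp add: circle_mean_def)
  then have 0: "\<forall>t\<in>{0..2*pi}. (cmod (f (of_real r * cis t)))\<^sup>2 = 0"
    by (subst (asm) integral_eq_0_iff)
      (auto intro!: continuous_intros continuous_on_circle f r)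
  have "z = of_real r * cis (Arg2pi z)"
    using Arg2pi[of z] unfolding is_Arg_def by (simp add: r_def cis_conv_exp)
  moreover have "Arg2pi z \<in> {0..2*pi}"
    using Arg2pi[of z] by auto
  ultimately show ?thesis
    using 0 by (metis zero_eq_power2 norm_eq_zero)
qed

lemma mean_osc_diff:
  assumes "f \<in> analytic_disc" "g \<in> analytic_disc" "a \<in> unit_disc"
  shows "mean_osc (\<lambda>z. f z - g z) a \<le> mean_osc f a + mean_osc g a"
proof -
  have "(\<lambda>z. f (disc_aut a z) - g (disc_aut a z) - (f a - g a))
      = (\<lambda>z. (f (disc_aut a z) - f a) - (g (disc_aut a z) - g a))"
    by (simp add: algebra_simps)
  then show ?thesis
    using assms unfolding mean_osc_def
    by (simp only:) (intro H2_norm_diff holomorphic_disc_aut; simp add: analytic_disc_def)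
qed

lemma bmoa_seminorm_diff:
  assumes "f \<in> analytic_disc" "g \<in> analytic_disc"
  shows "bmoa_seminorm (\<lambda>z. f z - g z) \<le> bmoa_seminorm f + bmoa_seminorm g"
  unfolding bmoa_seminorm_def
proof (rule SUP_least)
  fix a :: complex
  assume a: "a \<in> unit_disc"
  note mean_osc_diff[OF assms a]
  also have "mean_osc f a + mean_osc g a \<le> (SUP a\<in>unit_disc. mean_osc f a) + (SUP a\<in>unit_disc. mean_osc g a)"
    by (intro add_mono SUP_upper a)
  finally show "mean_osc (\<lambda>z. f z - g z) a
    \<le> (SUP a\<in>unit_disc. mean_osc f a) + (SUP a\<in>unit_disc. mean_osc g a)" .
qed

lemma bloch_seminorm_diff:
  assumes "f \<in> analytic_disc" "g \<in> analytic_disc"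
  shows "bloch_seminorm (\<lambda>z. f z - g z) \<le> bloch_seminorm f + bloch_seminorm g"
  unfolding bloch_seminorm_def
proof (rule SUP_least)
  fix z :: complex
  assume z: "z \<in> unit_disc"
  let ?w = "1 - (cmod z)\<^sup>2"
  have w: "?w \<ge> 0"
    using z by (simp add: power_le_one)
  have "deriv (\<lambda>z. f z - g z) z = deriv f z - deriv g z"
    using assms z unfolding analytic_disc_def
    by (intro deriv_diff) (auto intro: holomorphic_on_imp_differentiable_at)
  then have "cmod (deriv (\<lambda>z. f z - g z) z) \<le> cmod (deriv f z) + cmod (deriv g z)"
    by (simp add: norm_triangle_ineq4)
  then have "cmod (deriv (\<lambda>z. f z - g z) z) * ?w \<le> cmod (deriv f z) * ?w + cmod (deriv g z) * ?w"
    using w by (metis mult_right_mono distrib_right)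
  then have "ennreal (cmod (deriv (\<lambda>z. f z - g z) z) * ?w)
      \<le> ennreal (cmod (deriv f z) * ?w) + ennreal (cmod (deriv g z) * ?w)"
    using w by (simp add: ennreal_plus[symmetric] del: ennreal_plus)
  also have "\<dots> \<le> (SUP z\<in>unit_disc. ennreal (cmod (deriv f z) * (1 - (cmod z)\<^sup>2)))
      + (SUP z\<in>unit_disc. ennreal (cmod (deriv g z) * (1 - (cmod z)\<^sup>2)))"
    by (intro add_mono SUP_upper z)
  finally show "ennreal (cmod (deriv (\<lambda>z. f z - g z) z) * ?w)
    \<le> (SUP z\<in>unit_disc. ennreal (cmod (deriv f z) * (1 - (cmod z)\<^sup>2)))
      + (SUP z\<in>unit_disc. ennreal (cmod (deriv g z) * (1 - (cmod z)\<^sup>2)))" .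
qed

lemma bmoa_diff:
  assumes "f \<in> bmoa" "g \<in> bmoa"
  shows "(\<lambda>z. f z - g z) \<in> bmoa"
proof -
  have "bmoa_seminorm f + bmoa_seminorm g < \<infinity>"
    using assms by (simp add: bmoa_def)
  moreover have "bmoa_seminorm (\<lambda>z. f z - g z) \<le> bmoa_seminorm f + bmoa_seminorm g"
    using assms by (simp add: bmoa_def bmoa_seminorm_diff)
  ultimately have "bmoa_seminorm (\<lambda>z. f z - g z) < \<infinity>"
    by (rule order_le_less_trans[rotated])
  then show ?thesis
    using assms by (simp add: bmoa_def analytic_disc_diff)
qed

lemma bloch_diff:
  assumes "f \<in> bloch" "g \<in> bloch"
  shows "(\<lambda>z. f z - g z) \<in> bloch"
proof -
  have "bloch_seminorm f + bloch_seminorm g < \<infinity>"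
    using assms by (simp add: bloch_def)
  moreover have "bloch_seminorm (\<lambda>z. f z - g z) \<le> bloch_seminorm f + bloch_seminorm g"
    using assms by (simp add: bloch_def bloch_seminorm_diff)
  ultimately have "bloch_seminorm (\<lambda>z. f z - g z) < \<infinity>"
    by (rule order_le_less_trans[rotated])
  then show ?thesis
    using assms by (simp add: bloch_def analytic_disc_diff)
qed

lemma Metric_space_norm_dist:
  fixes X :: "(complex \<Rightarrow> complex) set" and s :: "(complex \<Rightarrow> complex) \<Rightarrow> ennreal"
  assumes n: "\<And>f. n f = cmod (f 0) + enn2real (s f)"
    and fin: "\<And>f. f \<in> X \<Longrightarrow> s f < \<infinity>"
    and diff: "\<And>f g. f \<in> X \<Longrightarrow> g \<in> X \<Longrightarrow> (\<lambda>z. f z - g z) \<in> X"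
    and tri: "\<And>f g. f \<in> X \<Longrightarrow> g \<in> X \<Longrightarrow> s (\<lambda>z. f z - g z) \<le> s f + s g"
    and commute: "\<And>f g. s (\<lambda>z. f z - g z) = s (\<lambda>z. g z - f z)"
    and zero: "s (\<lambda>z. 0) = 0"
    and sep: "\<And>f. f \<in> X \<Longrightarrow> f 0 = 0 \<Longrightarrow> s f = 0 \<Longrightarrow> f = (\<lambda>z. 0)"
  shows "Metric_space X (norm_dist n)"
proof -
  have nonneg: "0 \<le> n f" for f
    by (simp add: n)
  have n_diff: "n (\<lambda>z. f z - g z) \<le> n f + n g" if "f \<in> X" "g \<in> X" for f g
  proof -
    have "enn2real (s (\<lambda>z. f z - g z)) \<le> enn2real (s f + s g)"
      using tri[OF that] fin[OF that(1)] fin[OF that(2)] by (intro enn2real_mono) auto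
    also have "\<dots> = enn2real (s f) + enn2real (s g)"
      using fin[OF that(1)] fin[OF that(2)] by (simp add: enn2real_plus)
    finally show ?thesis
      using norm_triangle_ineq4[of "f 0" "g 0"] by (simp add: n)
  qed
  have n0: "n (\<lambda>z. 0) = 0"
    by (simp add: n zero)
  have sep': "f = g" if "f \<in> X" "g \<in> X" "n (\<lambda>z. f z - g z) = 0" for f g
  proof -
    have "f 0 - g 0 = 0 \<and> enn2real (s (\<lambda>z. f z - g z)) = 0"
      using that(3) unfolding n by (simp add: add_nonneg_eq_0_iff)
    then have "(\<lambda>z. f z - g z) = (\<lambda>z. 0)"
      using that fin[OF diff[OF that(1,2)]] by (intro sep diff) (auto simp: enn2real_eq_0_iff)
    then show ?thesis
      by (metis eq_iff_diff_eq_0 ext)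
  qed
  have comm: "n (\<lambda>z. f z - g z) = n (\<lambda>z. g z - f z)" for f g
    by (simp only: n norm_minus_commute[of "f 0"] commute[of f])
  have tri': "n (\<lambda>z. f z - h z) \<le> n (\<lambda>z. f z - g z) + n (\<lambda>z. g z - h z)"
    if "f \<in> X" "g \<in> X" "h \<in> X" for f g h
    using n_diff[OF diff[OF that(1,2)] diff[OF that(3,2)]] comm[of h g] by simp
  show ?thesis
  proof
    show "norm_dist n f g = norm_dist n g f" for f g
      unfolding norm_dist_def by (rule comm)
    show "(norm_dist n f g = 0) = (f = g)" if "f \<in> X" "g \<in> X" for f g
      using sep'[OF that] n0 by (auto simp: norm_dist_def)
  qed (use nonneg tri' in \<open>simp_all add: norm_dist_def\<close>)
qed

lemma analytic_disc_eq_0I: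
  assumes "f \<in> analytic_disc" "\<And>z. z \<in> unit_disc \<Longrightarrow> f z = 0"
  shows "f = (\<lambda>z. 0)"
  using assms unfolding analytic_disc_def by blast

lemma Metric_space_bmoa: "Metric_space bmoa (norm_dist bmoa_norm)"
proof (rule Metric_space_norm_dist[where s = bmoa_seminorm])
  show "bmoa_seminorm (\<lambda>z. f z - g z) = bmoa_seminorm (\<lambda>z. g z - f z)" for f g
  proof -
    have "cmod (f w - g w - (f a - g a)) = cmod (g w - f w - (g a - f a))" for w a
      by (subst norm_minus_commute) (simp add: algebra_simps)
    then show ?thesis
      by (simp add: bmoa_seminorm_def mean_osc_def H2_norm_def circle_mean_def)
  qed
  show "bmoa_seminorm (\<lambda>z. 0) = 0"
    by (simp add: bmoa_seminorm_def mean_osc_def H2_norm_def circle_mean_def)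
  show "f = (\<lambda>z. 0)" if "f \<in> bmoa" "f 0 = 0" "bmoa_seminorm f = 0" for f
  proof (rule analytic_disc_eq_0I)
    show f: "f \<in> analytic_disc"
      using that by (simp add: bmoa_def)
    fix z :: complex
    assume z: "z \<in> unit_disc"
    have "mean_osc f 0 \<le> bmoa_seminorm f"
      unfolding bmoa_seminorm_def by (intro SUP_upper) simp
    then have "H2_norm (\<lambda>z. f (disc_aut 0 z) - f 0) = 0"
      using that by (simp add: mean_osc_def)
    with H2_norm_eq_0[OF holomorphic_disc_aut[of f 0] this, of "- z"] z f that(2)
    show "f z = 0"
      by (cases "z = 0") (auto simp: disc_aut_0 analytic_disc_def)
  qed
  show "(\<lambda>z. f z - g z) \<in> bmoa" if "f \<in> bmoa" "g \<in> bmoa" for f g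
    using that by (rule bmoa_diff)
qed (auto simp: bmoa_norm_def bmoa_def bmoa_seminorm_diff)

lemma vmoa_diff:
  assumes "f \<in> vmoa" "g \<in> vmoa"
  shows "(\<lambda>z. f z - g z) \<in> vmoa"
proof -
  let ?F = "filtercomap cmod (at_left 1)"
  have f: "f \<in> bmoa" "f \<in> analytic_disc" "(mean_osc f \<longlongrightarrow> 0) ?F"
    and g: "g \<in> bmoa" "g \<in> analytic_disc" "(mean_osc g \<longlongrightarrow> 0) ?F"
    using assms by (auto simp: vmoa_def bmoa_def)
  have "\<forall>\<^sub>F a in ?F. a \<in> unit_disc"
    by (simp add: eventually_filtercomap)
      (rule exI[of _ "\<lambda>x. x < 1"], auto simp: eventually_at_filter)
  then have le: "\<forall>\<^sub>F a in ?F. mean_osc (\<lambda>z. f z - g z) a \<le> mean_osc f a + mean_osc g a"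
    by eventually_elim (rule mean_osc_diff[OF f(2) g(2)])
  have lim: "((\<lambda>a. mean_osc f a + mean_osc g a) \<longlongrightarrow> 0) ?F"
    using tendsto_add[OF f(3) g(3)] by simp
  have "(mean_osc (\<lambda>z. f z - g z) \<longlongrightarrow> 0) ?F"
    by (rule tendsto_sandwich[where f = "\<lambda>_. 0", OF _ le tendsto_const lim]) simp
  moreover have "(\<lambda>z. f z - g z) \<in> bmoa"
    using f(1) g(1) by (rule bmoa_diff)
  ultimately show ?thesis
    by (simp add: vmoa_def)
qed

lemma Metric_space_vmoa: "Metric_space vmoa (norm_dist bmoa_norm)"
  by (rule Metric_space.subspace[OF Metric_space_bmoa]) (auto simp: vmoa_def)

lemma norm_deriv_uminus: "cmod (deriv (\<lambda>z. - f z) z) = cmod (deriv f z)"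
proof (cases "f field_differentiable at z")
  case True
  then show ?thesis
    by simp
next
  case False
  have "\<not> ((\<lambda>z. - f z) has_field_derivative D) (at z)" for D
    using False DERIV_minus[of "\<lambda>z. - f z" D z UNIV] by (auto simp: field_differentiable_def)
  moreover have "\<not> (f has_field_derivative D) (at z)" for D
    using False by (auto simp: field_differentiable_def)
  ultimately show ?thesis
    by (simp add: deriv_def)
qed

lemma Metric_space_bloch: "Metric_space bloch (norm_dist bloch_norm)"
proof (rule Metric_space_norm_dist[where s = bloch_seminorm])
  show "bloch_seminorm (\<lambda>z. f z - g z) = bloch_seminorm (\<lambda>z. g z - f z)" for f g
    using norm_deriv_uminus[of "\<lambda>z. g z - f z"] by (simp add: bloch_seminorm_def)
  show "bloch_seminorm (\<lambda>z. 0) = 0"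
    by (simp add: bloch_seminorm_def)
  show "f = (\<lambda>z. 0)" if "f \<in> bloch" "f 0 = 0" "bloch_seminorm f = 0" for f
  proof (rule analytic_disc_eq_0I)
    show f: "f \<in> analytic_disc"
      using that by (simp add: bloch_def)
    have deriv: "deriv f w = 0" if w: "w \<in> unit_disc" for w
    proof -
      have "ennreal (cmod (deriv f w) * (1 - (cmod w)\<^sup>2)) \<le> bloch_seminorm f"
        unfolding bloch_seminorm_def by (intro SUP_upper w)
      then have "cmod (deriv f w) * (1 - (cmod w)\<^sup>2) \<le> 0"
        using \<open>bloch_seminorm f = 0\<close> by (simp add: ennreal_eq_0_iff)
      moreover have "1 - (cmod w)\<^sup>2 > 0"
        using w by (simp add: power_less_one_iff)
      ultimately show ?thesis
        by (simp add: mult_le_0_iff)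
    qed
    fix z :: complex
    assume z: "z \<in> unit_disc"
    have "f z = f 0"
    proof (rule has_field_derivative_zero_constant[of unit_disc f, THEN exE])
      show "(f has_field_derivative 0) (at w within unit_disc)" if "w \<in> unit_disc" for w
        using f that deriv[OF that] holomorphic_derivI[of f unit_disc w unit_disc]
        by (simp add: analytic_disc_def)
    qed (use z in auto)
    then show "f z = 0"
      using that by simp
  qed
  show "(\<lambda>z. f z - g z) \<in> bloch" if "f \<in> bloch" "g \<in> bloch" for f g
    using that by (rule bloch_diff)
qed (auto simp: bloch_norm_def bloch_def bloch_seminorm_diff)

end

theory Submission
  imports Defs
begin

text \<open>One implication is an inclusion of spaces: the derivative at the centre is a Taylor coefficient, so
  \<open>|f' a| (1 - |a|\<^sup>2) \<le> mean_osc f a\<close>, VMOA embeds boundedly in the Bloch space, and a compact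
  operator on the larger space restricts to a compact operator (\<open>compact_operator_bloch_imp_vmoa\<close>).

  For the converse write \<open>\<sigma>\<^sub>a\<close> for \<open>disc_aut a\<close> and \<open>\<psi>\<^sub>a = \<sigma>\<^sub>c \<circ> \<phi> \<circ> \<sigma>\<^sub>a\<close> with \<open>c = \<phi> a\<close>, a self-map of the disc
  that fixes 0. A Bloch function of norm at most \<open>B\<close> is \<open>B\<close>-Lipschitz for the hyperbolic distance,
  \<open>|f w - f c| \<le> B artanh |\<sigma>\<^sub>c w|\<close>, and \<open>artanh\<^sup>2 x \<le> 1 / (1 - x\<^sup>2) - 1\<close>. Hence the oscillation of
  \<open>f \<circ> \<phi>\<close> at \<open>a\<close> is controlled, uniformly in \<open>f\<close>, by the circle averages of \<open>1 / (1 - |\<psi>\<^sub>a|\<^sup>2)\<close>. If these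
  averages are bounded and tend to 1 at the boundary (\<open>hyperbolic_avg_bounded\<close>,
  \<open>hyperbolic_avg_small\<close>), then \<open>C\<^sub>\<phi>\<close> maps the Bloch space into VMOA, and a normal families argument gives
  compactness, since \<open>artanh\<^sup>2 x\<close> is of smaller order than \<open>1 / (1 - x\<^sup>2)\<close> as \<open>x\<close> tends to 1
  (\<open>composition_op_bloch_compact\<close>).

  What has to be drawn from compactness on VMOA is therefore a statement about \<open>\<phi>\<close> alone. The average
  of \<open>1 / |1 - cnj b u|\<^sup>2\<close> over \<open>|b| = s\<close> is \<open>1 / (1 - s\<^sup>2 |u|\<^sup>2)\<close>, so it is enough to bound the averages of
  \<open>1 / |1 - cnj b \<psi>\<^sub>a|\<^sup>2\<close> uniformly in \<open>b\<close>. By a Moebius identity (\<open>log_kernel_disc_aut\<close>) this function is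
  \<open>|exp (h \<circ> \<sigma>\<^sub>a - h a)|\<^sup>2\<close>, where \<open>h\<close> is a difference of two of the functions \<open>k\<^sub>b \<circ> \<phi>\<close> with
  \<open>k\<^sub>b z = - Ln (1 - cnj b z)\<close>. The \<open>k\<^sub>b\<close> form a bounded subset of VMOA because their imaginary parts are
  bounded by \<open>\<pi> / 2\<close>. Compactness makes the \<open>k\<^sub>b \<circ> \<phi>\<close> totally bounded, so \<open>h = g + e\<close>, where \<open>g\<close> is one of
  finitely many bounded functions in VMOA and \<open>e\<close> has small BMOA seminorm. For \<open>g\<close> a quadratic Taylor
  bound of the exponential suffices. For \<open>e\<close> one needs exponential integrability of John-Nirenberg type:
  if \<open>mean_osc e \<le> \<epsilon>\<close> everywhere and \<open>\<epsilon>\<close> is small, then \<open>|exp (e \<circ> \<sigma>\<^sub>a - e a)|\<^sup>2\<close> has circle averages at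
  most \<open>exp (3 \<epsilon>\<^sup>2)\<close> (\<open>mean_osc_exp_bound\<close>).

  That inequality is proved with a superharmonic function. The bound on the oscillation says that the
  subharmonic function \<open>|e|\<^sup>2\<close> has a harmonic majorant \<open>Re F\<close> with \<open>v = |e|\<^sup>2 - Re F\<close> between \<open>- \<epsilon>\<^sup>2\<close> and 0
  (\<open>harmonic_majorant\<close>). As \<open>v\<close> has Laplacian \<open>4 |e'|\<^sup>2\<close>, the function \<open>exp (2 Re e - 3 v - 9 v\<^sup>2)\<close> is
  superharmonic for small \<open>\<epsilon>\<close>. It dominates \<open>|exp e|\<^sup>2\<close>, and it exceeds \<open>|exp e|\<^sup>2\<close> at most by the factor
  \<open>exp (3 \<epsilon>\<^sup>2)\<close>.\<close>

section \<open>Averages over circles\<close>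

definition circle_avg :: "real \<Rightarrow> (complex \<Rightarrow> real) \<Rightarrow> real"
  where "circle_avg r u = integral {0..2 * pi} (\<lambda>t. u (of_real r * cis t)) / (2 * pi)"

lemma circle_integrable:
  fixes u :: "complex \<Rightarrow> real"
  assumes "continuous_on (sphere 0 r) u" "0 < r"
  shows "(\<lambda>t. u (of_real r * cis t)) integrable_on {0..2*pi}"
proof (rule integrable_continuous_interval, rule continuous_on_compose2[OF assms(1)])
  show "continuous_on {0..2 * pi} (\<lambda>t. complex_of_real r * cis t)"
    by (intro continuous_intros)
  show "(\<lambda>t. complex_of_real r * cis t) ` {0..2 * pi} \<subseteq> sphere 0 r"
    using assms(2) by (auto simp: norm_mult)
qed

lemma circle_avg_mono:
  assumes "continuous_on (sphere 0 r) u" "continuous_on (sphere 0 r) v" "0 < r"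
    and "\<And>z. cmod z = r \<Longrightarrow> u z \<le> v z"
  shows "circle_avg r u \<le> circle_avg r v"
  unfolding circle_avg_def
  by (intro divide_right_mono integral_le circle_integrable assms) (use assms(3) in \<open>auto simp: norm_mult\<close>)

lemma circle_avg_add:
  assumes "continuous_on (sphere 0 r) u" "continuous_on (sphere 0 r) v" "0 < r"
  shows "circle_avg r (\<lambda>z. u z + v z) = circle_avg r u + circle_avg r v"
  unfolding circle_avg_def
  by (subst integral_add) (auto intro!: circle_integrable assms simp: add_divide_distrib)

lemma circle_avg_cmult: "circle_avg r (\<lambda>z. c * u z) = c * circle_avg r u"
  by (simp add: circle_avg_def)

lemma circle_avg_const: "circle_avg r (\<lambda>z. c) = c"
  by (simp add: circle_avg_def)

lemma circle_avg_cong: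
  assumes "0 < r" "\<And>z. cmod z = r \<Longrightarrow> u z = v z"
  shows "circle_avg r u = circle_avg r v"
  unfolding circle_avg_def
  by (intro arg_cong2[where f="(/)"] integral_cong) (use assms in \<open>auto simp: norm_mult\<close>)

lemma circle_mean_square: "(circle_mean r f)\<^sup>2 = circle_avg r (\<lambda>z. (cmod (f z))\<^sup>2)"
proof -
  have "circle_mean r f = sqrt (circle_avg r (\<lambda>z. (cmod (f z))\<^sup>2))"
    by (simp add: circle_mean_def circle_avg_def)
  moreover have "circle_avg r (\<lambda>z. (cmod (f z))\<^sup>2) \<ge> 0"
    using circle_mean_nonneg[of r f] calculation by simp
  ultimately show ?thesis by simp
qed

lemma H2_norm_le_iff:
  assumes "0 \<le> c"
  shows "H2_norm f \<le> ennreal c \<longleftrightarrow> (\<forall>r\<in>{0<..<1}. circle_avg r (\<lambda>z. (cmod (f z))\<^sup>2) \<le> c\<^sup>2)"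
proof -
  have "circle_mean r f \<le> c \<longleftrightarrow> circle_avg r (\<lambda>z. (cmod (f z))\<^sup>2) \<le> c\<^sup>2" for r
    unfolding circle_mean_square[symmetric] using assms circle_mean_nonneg[of r f]
    by (metis abs_le_square_iff abs_of_nonneg)
  then show ?thesis
    using assms by (simp add: H2_norm_def SUP_le_iff)
qed

lemma circle_Cauchy_formula:
  assumes "G holomorphic_on cball 0 R" "cmod z < R"
  shows "((\<lambda>t. G (of_real R * cis t) * (of_real R * cis t / (of_real R * cis t - z)))
    has_integral 2 * of_real pi * G z) {0..2*pi}"
proof -
  have "((\<lambda>u. G u/(u-z)) has_contour_integral (2 * of_real pi * \<i> * G z)) (circlepath 0 R)"
    using assms by (intro Cauchy_integral_circlepath_simple) auto
  then have "((\<lambda>t. G (0 + R * cis t) / (0 + R * cis t - z) * R * \<i> * cis t) has_integral (2 * of_real pi * \<i> * G z)) {0..2*pi}"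
    unfolding circlepath_def by (subst (asm) has_contour_integral_part_circlepath_iff) auto
  from has_integral_mult_right[OF this, of "-\<i>"] show ?thesis
    by (simp add: field_simps)
qed

lemma circle_mean_value:
  assumes "G holomorphic_on cball 0 R" "0 < R"
  shows "((\<lambda>t. G (of_real R * cis t)) has_integral 2 * of_real pi * G 0) {0..2*pi}"
  using circle_Cauchy_formula[OF assms(1), of 0] assms(2) by simp

lemma circle_avg_Re:
  assumes "G holomorphic_on cball 0 R" "0 < R"
  shows "circle_avg R (\<lambda>z. Re (G z)) = Re (G 0)"
  using integral_unique[OF has_integral_linear[OF circle_mean_value[OF assms] bounded_linear_Re]]
  by (simp add: circle_avg_def o_def)

section \<open>The Poisson integral\<close>

definition poisson :: "real \<Rightarrow> complex \<Rightarrow> real \<Rightarrow> real"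
  where "poisson R z t = (R\<^sup>2 - (cmod z)\<^sup>2) / (cmod (of_real R * cis t - z))\<^sup>2"

definition poisson_int :: "real \<Rightarrow> (complex \<Rightarrow> real) \<Rightarrow> complex \<Rightarrow> real"
  where "poisson_int R u z = integral {0..2*pi} (\<lambda>t. poisson R z t * u (of_real R * cis t)) / (2*pi)"

lemma circle_minus_nonzero:
  assumes "cmod z < R" shows "of_real R * cis t - z \<noteq> 0"
proof
  assume "of_real R * cis t - z = 0"
  then have "cmod (of_real R * cis t) = cmod z" by simp
  then show False using assms by (simp add: norm_mult)
qed

lemma poisson_nonneg: "cmod z < R \<Longrightarrow> poisson R z t \<ge> 0"
  unfolding poisson_def by (intro divide_nonneg_nonneg) (auto intro: power_mono)

lemma poisson_eq_Re:
  assumes "cmod z < R"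
  shows "poisson R z t = Re ((of_real R * cis t + z) / (of_real R * cis t - z))"
proof -
  define w where "w = of_real R * cis t"
  have w: "cmod w = R" using assms norm_ge_zero[of z] by (simp add: w_def norm_mult del: norm_ge_zero)
  have "(w + z) / (w - z) = (w + z) * cnj (w - z) / of_real ((cmod (w - z))\<^sup>2)"
    by (rule complex_div_cnj)
  then have "Re ((w + z) / (w - z)) = Re ((w + z) * cnj (w - z)) / (cmod (w - z))\<^sup>2"
    by (simp only: Re_divide_of_real)
  also have "Re ((w + z) * cnj (w - z)) = (cmod w)\<^sup>2 - (cmod z)\<^sup>2"
    unfolding cmod_power2 by (simp add: algebra_simps power2_eq_square)
  finally show ?thesis by (simp add: poisson_def w_def[symmetric] w)
qed

text \<open>The first summand is the Cauchy kernel at \<open>z\<close>; on the circle the second one is the restriction of a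
  function that is holomorphic in the disc and vanishes at 0. Integrating against a holomorphic
  function, Cauchy's formula thus reproduces the value at \<open>z\<close>, which is the Poisson formula.\<close>

lemma poisson_eq_Cauchy:
  assumes "cmod z < R"
  shows "of_real (poisson R z t) = of_real R * cis t / (of_real R * cis t - z)
    + cnj z * (of_real R * cis t) / ((of_real R)\<^sup>2 - cnj z * (of_real R * cis t))"
proof -
  define w where "w = of_real R * cis t"
  have w: "cmod w = R" using assms norm_ge_zero[of z] by (simp add: w_def norm_mult del: norm_ge_zero)
  have ww: "(of_real R)\<^sup>2 = w * cnj w" using w by (simp add: complex_norm_square[symmetric])
  have n0: "w \<noteq> 0" using w assms norm_ge_zero[of z] by auto
  have n1: "w - z \<noteq> 0" using circle_minus_nonzero[OF assms] by (simp add: w_def)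
  then have n2: "cnj w - cnj z \<noteq> 0" by (simp only: complex_cnj_diff[symmetric] complex_cnj_zero_iff not_False_eq_True)
  have "of_real (poisson R z t) = (w * cnj w - z * cnj z) / ((w - z) * (cnj w - cnj z))"
    unfolding poisson_def w_def[symmetric] of_real_divide of_real_diff complex_norm_square
    using ww by simp
  also have "\<dots> = w / (w - z) + cnj z / (cnj w - cnj z)"
    using n1 n2 by (simp add: field_simps)
  also have "cnj z / (cnj w - cnj z) = cnj z * w / ((of_real R)\<^sup>2 - cnj z * w)"
    unfolding ww using n0 n2 by (simp add: field_simps)
  finally show ?thesis by (simp add: w_def)
qed

lemma poisson_formula:
  assumes G: "G holomorphic_on cball 0 R" and z: "cmod z < R"
  shows "((\<lambda>t. of_real (poisson R z t) * G (of_real R * cis t)) has_integral 2 * of_real pi * G z) {0..2*pi}"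
proof -
  have R: "0 < R" using z norm_ge_zero[of z] by linarith
  have ne: "(of_real R)\<^sup>2 - cnj z * w \<noteq> 0" if "w \<in> cball 0 R" for w
  proof
    assume "(of_real R)\<^sup>2 - cnj z * w = 0"
    then have "cmod ((of_real R)\<^sup>2) = cmod (cnj z * w)" by simp
    then have "R * R = cmod z * cmod w"
      by (simp add: norm_mult norm_power power2_eq_square)
    moreover have "cmod z * cmod w \<le> cmod z * R"
      using that by (intro mult_left_mono) auto
    moreover have "cmod z * R < R * R"
      using z R by (intro mult_strict_right_mono) auto
    ultimately show False by simp
  qed
  have "((\<lambda>t. G (of_real R * cis t) * (cnj z * (of_real R * cis t)) / ((of_real R)\<^sup>2 - cnj z * (of_real R * cis t)))
      has_integral 2 * of_real pi * (G 0 * (cnj z * 0) / ((of_real R)\<^sup>2 - cnj z * 0))) {0..2*pi}"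
    using ne by (intro circle_mean_value[where G="\<lambda>w. G w * (cnj z * w) / ((of_real R)\<^sup>2 - cnj z * w)"])
      (auto intro!: holomorphic_intros G R)
  from has_integral_add[OF circle_Cauchy_formula[OF G z] this] show ?thesis
    by (simp add: poisson_eq_Cauchy[OF z] algebra_simps)
qed

lemma continuous_on_poisson: "cmod z < R \<Longrightarrow> continuous_on S (poisson R z)"
  unfolding poisson_def using circle_minus_nonzero[of z R]
  by (intro continuous_intros) auto

lemma poisson_integrable:
  fixes u :: "complex \<Rightarrow> real"
  assumes "continuous_on (sphere 0 R) u" "cmod z < R"
  shows "(\<lambda>t. poisson R z t * u (of_real R * cis t)) integrable_on {0..2*pi}"
proof (intro integrable_continuous_interval continuous_intros continuous_on_poisson assms)
  have "R > 0" using assms(2) norm_ge_zero[of z] by linarith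
  then show "continuous_on {0..2 * pi} (\<lambda>t. u (of_real R * cis t))"
    by (intro continuous_on_compose2[OF assms(1)] continuous_intros) (auto simp: norm_mult)
qed

lemma poisson_int_Re:
  assumes "G holomorphic_on cball 0 R" "cmod z < R"
  shows "poisson_int R (\<lambda>w. Re (G w)) z = Re (G z)"
  using integral_unique[OF has_integral_linear[OF poisson_formula[OF assms] bounded_linear_Re]]
  by (simp add: poisson_int_def o_def)

lemma poisson_int_mono:
  assumes "continuous_on (sphere 0 R) u" "continuous_on (sphere 0 R) v" "cmod z < R"
    and "\<And>w. cmod w = R \<Longrightarrow> u w \<le> v w"
  shows "poisson_int R u z \<le> poisson_int R v z"
  unfolding poisson_int_def
proof (intro divide_right_mono integral_le poisson_integrable assms mult_left_mono poisson_nonneg)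
  show "cmod (of_real R * cis t) = R" for t
    using assms(3) norm_ge_zero[of z] by (simp add: norm_mult del: norm_ge_zero)
qed auto

lemma poisson_int_add:
  assumes "continuous_on (sphere 0 R) u" "continuous_on (sphere 0 R) v" "cmod z < R"
  shows "poisson_int R (\<lambda>w. u w + v w) z = poisson_int R u z + poisson_int R v z"
  unfolding poisson_int_def distrib_left
  by (subst integral_add) (auto intro!: poisson_integrable assms simp: add_divide_distrib)

text \<open>Expand the square; the mixed term is the real part of a holomorphic function and is reproduced by
  the Poisson integral. Nonnegativity of the left side is Jensen's inequality for \<open>|h|\<^sup>2\<close>.\<close>

lemma poisson_int_norm_diff_square:
  assumes h: "h holomorphic_on cball 0 R" and z: "cmod z < R"
  shows "poisson_int R (\<lambda>w. (cmod (h w - h z))\<^sup>2) z = poisson_int R (\<lambda>w. (cmod (h w))\<^sup>2) z - (cmod (h z))\<^sup>2"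
proof -
  let ?G = "\<lambda>w. (cnj (h z)) * (h z - 2 * h w)"
  have c: "continuous_on (sphere 0 R) h"
    using holomorphic_on_imp_continuous_on[OF h] by (rule continuous_on_subset) auto
  have "(cmod (h w - h z))\<^sup>2 = (cmod (h w))\<^sup>2 + Re (?G w)" for w
    unfolding cmod_power2 by (simp add: power2_eq_square algebra_simps)
  then have "poisson_int R (\<lambda>w. (cmod (h w - h z))\<^sup>2) z = poisson_int R (\<lambda>w. (cmod (h w))\<^sup>2 + Re (?G w)) z"
    by simp
  also have "\<dots> = poisson_int R (\<lambda>w. (cmod (h w))\<^sup>2) z + Re (?G z)"
    by (subst poisson_int_add, (intro continuous_intros c z)+, subst poisson_int_Re)
      (use h z in \<open>auto intro!: holomorphic_intros\<close>)
  also have "Re (?G z) = - (cmod (h z))\<^sup>2"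
    unfolding cmod_power2 by (simp add: power2_eq_square algebra_simps)
  finally show ?thesis by simp
qed

text \<open>Herglotz representation: averaging \<open>(\<zeta> + z) / (\<zeta> - z)\<close> against \<open>u\<close> exhibits the Poisson integral as
  the real part of a holomorphic function, so its derivatives are accessible through those of \<open>F\<close>.\<close>

lemma herglotz:
  assumes c: "continuous_on (sphere 0 R) u" and R: "0 < R"
  obtains F where "F holomorphic_on ball 0 R" "\<And>z. cmod z < R \<Longrightarrow> Re (F z) = poisson_int R u z"
proof -
  define k where "k = (\<lambda>z t. (of_real R * cis t + z) / (of_real R * cis t - z) * of_real (u (of_real R * cis t)))"
  define k' where "k' = (\<lambda>z t. 2 * (of_real R * cis t) / (of_real R * cis t - z)\<^sup>2 * of_real (u (of_real R * cis t)))"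
  define F where "F = (\<lambda>z. integral (cbox 0 (2*pi)) (k z) / (2*pi))"
  have cu: "continuous_on {0..2*pi} (\<lambda>t. u (of_real R * cis t))"
    using R by (intro continuous_on_compose2[OF c] continuous_intros) (auto simp: norm_mult)
  have cu2: "continuous_on (ball (0::complex) R \<times> {0..2*pi}) (\<lambda>x. u (of_real R * cis (snd x)))"
    by (rule continuous_on_compose2[OF cu]) (auto intro!: continuous_intros)
  have nz: "of_real R * cis t - z \<noteq> 0" if "z \<in> ball 0 R" for t z
    using circle_minus_nonzero[of z R t] that by simp
  have int: "k z integrable_on cbox 0 (2*pi)" if "z \<in> ball 0 R" for z
    unfolding k_def cbox_interval using nz[OF that]
    by (intro integrable_continuous_interval continuous_intros cu) auto
  have "F holomorphic_on ball 0 R"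
    unfolding F_def
  proof (intro holomorphic_intros leibniz_rule_holomorphic[where fx=k'] int)
    show "((\<lambda>z. k z t) has_field_derivative k' z t) (at z within ball 0 R)" if "z \<in> ball 0 R" for z t
      unfolding k_def k'_def using nz[OF that, of t]
      by (auto intro!: derivative_eq_intros simp: field_simps power2_eq_square)
    show "continuous_on (ball 0 R \<times> cbox 0 (2 * pi)) (\<lambda>(z, t). k' z t)"
      unfolding k'_def case_prod_beta using nz
      by (intro continuous_intros continuous_on_compose2[OF cu2]) (auto intro!: continuous_intros cu2 simp: cbox_interval)
  qed auto
  moreover have "Re (F z) = poisson_int R u z" if "cmod z < R" for z
  proof -
    have "Re (integral {0..2*pi} (k z)) = integral {0..2*pi} (\<lambda>t. Re (k z t))"
      using integral_linear[OF int bounded_linear_Re, of z] that by (simp add: o_def)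
    also have "\<dots> = integral {0..2*pi} (\<lambda>t. poisson R z t * u (of_real R * cis t))"
      by (intro integral_cong) (simp add: k_def poisson_eq_Re[OF that] del: times_divide_eq_left)
    finally show ?thesis by (simp add: F_def poisson_int_def)
  qed
  ultimately show thesis by (rule that)
qed

lemma poisson_int_0:
  assumes "0 < R" shows "poisson_int R u 0 = circle_avg R u"
proof -
  have "poisson R 0 t = 1" for t
    unfolding poisson_def using assms by (auto simp: norm_mult)
  then show ?thesis
    unfolding poisson_int_def circle_avg_def by (simp only: mult_1)
qed

section \<open>Moebius maps and the oscillation of a function\<close>

lemma mean_osc_le_iff:
  assumes "0 \<le> c"
  shows "mean_osc f a \<le> ennreal c \<longleftrightarrow>
    (\<forall>r\<in>{0<..<1}. circle_avg r (\<lambda>z. (cmod (f (disc_aut a z) - f a))\<^sup>2) \<le> c\<^sup>2)"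
  unfolding mean_osc_def by (rule H2_norm_le_iff[OF assms])

lemma disc_aut_denominator:
  assumes "cmod a < 1" "cmod z < 1" shows "1 - cnj a * z \<noteq> 0"
proof -
  have "cmod (cnj a * z) < 1"
    using assms mult_strict_mono'[of "cmod a" 1 "cmod z" 1] by (simp add: norm_mult)
  then show ?thesis by (metis eq_iff_diff_eq_0 norm_one less_irrefl)
qed

lemma disc_aut_involution:
  assumes a: "cmod a < 1" and z: "cmod z < 1"
  shows "disc_aut a (disc_aut a z) = z"
proof -
  have d: "1 - cnj a * z \<noteq> 0" "1 - cnj a * a \<noteq> 0"
    using disc_aut_denominator[OF a z] disc_aut_denominator[OF a a] by auto
  have "a - disc_aut a z = (1 - cnj a * a) * z / (1 - cnj a * z)"
    using d by (simp add: disc_aut_def field_simps)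
  moreover have "1 - cnj a * disc_aut a z = (1 - cnj a * a) / (1 - cnj a * z)"
    using d by (simp add: disc_aut_def field_simps)
  ultimately have "disc_aut a (disc_aut a z)
      = ((1 - cnj a * a) * z / (1 - cnj a * z)) / ((1 - cnj a * a) / (1 - cnj a * z))"
    by (simp only: disc_aut_def[of a "disc_aut a z"])
  then show ?thesis using d by simp
qed

lemma disc_aut_self: "disc_aut a a = 0"
  by (simp add: disc_aut_def)

lemma disc_aut_at_0: "disc_aut a 0 = a"
  by (simp add: disc_aut_def)

lemma norm_disc_aut_less: "cmod a < 1 \<Longrightarrow> cmod z < 1 \<Longrightarrow> cmod (disc_aut a z) < 1"
  using disc_aut_in_disc[of a z] by simp

lemma disc_aut_holomorphic:
  assumes "cmod a < 1" shows "disc_aut a holomorphic_on unit_disc"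
  unfolding disc_aut_def using disc_aut_denominator[OF assms]
  by (intro holomorphic_intros) auto

lemma disc_aut_cball_bound:
  assumes a: "cmod a < 1" and R: "R < 1"
  obtains r where "0 < r" "r < 1" "\<And>w. cmod w \<le> R \<Longrightarrow> cmod (disc_aut a w) < r"
proof -
  define C where "C = insert 0 (cmod ` disc_aut a ` cball 0 R)"
  have "continuous_on (cball 0 R) (disc_aut a)"
    using holomorphic_on_imp_continuous_on[OF disc_aut_holomorphic[OF a]]
    by (rule continuous_on_subset) (use R in auto)
  then have "compact C"
    unfolding C_def by (intro compact_insert compact_continuous_image continuous_intros) auto
  moreover have "C \<noteq> {}" by (simp add: C_def)
  ultimately obtain m where m: "m \<in> C" "\<forall>x\<in>C. x \<le> m"
    by (metis compact_attains_sup)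
  have "m < 1" "0 \<le> m" using m(1) norm_disc_aut_less[OF a] R by (auto simp: C_def)
  moreover have "cmod (disc_aut a w) \<le> m" if "cmod w \<le> R" for w
    using m(2) that by (auto simp: C_def)
  moreover have "0 < (m + 1) / 2" "(m + 1) / 2 < 1" "m < (m + 1) / 2"
    using \<open>m < 1\<close> \<open>0 \<le> m\<close> by auto
  ultimately show thesis
    using that[of "(m + 1) / 2"] by (meson le_less_trans)
qed

lemma norm_square_le_poisson_int:
  assumes h: "h holomorphic_on cball 0 R" and z: "cmod z < R"
  shows "(cmod (h z))\<^sup>2 \<le> poisson_int R (\<lambda>w. (cmod (h w))\<^sup>2) z"
proof -
  have "0 \<le> poisson_int R (\<lambda>w. (cmod (h w - h z))\<^sup>2) z"
  proof -
    have c: "continuous_on (sphere 0 R) h"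
      using holomorphic_on_imp_continuous_on[OF h] by (rule continuous_on_subset) auto
    have "poisson_int R (\<lambda>w. Re 0) z \<le> poisson_int R (\<lambda>w. (cmod (h w - h z))\<^sup>2) z"
      by (intro poisson_int_mono continuous_intros c z) auto
    then show ?thesis by (simp add: poisson_int_def)
  qed
  then show ?thesis by (simp add: poisson_int_norm_diff_square[OF h z])
qed

text \<open>The oscillation at \<open>z\<close> is an average over \<open>\<sigma>\<^sub>z\<close>-images of circles around 0, the Poisson integral
  one over a circle around 0. They are compared by subordination: in the coordinate \<open>\<sigma>\<^sub>z w\<close> the closed disc of
  radius \<open>R\<close> sits in a disc of radius \<open>r < 1\<close> on which \<open>|h \<circ> \<sigma>\<^sub>z - h z|\<^sup>2\<close> has a harmonic majorant \<open>Re \<Phi>\<close>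
  with value at 0 bounded by the square of the oscillation. Pulled back to the original coordinate,
  the majorant bounds the Poisson integral.\<close>

lemma poisson_int_le_mean_osc:
  assumes h: "h holomorphic_on unit_disc" and R: "R < 1" and z: "cmod z < R"
    and osc: "mean_osc h z \<le> ennreal \<epsilon>" and \<epsilon>: "0 \<le> \<epsilon>"
  shows "poisson_int R (\<lambda>w. (cmod (h w))\<^sup>2) z \<le> (cmod (h z))\<^sup>2 + \<epsilon>\<^sup>2"
proof -
  have R0: "0 < R" using z norm_ge_zero[of z] by linarith
  have z1: "cmod z < 1" using z R by simp
  have sub: "cball 0 R \<subseteq> unit_disc" using R by auto
  define \<kappa> where "\<kappa> = (\<lambda>w. h (disc_aut z w) - h z)"
  have \<kappa>: "\<kappa> holomorphic_on unit_disc"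
    unfolding \<kappa>_def using h z1 by (intro holomorphic_disc_aut) auto
  obtain r where r: "0 < r" "r < 1" "\<And>w. cmod w \<le> R \<Longrightarrow> cmod (disc_aut z w) < r"
    using disc_aut_cball_bound[OF z1 R] by blast
  have r1: "cball 0 r \<subseteq> unit_disc" using r by auto
  have \<kappa>r: "\<kappa> holomorphic_on cball 0 r" using \<kappa> r1 by (rule holomorphic_on_subset)
  have c\<kappa>: "continuous_on (sphere 0 r) (\<lambda>w. (cmod (\<kappa> w))\<^sup>2)"
    by (intro continuous_intros continuous_on_subset[OF holomorphic_on_imp_continuous_on[OF \<kappa>r]]) auto
  obtain \<Phi> where \<Phi>: "\<Phi> holomorphic_on ball 0 r"
      "\<And>w. cmod w < r \<Longrightarrow> Re (\<Phi> w) = poisson_int r (\<lambda>w. (cmod (\<kappa> w))\<^sup>2) w"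
    using herglotz[OF c\<kappa> r(1)] by metis
  define G where "G = \<Phi> \<circ> disc_aut z"
  have G: "G holomorphic_on cball 0 R"
    unfolding G_def using disc_aut_holomorphic[OF z1] \<Phi>(1) r(3)
    by (intro holomorphic_on_compose_gen[of _ _ _ "ball 0 r"]) (auto intro: holomorphic_on_subset[OF _ sub])
  have hR: "h holomorphic_on cball 0 R" using h sub by (rule holomorphic_on_subset)
  have le: "(cmod (h w - h z))\<^sup>2 \<le> Re (G w)" if "cmod w = R" for w
  proof -
    have "h w - h z = \<kappa> (disc_aut z w)"
      using disc_aut_involution[OF z1, of w] that R by (simp add: \<kappa>_def)
    then show ?thesis
      using norm_square_le_poisson_int[OF \<kappa>r r(3)[of w]] \<Phi>(2)[OF r(3)[of w]] that
      by (simp add: G_def)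
  qed
  have "poisson_int R (\<lambda>w. (cmod (h w))\<^sup>2) z - (cmod (h z))\<^sup>2 = poisson_int R (\<lambda>w. (cmod (h w - h z))\<^sup>2) z"
    by (rule poisson_int_norm_diff_square[OF hR z, symmetric])
  also have "\<dots> \<le> poisson_int R (\<lambda>w. Re (G w)) z"
    by (intro poisson_int_mono continuous_intros le z continuous_on_subset[OF holomorphic_on_imp_continuous_on[OF hR]]
        continuous_on_subset[OF holomorphic_on_imp_continuous_on[OF G]]) auto
  also have "\<dots> = Re (\<Phi> 0)"
    using poisson_int_Re[OF G z] by (simp add: G_def disc_aut_self)
  also have "\<dots> = circle_avg r (\<lambda>w. (cmod (\<kappa> w))\<^sup>2)"
    using \<Phi>(2)[of 0] r(1) by (simp add: poisson_int_0)
  also have "\<dots> \<le> \<epsilon>\<^sup>2"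
    using osc r(1,2) by (simp add: mean_osc_le_iff[OF \<epsilon>] \<kappa>_def)
  finally show ?thesis by simp
qed

lemma harmonic_majorant:
  assumes h: "h holomorphic_on unit_disc" and R: "0 < R" "R < 1" and \<epsilon>: "0 \<le> \<epsilon>"
    and osc: "\<And>a. cmod a < 1 \<Longrightarrow> mean_osc h a \<le> ennreal \<epsilon>"
  obtains F where "F holomorphic_on ball 0 R"
    "\<And>z. cmod z < R \<Longrightarrow> (cmod (h z))\<^sup>2 \<le> Re (F z) \<and> Re (F z) \<le> (cmod (h z))\<^sup>2 + \<epsilon>\<^sup>2"
proof -
  have hR: "h holomorphic_on cball 0 R" using h by (rule holomorphic_on_subset) (use R in auto)
  have c: "continuous_on (sphere 0 R) (\<lambda>w. (cmod (h w))\<^sup>2)"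
    by (intro continuous_intros continuous_on_subset[OF holomorphic_on_imp_continuous_on[OF hR]]) auto
  obtain F where F: "F holomorphic_on ball 0 R"
    "\<And>z. cmod z < R \<Longrightarrow> Re (F z) = poisson_int R (\<lambda>w. (cmod (h w))\<^sup>2) z"
    using herglotz[OF c R(1)] by metis
  show thesis
    by (rule that[OF F(1)])
      (use F(2) norm_square_le_poisson_int[OF hR] poisson_int_le_mean_osc[OF h R(2) _ osc \<epsilon>] R in auto)
qed

section \<open>Exponentials of functions of small mean oscillation\<close>

text \<open>In logarithmic polar coordinates \<open>z = exp (s + i t)\<close> a superharmonic function has nonpositive
  Laplacian in \<open>(s, t)\<close>. Integrating over a period removes the \<open>t\<close>-derivatives, so the circle integrals
  are concave in \<open>s\<close>. Being bounded below as \<open>s\<close> tends to \<open>-\<infinity>\<close>, they cannot increase anywhere.\<close>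

lemma circle_integral_antimono:
  fixes P Ps Pss Pt Ptt :: "real \<Rightarrow> real \<Rightarrow> real"
  assumes ds: "\<And>s t. s < L \<Longrightarrow> ((\<lambda>s. P s t) has_real_derivative Ps s t) (at s)"
    and dss: "\<And>s t. s < L \<Longrightarrow> ((\<lambda>s. Ps s t) has_real_derivative Pss s t) (at s)"
    and dt: "\<And>s t. s < L \<Longrightarrow> ((\<lambda>t. P s t) has_real_derivative Pt s t) (at t)"
    and dtt: "\<And>s t. s < L \<Longrightarrow> ((\<lambda>t. Pt s t) has_real_derivative Ptt s t) (at t)"
    and cs: "continuous_on ({..<L} \<times> {0..2*pi}) (\<lambda>(s,t). Ps s t)"
    and css: "continuous_on ({..<L} \<times> {0..2*pi}) (\<lambda>(s,t). Pss s t)"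
    and lap: "\<And>s t. s < L \<Longrightarrow> Pss s t + Ptt s t \<le> 0"
    and per: "\<And>s. s < L \<Longrightarrow> Pt s (2*pi) = Pt s 0"
    and nonneg: "\<And>s t. s < L \<Longrightarrow> 0 \<le> P s t"
    and "s1 \<le> s2" "s2 < L"
  shows "integral {0..2*pi} (P s2) \<le> integral {0..2*pi} (P s1)"
proof -
  define M where "M = (\<lambda>s. integral {0..2*pi} (P s))"
  define M1 where "M1 = (\<lambda>s. integral {0..2*pi} (Ps s))"
  define M2 where "M2 = (\<lambda>s. integral {0..2*pi} (Pss s))"
  have cP: "continuous_on {0..2*pi} (P s)" if "s < L" for s
    using dt[OF that] by (meson DERIV_isCont continuous_at_imp_continuous_on)
  have cPs: "continuous_on {0..2*pi} (Ps s)" if "s < L" for s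
  proof -
    have "continuous_on {0..2*pi} (\<lambda>t. (s, t))"
      by (intro continuous_on_Pair continuous_on_const continuous_on_id)
    from continuous_on_compose2[OF cs this] show ?thesis
      using that by (simp add: image_subset_iff)
  qed
  have cPss: "continuous_on {0..2*pi} (Pss s)" if "s < L" for s
  proof -
    have "continuous_on {0..2*pi} (\<lambda>t. (s, t))"
      by (intro continuous_on_Pair continuous_on_const continuous_on_id)
    from continuous_on_compose2[OF css this] show ?thesis
      using that by (simp add: image_subset_iff)
  qed
  have DM: "(M has_real_derivative M1 s) (at s)" if "s < L" for s
  proof -
    have "((\<lambda>s. integral (cbox 0 (2*pi)) (P s)) has_field_derivative integral (cbox 0 (2*pi)) (Ps s)) (at s within {..<L})"
      using that cs by (intro leibniz_rule_field_derivative)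
        (auto intro!: integrable_continuous_interval cP DERIV_subset[OF ds] simp: cbox_interval)
    then show ?thesis
      using that by (simp add: M_def M1_def cbox_interval at_within_open[of s "{..<L}"])
  qed
  have DM1: "(M1 has_real_derivative M2 s) (at s)" if "s < L" for s
  proof -
    have "((\<lambda>s. integral (cbox 0 (2*pi)) (Ps s)) has_field_derivative integral (cbox 0 (2*pi)) (Pss s)) (at s within {..<L})"
      using that css by (intro leibniz_rule_field_derivative)
        (auto intro!: integrable_continuous_interval cPs DERIV_subset[OF dss] simp: cbox_interval)
    then show ?thesis
      using that by (simp add: M1_def M2_def cbox_interval at_within_open[of s "{..<L}"])
  qed
  have M2: "M2 s \<le> 0" if s: "s < L" for s
  proof -
    have "(Ptt s has_integral Pt s (2*pi) - Pt s 0) {0..2*pi}"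
      using dtt[OF s] by (intro fundamental_theorem_of_calculus)
        (auto simp: has_real_derivative_iff_has_vector_derivative[symmetric] intro: DERIV_subset)
    then have Ptt: "(Ptt s has_integral 0) {0..2*pi}" by (simp add: per[OF s])
    have "(Pss s has_integral M2 s) {0..2*pi}"
      unfolding M2_def using cPss[OF s] by (intro integrable_integral integrable_continuous_interval)
    from has_integral_add[OF this Ptt] show ?thesis
      using has_integral_le[of "\<lambda>t. Pss s t + Ptt s t" "M2 s + 0" "{0..2*pi}" "\<lambda>_. 0" 0] lap[OF s] by auto
  qed
  have M0: "0 \<le> M s" if "s < L" for s
    unfolding M_def using cP[OF that] nonneg[OF that]
    by (intro integral_nonneg integrable_continuous_interval) auto
  have M1: "M1 s \<le> 0" if s: "s < L" for s
  proof (rule ccontr)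
    assume "\<not> M1 s \<le> 0"
    then have pos: "M1 s > 0" by simp
    have mono: "M1 s \<le> M1 x" if "x \<le> s" for x
      using that s by (intro DERIV_nonpos_imp_nonincreasing[of x s M1]) (auto intro!: exI DM1 M2)
    \<comment> \<open>A tangent of positive slope would force the concave function below 0 at this point.\<close>
    define x where "x = s - (M s + 1) / M1 s"
    have x: "x < s" using pos M0[OF s] by (simp add: x_def add_nonneg_pos)
    obtain y where y: "x < y" "y < s" "M s - M x = (s - x) * M1 y"
      using MVT2[OF x, of M M1] DM s by auto
    have "(s - x) * M1 s \<le> (s - x) * M1 y"
      using y x mono[of y] by (intro mult_left_mono) auto
    then have "M s + 1 \<le> M s - M x"
      using pos y by (simp add: x_def)
    then show False using M0[of x] x s by simp
  qed
  have "M s2 \<le> M s1"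
    using assms by (intro DERIV_nonpos_imp_nonincreasing[of s1 s2 M]) (auto intro!: exI DM M1)
  then show ?thesis by (simp add: M_def)
qed

lemma holomorphic_partial_derivatives:
  assumes "k holomorphic_on U" "open U" "Complex s t \<in> U"
  shows "((\<lambda>s. Re (k (Complex s t))) has_real_derivative Re (deriv k (Complex s t))) (at s)"
    and "((\<lambda>s. Im (k (Complex s t))) has_real_derivative Im (deriv k (Complex s t))) (at s)"
    and "((\<lambda>t. Re (k (Complex s t))) has_real_derivative - Im (deriv k (Complex s t))) (at t)"
    and "((\<lambda>t. Im (k (Complex s t))) has_real_derivative Re (deriv k (Complex s t))) (at t)"
proof -
  have D: "(k has_field_derivative deriv k (Complex s t)) (at (Complex s t))"
    using assms by (rule holomorphic_derivI)
  have "((\<lambda>s. complex_of_real s + \<i> * t) has_vector_derivative 1) (at s)"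
    by (auto intro!: derivative_eq_intros simp: has_vector_derivative_def scaleR_conv_of_real)
  then have 1: "((\<lambda>s. Complex s t) has_vector_derivative 1) (at s)"
    by (simp add: Complex_eq)
  have "((\<lambda>t. complex_of_real s + \<i> * t) has_vector_derivative \<i>) (at t)"
    by (auto intro!: derivative_eq_intros simp: has_vector_derivative_def scaleR_conv_of_real)
  then have 2: "((\<lambda>t. Complex s t) has_vector_derivative \<i>) (at t)"
    by (simp add: Complex_eq)
  note 1 = field_vector_diff_chain_at[OF 1 D] and 2 = field_vector_diff_chain_at[OF 2 D]
  show "((\<lambda>s. Re (k (Complex s t))) has_real_derivative Re (deriv k (Complex s t))) (at s)"
    using bounded_linear.has_vector_derivative[OF bounded_linear_Re 1]
    by (simp add: o_def has_real_derivative_iff_has_vector_derivative)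
  show "((\<lambda>s. Im (k (Complex s t))) has_real_derivative Im (deriv k (Complex s t))) (at s)"
    using bounded_linear.has_vector_derivative[OF bounded_linear_Im 1]
    by (simp add: o_def has_real_derivative_iff_has_vector_derivative)
  show "((\<lambda>t. Re (k (Complex s t))) has_real_derivative - Im (deriv k (Complex s t))) (at t)"
    using bounded_linear.has_vector_derivative[OF bounded_linear_Re 2]
    by (simp add: o_def has_real_derivative_iff_has_vector_derivative)
  show "((\<lambda>t. Im (k (Complex s t))) has_real_derivative Re (deriv k (Complex s t))) (at t)"
    using bounded_linear.has_vector_derivative[OF bounded_linear_Im 2]
    by (simp add: o_def has_real_derivative_iff_has_vector_derivative)
qed

text \<open>For \<open>Y = 2 p - 3 v - 9 v\<^sup>2\<close> with \<open>p\<close> harmonic and \<open>v\<close> of Laplacian \<open>4 |\<nabla>p|\<^sup>2\<close>, the left side is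
  \<open>\<Delta>Y + |\<nabla>Y|\<^sup>2\<close>, the factor of \<open>exp Y\<close> in \<open>\<Delta>(exp Y)\<close>; the gradient of \<open>p\<close> is \<open>(p1, - q1)\<close>. With
  \<open>b = 3 + 18 v\<close> one has \<open>|\<nabla>Y|\<^sup>2 \<le> 8 |\<nabla>p|\<^sup>2 + 2 b\<^sup>2 |\<nabla>v|\<^sup>2\<close>. The first term is absorbed by
  \<open>- b \<Delta>v = - 4 b |\<nabla>p|\<^sup>2\<close> if \<open>b \<ge> 2\<close>, and the second one by \<open>- 18 |\<nabla>v|\<^sup>2\<close> if \<open>b \<le> 3\<close>. This is where the
  range \<open>[- 1 / 18, 0]\<close> of \<open>v\<close> comes from.\<close>

lemma exp_Laplacian_le_0:
  fixes p1 q1 v vs vt vss vtt p2 :: real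
  assumes v: "- 1 / 18 \<le> v" "v \<le> 0" and lap: "vss + vtt = 4 * (p1\<^sup>2 + q1\<^sup>2)"
  shows "(2 * p2 - 18 * vs\<^sup>2 - (3 + 18 * v) * vss + (2 * p1 - (3 + 18 * v) * vs)\<^sup>2)
    + (- 2 * p2 - 18 * vt\<^sup>2 - (3 + 18 * v) * vtt + (- 2 * q1 - (3 + 18 * v) * vt)\<^sup>2) \<le> 0"
proof -
  define b where "b = 3 + 18 * v"
  have b: "2 \<le> b" "b \<le> 3" using v by (auto simp: b_def)
  have 1: "(2 * p1 - b * vs)\<^sup>2 \<le> 8 * p1\<^sup>2 + 2 * b\<^sup>2 * vs\<^sup>2"
    using zero_le_power2[of "2 * p1 + b * vs"] by (simp add: power2_eq_square algebra_simps)
  have 2: "(- 2 * q1 - b * vt)\<^sup>2 \<le> 8 * q1\<^sup>2 + 2 * b\<^sup>2 * vt\<^sup>2"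
    using zero_le_power2[of "2 * q1 - b * vt"] by (simp add: power2_eq_square algebra_simps)
  have b9: "2 * b\<^sup>2 \<le> 18" using b power_mono[of b 3 2] by simp
  have 3: "2 * b\<^sup>2 * vs\<^sup>2 \<le> 18 * vs\<^sup>2" "2 * b\<^sup>2 * vt\<^sup>2 \<le> 18 * vt\<^sup>2"
    using b9 by (intro mult_right_mono; simp)+
  have "0 \<le> vss + vtt"
    unfolding lap by simp
  from mult_right_mono[OF b(1) this] have "2 * vss + 2 * vtt \<le> b * vss + b * vtt"
    by (simp only: distrib_left)
  moreover have "8 * p1\<^sup>2 + 8 * q1\<^sup>2 = 2 * vss + 2 * vtt"
    using lap by simp
  ultimately have 4: "8 * p1\<^sup>2 + 8 * q1\<^sup>2 \<le> b * vss + b * vtt"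
    by (simp only:)
  have 5: "(2 * p1 - b * vs)\<^sup>2 \<le> 8 * p1\<^sup>2 + 18 * vs\<^sup>2"
    by (rule order_trans[OF 1 add_left_mono[OF 3(1)]])
  have 6: "(- 2 * q1 - b * vt)\<^sup>2 \<le> 8 * q1\<^sup>2 + 18 * vt\<^sup>2"
    by (rule order_trans[OF 2 add_left_mono[OF 3(2)]])
  have "(2 * p2 - A - S + X) + (- 2 * p2 - B - T + Y) \<le> 0"
    if "X \<le> P + A" "Y \<le> Q + B" "P + Q \<le> S + T" for A B S T X Y P Q
    using that by simp
  from this[OF 5 6 4] show ?thesis
    unfolding b_def[symmetric] .
qed

text \<open>The function \<open>W\<close> is superharmonic by \<open>exp_Laplacian_le_0\<close>, because \<open>|h|\<^sup>2\<close> has Laplacian \<open>4 |h'|\<^sup>2\<close> and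
  \<open>Re F\<close> is harmonic. Its circle averages decrease with the radius, and they tend to \<open>W 0\<close> as the radius
  tends to 0.\<close>

lemma circle_avg_exp_superharmonic:
  assumes h: "h holomorphic_on ball 0 R" and F: "F holomorphic_on ball 0 R"
    and bd: "\<And>z. cmod z < R \<Longrightarrow> (cmod (h z))\<^sup>2 \<le> Re (F z) \<and> Re (F z) \<le> (cmod (h z))\<^sup>2 + 1 / 18"
    and r: "0 < r" "r < R"
    and W_def: "W = (\<lambda>z. exp (2 * Re (h z) - 3 * ((cmod (h z))\<^sup>2 - Re (F z)) - 9 * ((cmod (h z))\<^sup>2 - Re (F z))\<^sup>2))"
  shows "circle_avg r W \<le> W 0"
proof -
  have R: "0 < R" using r by simp
  define U where "U = {z::complex. Re z < ln R}"
  have U: "open U" unfolding U_def by (rule open_halfspace_Re_lt)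
  have expU: "exp z \<in> ball 0 R" if "z \<in> U" for z
  proof -
    have "exp (Re z) < exp (ln R)" using that by (simp add: U_def)
    then show ?thesis using R by simp
  qed
  have exp2: "(\<lambda>z. k (exp z)) holomorphic_on U" if "k holomorphic_on ball 0 R" for k
    using holomorphic_on_compose_gen[OF holomorphic_on_exp that image_subsetI, OF expU] by (simp add: o_def)
  have der: "deriv (\<lambda>z. k (exp z)) z = deriv k (exp z) * exp z" if "k holomorphic_on ball 0 R" "z \<in> U" for k z
  proof -
    have "(k has_field_derivative deriv k (exp z)) (at (exp z))"
      using that(1) expU[OF that(2)] by (intro holomorphic_derivI[of _ "ball 0 R"]) auto
    from DERIV_chain2[OF this DERIV_exp] show ?thesis by (rule DERIV_imp_deriv)
  qed
  \<comment> \<open>Everything is computed in the variable \<open>log z\<close>, where the circle of radius \<open>exp s\<close> is a vertical segment;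
    \<open>s\<close> and \<open>t\<close> in a name mark derivatives in its real and imaginary direction.\<close>
  define h0 where "h0 = (\<lambda>z. h (exp z))"
  define h1 where "h1 = deriv h0"
  define h2 where "h2 = deriv h1"
  define F0 where "F0 = (\<lambda>z. F (exp z))"
  define F1 where "F1 = deriv F0"
  define F2 where "F2 = deriv F1"
  have hol: "h0 holomorphic_on U" "h1 holomorphic_on U" "h2 holomorphic_on U"
     "F0 holomorphic_on U" "F1 holomorphic_on U" "F2 holomorphic_on U"
    unfolding h2_def h1_def F2_def F1_def h0_def F0_def
    by (intro holomorphic_deriv exp2 h F U)+
  define v where "v = (\<lambda>z. (Re (h0 z))\<^sup>2 + (Im (h0 z))\<^sup>2 - Re (F0 z))"
  define vs where "vs = (\<lambda>z. 2 * Re (h0 z) * Re (h1 z) + 2 * Im (h0 z) * Im (h1 z) - Re (F1 z))"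
  define vt where "vt = (\<lambda>z. - 2 * Re (h0 z) * Im (h1 z) + 2 * Im (h0 z) * Re (h1 z) + Im (F1 z))"
  define vss where "vss = (\<lambda>z. 2 * (Re (h1 z))\<^sup>2 + 2 * (Im (h1 z))\<^sup>2
      + 2 * Re (h0 z) * Re (h2 z) + 2 * Im (h0 z) * Im (h2 z) - Re (F2 z))"
  define vtt where "vtt = (\<lambda>z. 2 * (Re (h1 z))\<^sup>2 + 2 * (Im (h1 z))\<^sup>2
      - 2 * Re (h0 z) * Re (h2 z) - 2 * Im (h0 z) * Im (h2 z) + Re (F2 z))"
  define w where "w = (\<lambda>z. exp (2 * Re (h0 z) - 3 * v z - 9 * (v z)\<^sup>2))"
  define ys where "ys = (\<lambda>z. 2 * Re (h1 z) - (3 + 18 * v z) * vs z)"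
  define yt where "yt = (\<lambda>z. - 2 * Im (h1 z) - (3 + 18 * v z) * vt z)"
  define yss where "yss = (\<lambda>z. 2 * Re (h2 z) - 18 * (vs z)\<^sup>2 - (3 + 18 * v z) * vss z)"
  define ytt where "ytt = (\<lambda>z. - 2 * Re (h2 z) - 18 * (vt z)\<^sup>2 - (3 + 18 * v z) * vtt z)"
  have Uc: "Complex s t \<in> U" if "s < ln R" for s t using that by (simp add: U_def)
  note ph0 = holomorphic_partial_derivatives[OF hol(1) U Uc, folded h1_def]
  note ph1 = holomorphic_partial_derivatives[OF hol(2) U Uc, folded h2_def]
  note pF0 = holomorphic_partial_derivatives[OF hol(4) U Uc, folded F1_def]
  note pF1 = holomorphic_partial_derivatives[OF hol(5) U Uc, folded F2_def]
  have Dvs: "((\<lambda>s. v (Complex s t)) has_real_derivative vs (Complex s t)) (at s)" if "s < ln R" for s t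
    unfolding v_def vs_def
    by (rule derivative_eq_intros ph0 pF0 that refl)+ (simp add: algebra_simps)
  have Dvt: "((\<lambda>t. v (Complex s t)) has_real_derivative vt (Complex s t)) (at t)" if "s < ln R" for s t
    unfolding v_def vt_def
    by (rule derivative_eq_intros ph0 pF0 that refl)+ (simp add: algebra_simps)
  have Dvss: "((\<lambda>s. vs (Complex s t)) has_real_derivative vss (Complex s t)) (at s)" if "s < ln R" for s t
    unfolding vs_def vss_def
    by (rule derivative_eq_intros ph0 ph1 pF1 that refl)+ (simp add: algebra_simps power2_eq_square)
  have Dvtt: "((\<lambda>t. vt (Complex s t)) has_real_derivative vtt (Complex s t)) (at t)" if "s < ln R" for s t
    unfolding vt_def vtt_def
    by (rule derivative_eq_intros ph0 ph1 pF1 that refl)+ (simp add: algebra_simps power2_eq_square)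
  have Dws: "((\<lambda>s. w (Complex s t)) has_real_derivative w (Complex s t) * ys (Complex s t)) (at s)" if "s < ln R" for s t
    unfolding w_def ys_def
    by (rule derivative_eq_intros ph0 Dvs that refl)+ (simp add: algebra_simps)
  have Dwt: "((\<lambda>t. w (Complex s t)) has_real_derivative w (Complex s t) * yt (Complex s t)) (at t)" if "s < ln R" for s t
    unfolding w_def yt_def
    by (rule derivative_eq_intros ph0 Dvt that refl)+ (simp add: algebra_simps)
  have Dys: "((\<lambda>s. ys (Complex s t)) has_real_derivative yss (Complex s t)) (at s)" if "s < ln R" for s t
    unfolding ys_def yss_def
    by (rule derivative_eq_intros ph1 Dvs Dvss that refl)+ (simp add: algebra_simps power2_eq_square)
  have Dyt: "((\<lambda>t. yt (Complex s t)) has_real_derivative ytt (Complex s t)) (at t)" if "s < ln R" for s t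
    unfolding yt_def ytt_def
    by (rule derivative_eq_intros ph1 Dvt Dvtt that refl)+ (simp add: algebra_simps power2_eq_square)
  define wss where "wss = (\<lambda>z. w z * (yss z + (ys z)\<^sup>2))"
  define wtt where "wtt = (\<lambda>z. w z * (ytt z + (yt z)\<^sup>2))"
  have Dwss: "((\<lambda>s. w (Complex s t) * ys (Complex s t)) has_real_derivative wss (Complex s t)) (at s)" if "s < ln R" for s t
    unfolding wss_def
    by (rule derivative_eq_intros Dws Dys that refl)+ (simp add: algebra_simps power2_eq_square)
  have Dwtt: "((\<lambda>t. w (Complex s t) * yt (Complex s t)) has_real_derivative wtt (Complex s t)) (at t)" if "s < ln R" for s t
    unfolding wtt_def
    by (rule derivative_eq_intros Dwt Dyt that refl)+ (simp add: algebra_simps power2_eq_square)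
  have cont: "continuous_on U h0" "continuous_on U h1" "continuous_on U h2"
     "continuous_on U F0" "continuous_on U F1" "continuous_on U F2"
    by (intro holomorphic_on_imp_continuous_on hol)+
  have cws: "continuous_on U (\<lambda>z. w z * ys z)"
    unfolding w_def ys_def v_def vs_def by (intro continuous_intros cont)
  have cwss: "continuous_on U wss"
    unfolding wss_def w_def ys_def yss_def v_def vs_def vss_def by (intro continuous_intros cont)
  have cc: "continuous_on ({..<ln R} \<times> {0..2*pi}) (\<lambda>(s,t). g (Complex s t))"
    if "continuous_on U g" for g :: "complex \<Rightarrow> real"
  proof -
    have "continuous_on ({..<ln R} \<times> {0..2*pi}) (\<lambda>x. Complex (fst x) (snd x))"
      unfolding Complex_eq by (intro continuous_intros)
    from continuous_on_compose2[OF that this] show ?thesis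
      by (simp add: case_prod_beta U_def image_subset_iff)
  qed
  have vbd: "- 1 / 18 \<le> v z" "v z \<le> 0" if "z \<in> U" for z
    using bd[of "exp z"] expU[OF that] unfolding v_def h0_def F0_def cmod_power2 by auto
  have w_exp: "w z = W (exp z)" for z
    by (simp add: w_def W_def v_def h0_def F0_def cmod_power2)
  have per: "yt (Complex s (2*pi)) = yt (Complex s 0)" "w (Complex s (2*pi)) = w (Complex s 0)" if "s < ln R" for s
  proof -
    have e: "exp (Complex s (2*pi)) = exp (Complex s 0)" by (simp add: complex_eq_iff Re_exp Im_exp)
    have "h1 (Complex s (2*pi)) = h1 (Complex s 0)" "F1 (Complex s (2*pi)) = F1 (Complex s 0)"
      unfolding h1_def F1_def h0_def F0_def using der[OF h Uc[OF that]] der[OF F Uc[OF that]] by (simp_all add: e)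
    then show "yt (Complex s (2*pi)) = yt (Complex s 0)" "w (Complex s (2*pi)) = w (Complex s 0)"
      by (simp_all add: yt_def vt_def v_def h0_def F0_def e w_exp)
  qed
  have mono: "integral {0..2*pi} (\<lambda>t. w (Complex s2 t)) \<le> integral {0..2*pi} (\<lambda>t. w (Complex s1 t))"
    if "s1 \<le> s2" "s2 < ln R" for s1 s2
  proof (rule circle_integral_antimono[where L = "ln R" and P = "\<lambda>s t. w (Complex s t)"
        and Ps = "\<lambda>s t. w (Complex s t) * ys (Complex s t)" and Pss = "\<lambda>s t. wss (Complex s t)"
        and Pt = "\<lambda>s t. w (Complex s t) * yt (Complex s t)" and Ptt = "\<lambda>s t. wtt (Complex s t)"])
    fix s t assume s: "s < ln R"
    let ?z = "Complex s t"
    have "(yss ?z + (ys ?z)\<^sup>2) + (ytt ?z + (yt ?z)\<^sup>2) \<le> 0"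
      unfolding yss_def ys_def ytt_def yt_def
      by (rule exp_Laplacian_le_0) (use vbd[OF Uc[OF s, of t]] in \<open>auto simp: vss_def vtt_def\<close>)
    moreover have "0 \<le> w ?z" by (simp add: w_def)
    ultimately show "wss ?z + wtt ?z \<le> 0"
      unfolding wss_def wtt_def distrib_left[symmetric] by (rule mult_nonneg_nonpos[rotated])
    show "0 \<le> w ?z" by fact
  qed (use Dws Dwt Dwss Dwtt cc[OF cws] cc[OF cwss] per that in auto)
  have avg: "circle_avg x W = integral {0..2*pi} (\<lambda>t. w (Complex (ln x) t)) / (2*pi)" if "0 < x" for x
  proof -
    have "exp (Complex (ln x) t) = of_real x * cis t" for t
      using that by (simp add: Complex_eq exp_add cis_conv_exp exp_of_real)
    then show ?thesis by (simp add: circle_avg_def w_exp)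
  qed
  have cW: "continuous_on (ball 0 R) W"
    unfolding W_def by (intro continuous_intros holomorphic_on_imp_continuous_on h F)
  have cWs: "continuous_on (sphere 0 x) W" if "x < R" for x
    by (rule continuous_on_subset[OF cW]) (use that in auto)
  show ?thesis
  proof (rule field_le_epsilon)
    fix e :: real assume e: "e > 0"
    have "continuous (at 0) W" using cW R by (simp add: continuous_on_eq_continuous_at)
    then obtain d where d: "d > 0" "\<And>z. cmod z < d \<Longrightarrow> \<bar>W z - W 0\<bar> < e"
      using e unfolding continuous_at_eps_delta dist_norm by auto
    define x where "x = min r (d / 2)"
    have x: "0 < x" "x \<le> r" "x < d" using r d by (auto simp: x_def)
    have "circle_avg r W \<le> circle_avg x W"
      using mono[of "ln x" "ln r"] x r by (auto simp: avg divide_right_mono)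
    also have "\<dots> \<le> circle_avg x (\<lambda>_. W 0 + e)"
    proof (rule circle_avg_mono)
      show "W z \<le> W 0 + e" if "cmod z = x" for z using d(2)[of z] that x by auto
    qed (use x r in \<open>auto intro!: cWs continuous_intros\<close>)
    finally show "circle_avg r W \<le> W 0 + e" by (simp add: circle_avg_const)
  qed
qed

text \<open>A John-Nirenberg inequality for analytic functions. The majorant \<open>Re F\<close> is constructed once for \<open>h\<close>
  and transported by \<open>\<sigma>\<^sub>a\<close>, which keeps it harmonic; so the super-mean-value property is only ever used
  at the centre 0. There \<open>- v\<close> is at most \<open>\<epsilon>\<^sup>2\<close>, and on the circle \<open>v \<le> 0\<close> makes \<open>W\<close> dominate \<open>|exp k|\<^sup>2\<close>.\<close>

lemma mean_osc_exp_bound: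
  assumes h: "h holomorphic_on unit_disc" and \<epsilon>: "0 \<le> \<epsilon>" "\<epsilon>\<^sup>2 \<le> 1 / 18"
    and osc: "\<And>a. cmod a < 1 \<Longrightarrow> mean_osc h a \<le> ennreal \<epsilon>"
    and a: "cmod a < 1" and r: "0 < r" "r < 1"
  shows "circle_avg r (\<lambda>z. exp (2 * Re (h (disc_aut a z) - h a))) \<le> exp (3 * \<epsilon>\<^sup>2)"
proof -
  define r' where "r' = (r + 1) / 2"
  have r': "r < r'" "r' < 1" using r by (auto simp: r'_def)
  obtain R where R: "0 < R" "R < 1" "\<And>z. cmod z \<le> r' \<Longrightarrow> cmod (disc_aut a z) < R"
    using disc_aut_cball_bound[OF a r'(2)] by blast
  obtain F where F: "F holomorphic_on ball 0 R"
    "\<And>z. cmod z < R \<Longrightarrow> (cmod (h z))\<^sup>2 \<le> Re (F z) \<and> Re (F z) \<le> (cmod (h z))\<^sup>2 + \<epsilon>\<^sup>2"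
    using harmonic_majorant[OF h R(1,2) \<epsilon>(1) osc] by metis
  define k where "k = (\<lambda>z. h (disc_aut a z))"
  define G where "G = (\<lambda>z. F (disc_aut a z))"
  have aut: "disc_aut a holomorphic_on ball 0 r'"
    using disc_aut_holomorphic[OF a] by (rule holomorphic_on_subset) (use r' in auto)
  have sub: "disc_aut a ` ball 0 r' \<subseteq> ball 0 R" using R(3) by (force simp: image_subset_iff)
  have G: "G holomorphic_on ball 0 r'"
    using holomorphic_on_compose_gen[OF aut F(1) sub] by (simp add: G_def o_def)
  have k: "k holomorphic_on ball 0 r'"
    using holomorphic_on_compose_gen[OF aut h order_trans[OF sub]] R(2) by (simp add: k_def o_def subset_ball)
  define v where "v = (\<lambda>z. (cmod (k z))\<^sup>2 - Re (G z))"
  define W where "W = (\<lambda>z. exp (2 * Re (k z) - 3 * v z - 9 * (v z)\<^sup>2))"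
  have bd: "(cmod (k z))\<^sup>2 \<le> Re (G z) \<and> Re (G z) \<le> (cmod (k z))\<^sup>2 + \<epsilon>\<^sup>2" if "cmod z < r'" for z
    unfolding k_def G_def using that by (intro F(2) R(3)) auto
  have super: "circle_avg r W \<le> W 0"
    by (rule circle_avg_exp_superharmonic[OF k G _ r(1) r'(1)])
      (use bd \<epsilon>(2) in \<open>force simp: W_def v_def\<close>)+
  have ck: "continuous_on (sphere 0 r) k" "continuous_on (sphere 0 r) G"
    using r' by (auto intro!: continuous_on_subset[OF holomorphic_on_imp_continuous_on[OF k]]
        continuous_on_subset[OF holomorphic_on_imp_continuous_on[OF G]])
  have "circle_avg r (\<lambda>z. exp (2 * Re (k z))) \<le> circle_avg r W"
  proof (rule circle_avg_mono)
    show "exp (2 * Re (k z)) \<le> W z" if "cmod z = r" for z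
    proof -
      have "- 1 / 18 \<le> v z" "v z \<le> 0" using bd[of z] that r' \<epsilon>(2) by (auto simp: v_def)
      then have "0 \<le> (- v z) * (3 + 9 * v z)" by (intro mult_nonneg_nonneg) auto
      then show ?thesis by (simp add: W_def power2_eq_square algebra_simps)
    qed
  qed (unfold W_def v_def, (intro continuous_intros ck r)+)
  also have "circle_avg r W \<le> exp (2 * Re (h a)) * exp (3 * \<epsilon>\<^sup>2)"
  proof -
    have "0 < r'" using r r' by simp
    then have "- (\<epsilon>\<^sup>2) \<le> v 0" using bd[of 0] by (simp add: v_def)
    then have "- 3 * v 0 - 9 * (v 0)\<^sup>2 \<le> 3 * \<epsilon>\<^sup>2" using zero_le_power2[of "v 0"] by linarith
    then have "W 0 \<le> exp (2 * Re (h a) + 3 * \<epsilon>\<^sup>2)"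
      by (simp add: W_def k_def disc_aut_at_0)
    with super show ?thesis by (simp add: exp_add)
  qed
  finally have "exp (- 2 * Re (h a)) * circle_avg r (\<lambda>z. exp (2 * Re (k z)))
      \<le> exp (- 2 * Re (h a)) * (exp (2 * Re (h a)) * exp (3 * \<epsilon>\<^sup>2))"
    by (intro mult_left_mono) auto
  also have "\<dots> = exp (3 * \<epsilon>\<^sup>2)" by (simp add: exp_minus field_simps)
  also have "exp (- 2 * Re (h a)) * circle_avg r (\<lambda>z. exp (2 * Re (k z)))
      = circle_avg r (\<lambda>z. exp (2 * Re (h (disc_aut a z) - h a)))"
    by (simp add: circle_avg_cmult[symmetric] exp_add[symmetric] k_def algebra_simps)
  finally show ?thesis .
qed

section \<open>Membership in VMOA\<close>

abbreviation boundary_filter :: "complex filter"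
  where "boundary_filter \<equiv> filtercomap cmod (at_left 1)"

lemma eventually_boundary_disc: "\<forall>\<^sub>F a in boundary_filter. cmod a < 1"
  by (simp add: eventually_filtercomap)
    (rule exI[of _ "\<lambda>x. x < 1"], auto simp: eventually_at_filter)

lemma eventually_boundary_iff:
  "(\<forall>\<^sub>F a in boundary_filter. P a) \<longleftrightarrow> (\<exists>\<rho><1. \<forall>a. \<rho> < cmod a \<longrightarrow> cmod a < 1 \<longrightarrow> P a)"
  (is "?L \<longleftrightarrow> ?R")
proof
  assume ?L
  then obtain Q where "eventually Q (at_left 1)" "\<And>a. Q (cmod a) \<Longrightarrow> P a"
    by (auto simp: eventually_filtercomap)
  then show ?R by (auto simp: eventually_at_left_field)
next
  assume ?R
  then obtain \<rho> where "\<rho> < 1" "\<And>a. \<rho> < cmod a \<Longrightarrow> cmod a < 1 \<Longrightarrow> P a" by blast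
  then show ?L
    unfolding eventually_filtercomap
    by (intro exI[of _ "\<lambda>x. \<rho> < x \<and> x < 1"]) (auto simp: eventually_at_left_field)
qed

lemma mean_osc_cong:
  assumes "\<And>z. cmod z < 1 \<Longrightarrow> f z = g z" "cmod a < 1"
  shows "mean_osc f a = mean_osc g a"
proof -
  have "circle_mean r (\<lambda>z. f (disc_aut a z) - f a) = circle_mean r (\<lambda>z. g (disc_aut a z) - g a)"
    if "r \<in> {0<..<1}" for r
  proof -
    have "cmod (disc_aut a (of_real r * cis t)) < 1" for t
      using that by (intro norm_disc_aut_less assms) (simp add: norm_mult)
    then show ?thesis by (simp add: circle_mean_def assms)
  qed
  then show ?thesis unfolding mean_osc_def H2_norm_def by (intro SUP_cong) auto
qed

lemma mean_osc_on_disc: "cmod a < 1 \<Longrightarrow> mean_osc (on_disc f) a = mean_osc f a"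
  by (rule mean_osc_cong) (auto simp: on_disc_def)

lemma on_disc_analytic: "f holomorphic_on unit_disc \<Longrightarrow> on_disc f \<in> analytic_disc"
  unfolding analytic_disc_def
  by (auto simp: on_disc_def intro: holomorphic_transform)

lemma vmoaI:
  assumes f: "f \<in> analytic_disc" and bd: "\<And>a. cmod a < 1 \<Longrightarrow> mean_osc f a \<le> ennreal C"
    and small: "\<And>e. 0 < e \<Longrightarrow> \<forall>\<^sub>F a in boundary_filter. mean_osc f a \<le> ennreal e"
  shows "f \<in> vmoa"
proof -
  have "bmoa_seminorm f \<le> ennreal C"
    unfolding bmoa_seminorm_def by (intro SUP_least) (use bd in auto)
  then have "f \<in> bmoa"
    using f by (auto simp: bmoa_def less_top[symmetric] top_unique)
  moreover have "(mean_osc f \<longlongrightarrow> 0) boundary_filter"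
  proof (rule order_tendstoI)
    fix x :: ennreal assume "0 < x"
    then obtain y where y: "0 < y" "y < x" using dense by blast
    then obtain e where e: "0 < e" "ennreal e < x"
      by (cases y) auto
    show "\<forall>\<^sub>F a in boundary_filter. mean_osc f a < x"
      using small[OF e(1)] by eventually_elim (use e(2) in auto)
  qed auto
  ultimately show ?thesis by (simp add: vmoa_def)
qed

lemma vmoa_small:
  assumes "f \<in> vmoa" "0 < e"
  shows "\<forall>\<^sub>F a in boundary_filter. mean_osc f a \<le> ennreal e"
proof -
  have "(mean_osc f \<longlongrightarrow> 0) boundary_filter" using assms(1) by (simp add: vmoa_def)
  from order_tendstoD(2)[OF this, of "ennreal e"] assms(2)
  show ?thesis by (auto elim!: eventually_mono)
qed

lemma bmoa_norm_le:
  assumes "\<And>a. cmod a < 1 \<Longrightarrow> mean_osc f a \<le> ennreal C" "0 \<le> C"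
  shows "bmoa_norm f \<le> cmod (f 0) + C"
proof -
  have "bmoa_seminorm f \<le> ennreal C"
    unfolding bmoa_seminorm_def by (intro SUP_least) (use assms in auto)
  then have "enn2real (bmoa_seminorm f) \<le> C"
    using assms(2) by (simp add: enn2real_leI)
  then show ?thesis by (simp add: bmoa_norm_def)
qed

lemma mean_osc_le_bmoa_norm:
  assumes "f \<in> bmoa" "bmoa_norm f \<le> C" "cmod a < 1"
  shows "mean_osc f a \<le> ennreal C"
proof -
  have "mean_osc f a \<le> bmoa_seminorm f"
    unfolding bmoa_seminorm_def using assms(3) by (intro SUP_upper) auto
  also have "\<dots> = ennreal (enn2real (bmoa_seminorm f))"
    using assms(1) by (simp add: bmoa_def)
  also have "\<dots> \<le> ennreal C"
    using assms(2) norm_ge_zero[of "f 0"] unfolding bmoa_norm_def by (intro ennreal_leI) linarith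
  finally show ?thesis .
qed

context
  fixes f :: "complex \<Rightarrow> complex" and a :: complex and r :: real
  assumes f: "f holomorphic_on unit_disc" and a: "cmod a < 1" and r: "0 < r" "r < 1"
begin

lemma recentred_holomorphic: "(\<lambda>z. f (disc_aut a z) - f a) holomorphic_on cball 0 r"
  by (rule holomorphic_on_subset[OF holomorphic_disc_aut[OF f]]) (use a r in auto)

lemma recentred_continuous: "continuous_on (sphere 0 r) (\<lambda>z. f (disc_aut a z))"
proof -
  have "continuous_on (sphere 0 r) (\<lambda>z. (f (disc_aut a z) - f a) + f a)"
    by (intro continuous_intros continuous_on_subset[OF holomorphic_on_imp_continuous_on[OF recentred_holomorphic]]) auto
  then show ?thesis by simp
qed

lemma circle_avg_Re_recentred: "circle_avg r (\<lambda>z. Re (f (disc_aut a z) - f a)) = 0"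
  using circle_avg_Re[OF recentred_holomorphic r(1)] by (simp add: disc_aut_at_0)

lemma circle_avg_recentred_Im:
  "circle_avg r (\<lambda>z. (cmod (f (disc_aut a z) - f a))\<^sup>2)
    = circle_avg r (\<lambda>z. 2 * (Im (f (disc_aut a z) - f a))\<^sup>2)"
proof -
  let ?k = "\<lambda>z. f (disc_aut a z) - f a"
  have "(\<lambda>z. (?k z)\<^sup>2) holomorphic_on cball 0 r"
    by (intro holomorphic_intros recentred_holomorphic)
  from circle_avg_Re[OF this r(1)] have 0: "circle_avg r (\<lambda>z. Re ((?k z)\<^sup>2)) = 0"
    by (simp add: disc_aut_at_0)
  have "(cmod (?k z))\<^sup>2 = Re ((?k z)\<^sup>2) + 2 * (Im (?k z))\<^sup>2" for z
    unfolding cmod_power2 by (simp add: power2_eq_square algebra_simps)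
  then have "circle_avg r (\<lambda>z. (cmod (?k z))\<^sup>2) = circle_avg r (\<lambda>z. Re ((?k z)\<^sup>2) + 2 * (Im (?k z))\<^sup>2)"
    by simp
  also have "\<dots> = circle_avg r (\<lambda>z. 2 * (Im (?k z))\<^sup>2)"
    by (subst circle_avg_add) (auto intro!: continuous_intros recentred_continuous r simp: 0)
  finally show ?thesis .
qed

end

text \<open>An analytic function with bounded imaginary part is in BMOA, because the mean square of a recentred
  analytic function is twice that of its imaginary part: the real part of its square averages to 0.\<close>

lemma mean_osc_le_of_Im_bounded:
  assumes f: "f holomorphic_on unit_disc" and Im: "\<And>z. cmod z < 1 \<Longrightarrow> \<bar>Im (f z)\<bar> \<le> K" and a: "cmod a < 1"
  shows "mean_osc f a \<le> ennreal (4 * K)"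
proof -
  have K: "0 \<le> K" using Im[of 0] by simp
  have "circle_avg r (\<lambda>z. (cmod (f (disc_aut a z) - f a))\<^sup>2) \<le> (4 * K)\<^sup>2" if r: "0 < r" "r < 1" for r
  proof -
    note c = recentred_continuous[OF f a r]
    have "2 * (Im (f (disc_aut a z) - f a))\<^sup>2 \<le> (4 * K)\<^sup>2" if "cmod z = r" for z
    proof -
      have "\<bar>Im (f (disc_aut a z) - f a)\<bar> \<le> 2 * K"
        using Im[OF a] Im[of "disc_aut a z"] norm_disc_aut_less[OF a, of z] that r by auto
      then have "(Im (f (disc_aut a z) - f a))\<^sup>2 \<le> (2 * K)\<^sup>2" using power_mono[of "\<bar>Im (f (disc_aut a z) - f a)\<bar>" "2 * K" 2] by simp
      then have "2 * (Im (f (disc_aut a z) - f a))\<^sup>2 \<le> 8 * K\<^sup>2" by (simp add: power_mult_distrib)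
      also have "\<dots> \<le> (4 * K)\<^sup>2" by (simp add: power_mult_distrib)
      finally show ?thesis .
    qed
    then have "circle_avg r (\<lambda>z. 2 * (Im (f (disc_aut a z) - f a))\<^sup>2) \<le> circle_avg r (\<lambda>z. (4 * K)\<^sup>2)"
      by (intro circle_avg_mono continuous_intros c r)
    then show ?thesis by (simp add: circle_avg_recentred_Im[OF f a r] circle_avg_const)
  qed
  then show ?thesis using K by (simp add: mean_osc_le_iff)
qed

text \<open>As \<open>a\<close> tends to the boundary, \<open>\<sigma>\<^sub>a\<close> tends to a constant in mean square:
  \<open>|\<sigma>\<^sub>a - a|\<^sup>2\<close> averages to at most \<open>1 - |a|\<^sup>2\<close>. This places functions that are smooth up to the circle
  in VMOA.\<close>

lemma mean_osc_le_of_Lipschitz: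
  assumes f: "f holomorphic_on unit_disc" and a: "cmod a < 1" and L: "0 \<le> L"
    and lip: "\<And>z w. cmod z < 1 \<Longrightarrow> cmod w < 1 \<Longrightarrow> cmod (f z - f w) \<le> L * cmod (z - w)"
  shows "mean_osc f a \<le> ennreal (L * sqrt (1 - (cmod a)\<^sup>2))"
proof -
  have a1: "0 \<le> 1 - (cmod a)\<^sup>2" using a by (simp add: power_le_one)
  have "circle_avg r (\<lambda>z. (cmod (f (disc_aut a z) - f a))\<^sup>2) \<le> (L * sqrt (1 - (cmod a)\<^sup>2))\<^sup>2"
    if r: "0 < r" "r < 1" for r
  proof -
    have hol: "disc_aut a holomorphic_on cball 0 r"
      by (rule holomorphic_on_subset[OF disc_aut_holomorphic[OF a]]) (use r in auto)
    have c: "continuous_on (sphere 0 r) (disc_aut a)"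
      by (rule continuous_on_subset[OF holomorphic_on_imp_continuous_on[OF hol]]) auto
    have "circle_avg r (\<lambda>z. (cmod (f (disc_aut a z) - f a))\<^sup>2)
        \<le> circle_avg r (\<lambda>z. L\<^sup>2 * (cmod (disc_aut a z - a))\<^sup>2)"
    proof (intro circle_avg_mono continuous_intros recentred_continuous[OF f a r] c r)
      fix z assume "cmod z = r"
      then have "cmod (f (disc_aut a z) - f a) \<le> L * cmod (disc_aut a z - a)"
        using r a by (intro lip norm_disc_aut_less) auto
      then show "(cmod (f (disc_aut a z) - f a))\<^sup>2 \<le> L\<^sup>2 * (cmod (disc_aut a z - a))\<^sup>2"
        unfolding power_mult_distrib[symmetric] by (rule power_mono) simp
    qed
    also have "\<dots> = L\<^sup>2 * (circle_avg r (\<lambda>z. (cmod (disc_aut a z))\<^sup>2) - (cmod a)\<^sup>2)"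
      using poisson_int_norm_diff_square[OF hol, of 0] r
      by (simp add: circle_avg_cmult poisson_int_0 disc_aut_at_0)
    also have "\<dots> \<le> L\<^sup>2 * (circle_avg r (\<lambda>z. 1) - (cmod a)\<^sup>2)"
    proof (intro mult_left_mono diff_right_mono circle_avg_mono continuous_intros c r)
      show "(cmod (disc_aut a z))\<^sup>2 \<le> 1" if "cmod z = r" for z
        using norm_disc_aut_less[OF a, of z] that r by (simp add: power_le_one)
    qed auto
    finally show ?thesis using a1 by (simp add: circle_avg_const power_mult_distrib)
  qed
  then show ?thesis using L a1 by (simp add: mean_osc_le_iff)
qed

section \<open>Logarithmic test functions\<close>

text \<open>The logarithm of the Cauchy kernel \<open>1 / (1 - cnj b z)\<close>. As \<open>b\<close> tends to the circle these functions
  become unbounded, but they stay bounded in BMOA, and each of them with \<open>|b| < 1\<close> is in VMOA.\<close>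

definition log_kernel :: "complex \<Rightarrow> complex \<Rightarrow> complex"
  where "log_kernel b z = - Ln (1 - cnj b * z)"

lemma Re_kernel_pos:
  assumes "cmod b < 1" "cmod z < 1" shows "0 < Re (1 - cnj b * z)"
proof -
  have "cmod (cnj b * z) < 1"
    using assms mult_strict_mono'[of "cmod b" 1 "cmod z" 1] by (simp add: norm_mult)
  then show ?thesis using complex_Re_le_cmod[of "cnj b * z"] by (simp del: complex_Re_le_cmod)
qed

lemma log_kernel_has_derivative:
  assumes "cmod b < 1" "cmod z < 1"
  shows "(log_kernel b has_field_derivative cnj b / (1 - cnj b * z)) (at z)"
  unfolding log_kernel_def using Re_kernel_pos[OF assms]
  by (auto intro!: derivative_eq_intros simp: complex_nonpos_Reals_iff field_simps)

lemma log_kernel_holomorphic: "cmod b < 1 \<Longrightarrow> log_kernel b holomorphic_on unit_disc"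
  using log_kernel_has_derivative[of b] by (intro holomorphic_onI) (auto simp: field_differentiable_def intro: DERIV_subset)

lemma log_kernel_0 [simp]: "log_kernel b 0 = 0"
  by (simp add: log_kernel_def)

lemma log_kernel_Im: "cmod b < 1 \<Longrightarrow> cmod z < 1 \<Longrightarrow> \<bar>Im (log_kernel b z)\<bar> \<le> pi / 2"
  using Re_Ln_pos_lt_imp[OF Re_kernel_pos[of b z]] by (simp add: log_kernel_def)

lemma log_kernel_Lipschitz:
  assumes b: "cmod b < 1" and "cmod z < 1" "cmod w < 1"
  shows "cmod (log_kernel b z - log_kernel b w) \<le> 1 / (1 - cmod b) * cmod (z - w)"
proof (rule field_differentiable_bound[of unit_disc])
  fix z assume z: "z \<in> unit_disc"
  show "(log_kernel b has_field_derivative cnj b / (1 - cnj b * z)) (at z within unit_disc)"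
    using log_kernel_has_derivative[OF b, of z] z by (auto intro: DERIV_subset)
  have "1 - cmod b \<le> cmod (1 - cnj b * z)"
  proof -
    have "cmod b * cmod z \<le> cmod b * 1" using z by (intro mult_left_mono) auto
    then have "cmod (cnj b * z) \<le> cmod b" by (simp add: norm_mult)
    then show ?thesis using norm_triangle_ineq2[of 1 "cnj b * z"] by simp
  qed
  moreover have "cmod b \<le> 1" using b by simp
  ultimately show "cmod (cnj b / (1 - cnj b * z)) \<le> 1 / (1 - cmod b)"
    using b unfolding norm_divide complex_mod_cnj by (intro frac_le) auto
qed (use assms in auto)

lemma exp_2Re_log_kernel:
  assumes "cmod b < 1" "cmod z < 1"
  shows "exp (2 * Re (log_kernel b z)) = 1 / (cmod (1 - cnj b * z))\<^sup>2"
proof -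
  have nz: "1 - cnj b * z \<noteq> 0" by (rule disc_aut_denominator[OF assms])
  then have "Re (log_kernel b z) = - ln (cmod (1 - cnj b * z))"
    by (simp add: log_kernel_def)
  moreover have "exp (2 * - ln (cmod (1 - cnj b * z))) = (exp (- ln (cmod (1 - cnj b * z))))\<^sup>2"
    by (simp only: exp_double)
  ultimately show ?thesis using nz by (simp add: exp_minus power_divide field_simps)
qed

lemma log_kernel_vmoa:
  assumes b: "cmod b < 1" shows "on_disc (log_kernel b) \<in> vmoa"
proof (rule vmoaI)
  show "on_disc (log_kernel b) \<in> analytic_disc"
    by (intro on_disc_analytic log_kernel_holomorphic b)
  show "mean_osc (on_disc (log_kernel b)) a \<le> ennreal (4 * (pi / 2))" if "cmod a < 1" for a
    using mean_osc_le_of_Im_bounded[OF log_kernel_holomorphic[OF b] log_kernel_Im[OF b] that]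
    by (simp add: mean_osc_on_disc[OF that])
  fix e :: real assume e: "0 < e"
  define L where "L = 1 / (1 - cmod b)"
  have L: "0 \<le> L" using b by (simp add: L_def)
  have "((\<lambda>x. L * sqrt (1 - x\<^sup>2)) \<longlongrightarrow> L * sqrt (1 - 1\<^sup>2)) (at_left 1)"
    by (intro tendsto_intros)
  then have "\<forall>\<^sub>F x in at_left 1. L * sqrt (1 - x\<^sup>2) < e"
    using e by (intro order_tendstoD(2)) auto
  then have "\<forall>\<^sub>F a in boundary_filter. L * sqrt (1 - (cmod a)\<^sup>2) < e"
    by (rule eventually_filtercomapI)
  with eventually_boundary_disc show "\<forall>\<^sub>F a in boundary_filter. mean_osc (on_disc (log_kernel b)) a \<le> ennreal e"
  proof eventually_elim
    case (elim a)
    have "mean_osc (log_kernel b) a \<le> ennreal (L * sqrt (1 - (cmod a)\<^sup>2))"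
      using log_kernel_Lipschitz[OF b] unfolding L_def[symmetric]
      by (intro mean_osc_le_of_Lipschitz log_kernel_holomorphic b elim L)
    also have "\<dots> \<le> ennreal e" using elim by (intro ennreal_leI) simp
    finally show ?case by (simp add: mean_osc_on_disc elim)
  qed
qed

text \<open>Precomposing a Cauchy kernel with \<open>\<sigma>\<^sub>c\<close> yields a quotient of two Cauchy kernels, with parameters
  \<open>\<sigma>\<^sub>c b\<close> and \<open>c\<close>, up to a constant factor; evaluation at \<open>w = c\<close> shows that recentring removes it.\<close>

lemma log_kernel_disc_aut:
  assumes b: "cmod b < 1" and c: "cmod c < 1" and w: "cmod w < 1"
  defines "h \<equiv> (\<lambda>z. log_kernel (disc_aut c b) z - log_kernel c z)"
  shows "exp (2 * Re (h w - h c)) = 1 / (cmod (1 - cnj b * disc_aut c w))\<^sup>2"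
proof -
  define b' where "b' = disc_aut c b"
  have b': "cmod b' < 1" unfolding b'_def by (rule norm_disc_aut_less[OF c b])
  have nz: "1 - cnj b * c \<noteq> 0" "1 - cnj c * w \<noteq> 0" "1 - cnj c * c \<noteq> 0" "1 - cnj b' * w \<noteq> 0" "1 - cnj b' * c \<noteq> 0"
    by (rule disc_aut_denominator; fact)+
  have nz': "1 - c * cnj b \<noteq> 0" using nz(1) by (simp add: mult.commute)
  have cb': "cnj b' = (cnj c - cnj b) / (1 - c * cnj b)"
    by (simp add: b'_def disc_aut_def)
  have id: "1 - cnj b * disc_aut c x = (1 - cnj b * c) * (1 - cnj b' * x) / (1 - cnj c * x)"
    if x: "1 - cnj c * x \<noteq> 0" for x
  proof -
    have "(1 - cnj b * c) * (1 - cnj b' * x) = (1 - cnj b * c) - (cnj c - cnj b) * x"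
    proof -
      have "D * (1 - N / D * x) = D - N * x" if "D \<noteq> 0" for D N :: complex
        using that by (simp add: field_simps)
      from this[OF nz(1)] show ?thesis
        unfolding cb' mult.commute[of c "cnj b"] .
    qed
    also have "\<dots> = (1 - cnj c * x) - cnj b * (c - x)"
      by (simp add: algebra_simps)
    finally have num: "(1 - cnj b * c) * (1 - cnj b' * x) = (1 - cnj c * x) - cnj b * (c - x)" .
    have "1 - B * (N / E) = (E - B * N) / E" if "E \<noteq> 0" for B N E :: complex
      using that by (simp add: field_simps)
    from this[OF x] show ?thesis
      unfolding num disc_aut_def .
  qed
  have eq1: "1 = (1 - cnj b * c) * (1 - cnj b' * c) / (1 - cnj c * c)"
    using id[OF nz(3)] by (simp add: disc_aut_self)
  have "exp (2 * Re (h w - h c)) = exp (2 * Re (log_kernel b' w)) * exp (2 * Re (log_kernel c c))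
      / (exp (2 * Re (log_kernel c w)) * exp (2 * Re (log_kernel b' c)))"
    by (simp add: h_def b'_def[symmetric] exp_add[symmetric] exp_diff[symmetric] algebra_simps)
  also have "\<dots> = (cmod ((1 - cnj c * w) * (1 - cnj b' * c) / ((1 - cnj b' * w) * (1 - cnj c * c))))\<^sup>2"
    using b' c w by (simp add: exp_2Re_log_kernel norm_mult norm_divide power_mult_distrib power_divide)
  also have "(1 - cnj c * w) * (1 - cnj b' * c) / ((1 - cnj b' * w) * (1 - cnj c * c))
      = ((1 - cnj b * c) * (1 - cnj b' * c) / (1 - cnj c * c)) / ((1 - cnj b * c) * (1 - cnj b' * w) / (1 - cnj c * w))"
    using nz by (simp add: divide_simps del: mult_eq_0_iff)
  also have "\<dots> = 1 / (1 - cnj b * disc_aut c w)"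
    using id[OF nz(2)] eq1 by simp
  finally show ?thesis by (simp add: norm_divide power_divide)
qed

section \<open>Kernel averages of the recentred symbol\<close>

lemma exp_le_quadratic:
  fixes y :: real
  assumes "\<bar>y\<bar> \<le> K" shows "exp y \<le> 1 + y + exp K * y\<^sup>2"
proof -
  obtain t where t: "\<bar>t\<bar> \<le> \<bar>y\<bar>" "exp y = (\<Sum>m<2. y ^ m / fact m) + exp t / fact 2 * y ^ 2"
    using Maclaurin_exp_le[of y 2] by auto
  have "exp t / 2 \<le> exp K" using t(1) assms by (smt (verit) exp_ge_zero exp_le_cancel_iff field_sum_of_halves)
  then have "exp t / 2 * y\<^sup>2 \<le> exp K * y\<^sup>2" by (rule mult_right_mono) simp
  then show ?thesis using t(2) by (simp add: numeral_2_eq_2)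
qed

text \<open>For a bounded function the exponential is controlled by its Taylor polynomial of degree 2: the linear
  term averages to 0, and the quadratic one to at most the square of the
  oscillation, up to a constant.\<close>

lemma circle_avg_exp_bounded:
  assumes g: "g holomorphic_on unit_disc" and M: "\<And>z. cmod z < 1 \<Longrightarrow> cmod (g z) \<le> M"
    and osc: "mean_osc g a \<le> ennreal \<delta>" "0 \<le> \<delta>" and a: "cmod a < 1" and r: "0 < r" "r < 1"
  shows "circle_avg r (\<lambda>z. exp (4 * Re (g (disc_aut a z) - g a))) \<le> 1 + 16 * exp (8 * M) * \<delta>\<^sup>2"
proof -
  note c = recentred_continuous[OF g a r]
  let ?k = "\<lambda>z. g (disc_aut a z) - g a"
  have "circle_avg r (\<lambda>z. exp (4 * Re (?k z)))
      \<le> circle_avg r (\<lambda>z. 1 + (4 * Re (?k z) + (16 * exp (8 * M)) * (cmod (?k z))\<^sup>2))"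
  proof (intro circle_avg_mono continuous_intros c r)
    fix z assume z: "cmod z = r"
    have k: "cmod (?k z) \<le> 2 * M"
      using norm_triangle_ineq4[of "g (disc_aut a z)" "g a"] M[OF a] M[of "disc_aut a z"]
        norm_disc_aut_less[OF a, of z] z r by simp
    have "exp (4 * Re (?k z)) \<le> 1 + 4 * Re (?k z) + exp (8 * M) * (4 * Re (?k z))\<^sup>2"
      using abs_Re_le_cmod[of "?k z"] k by (intro exp_le_quadratic) linarith
    also have "(4 * Re (?k z))\<^sup>2 = 16 * (Re (?k z))\<^sup>2" unfolding power_mult_distrib by simp
    also have "exp (8 * M) * (16 * (Re (?k z))\<^sup>2) \<le> exp (8 * M) * (16 * (cmod (?k z))\<^sup>2)"
      by (intro mult_left_mono) (auto simp: cmod_power2)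
    finally show "exp (4 * Re (?k z)) \<le> 1 + (4 * Re (?k z) + (16 * exp (8 * M)) * (cmod (?k z))\<^sup>2)"
      by (simp add: mult_ac)
  qed
  also have "\<dots> = 1 + (4 * circle_avg r (\<lambda>z. Re (?k z)) + (16 * exp (8 * M)) * circle_avg r (\<lambda>z. (cmod (?k z))\<^sup>2))"
  proof -
    have cR: "continuous_on (sphere 0 r) (\<lambda>z. 4 * Re (?k z))"
      "continuous_on (sphere 0 r) (\<lambda>z. (16 * exp (8 * M)) * (cmod (?k z))\<^sup>2)"
      by (intro continuous_intros c)+
    show ?thesis
      unfolding circle_avg_cmult[symmetric] circle_avg_add[OF cR r(1), symmetric]
      using circle_avg_add[OF continuous_on_const continuous_on_add[OF cR] r(1), of 1]
      by (simp only: circle_avg_const)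
  qed
  also have "\<dots> = 1 + (16 * exp (8 * M)) * circle_avg r (\<lambda>z. (cmod (?k z))\<^sup>2)"
    by (simp add: circle_avg_Re_recentred[OF g a r, simplified])
  also have "\<dots> \<le> 1 + (16 * exp (8 * M)) * \<delta>\<^sup>2"
    using osc r by (intro add_left_mono mult_left_mono) (auto simp: mean_osc_le_iff)
  finally show ?thesis .
qed

lemma mean_osc_diff_le:
  assumes "f holomorphic_on unit_disc" "g holomorphic_on unit_disc" "cmod a < 1"
    and "mean_osc f a \<le> ennreal x" "mean_osc g a \<le> ennreal y" "0 \<le> x" "0 \<le> y"
  shows "mean_osc (\<lambda>z. f z - g z) a \<le> ennreal (x + y)"
proof -
  have "mean_osc (on_disc (\<lambda>z. f z - g z)) a = mean_osc (\<lambda>z. on_disc f z - on_disc g z) a"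
    by (intro mean_osc_cong assms) (simp add: on_disc_def)
  also have "\<dots> \<le> mean_osc (on_disc f) a + mean_osc (on_disc g) a"
    using assms by (intro mean_osc_diff on_disc_analytic) auto
  also have "\<dots> \<le> ennreal x + ennreal y"
    using assms by (intro add_mono) (auto simp: mean_osc_on_disc)
  finally show ?thesis using assms by (simp add: mean_osc_on_disc)
qed

lemma mean_osc_double:
  assumes "mean_osc f a \<le> ennreal x" "0 \<le> x"
  shows "mean_osc (\<lambda>z. 2 * f z) a \<le> ennreal (2 * x)"
proof -
  have "(cmod (2 * f w - 2 * f a))\<^sup>2 = 4 * (cmod (f w - f a))\<^sup>2" for w
    unfolding right_diff_distrib[symmetric] norm_mult power_mult_distrib by simp
  then show ?thesis
    using assms by (simp add: mean_osc_le_iff circle_avg_cmult power_mult_distrib)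
qed

lemma disc_map_aut_holomorphic:
  assumes "\<phi> holomorphic_on unit_disc" "\<phi> ` unit_disc \<subseteq> unit_disc" "cmod a < 1"
  shows "(\<lambda>z. disc_aut (\<phi> a) (\<phi> (disc_aut a z))) holomorphic_on unit_disc"
    and "\<And>z. cmod z < 1 \<Longrightarrow> cmod (disc_aut (\<phi> a) (\<phi> (disc_aut a z))) < 1"
proof -
  have sub: "disc_aut a ` unit_disc \<subseteq> unit_disc" using disc_aut_in_disc[of a] assms(3) by auto
  have \<phi>: "cmod (\<phi> z) < 1" if "cmod z < 1" for z using assms(2) that by (auto simp: image_subset_iff)
  have 1: "(\<lambda>z. \<phi> (disc_aut a z)) holomorphic_on unit_disc"
    using holomorphic_on_compose_gen[OF disc_aut_holomorphic[OF assms(3)] assms(1) sub] by (simp add: o_def)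
  have sub2: "(\<lambda>z. \<phi> (disc_aut a z)) ` unit_disc \<subseteq> unit_disc" using sub assms(2) by blast
  show "(\<lambda>z. disc_aut (\<phi> a) (\<phi> (disc_aut a z))) holomorphic_on unit_disc"
    using holomorphic_on_compose_gen[OF 1 disc_aut_holomorphic[OF \<phi>[OF assms(3)]] sub2] by (simp add: o_def)
  show "cmod (disc_aut (\<phi> a) (\<phi> (disc_aut a z))) < 1" if "cmod z < 1" for z
    by (intro norm_disc_aut_less \<phi> assms that)
qed

text \<open>With \<open>c = \<phi> a\<close>, the kernel is the squared modulus of the exponential of \<open>h \<circ> \<sigma>\<^sub>a - h a\<close>, where \<open>h\<close> is the
  difference of the test functions with parameters \<open>\<sigma>\<^sub>c b\<close> and \<open>c\<close>, composed with \<open>\<phi>\<close>. Both parameters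
  depend on \<open>a\<close>, and they are replaced by members \<open>i\<close>, \<open>j\<close> of the net. This splits \<open>h\<close> into the bounded
  function \<open>g\<close> and an error \<open>e\<close> with \<open>mean_osc e \<le> 2 \<epsilon>\<close>. The inequality \<open>x y \<le> (x\<^sup>2 + y\<^sup>2) / 2\<close> separates
  the two exponentials at the price of doubling \<open>g\<close> and \<open>e\<close>, whence \<open>4 \<epsilon>\<close>.\<close>

lemma circle_avg_kernel_le:
  assumes \<phi>: "\<phi> holomorphic_on unit_disc" "\<phi> ` unit_disc \<subseteq> unit_disc"
    and net: "\<And>b. cmod b < 1 \<Longrightarrow> \<exists>b'\<in>N. \<forall>a. cmod a < 1 \<longrightarrow>
        mean_osc (\<lambda>z. log_kernel b (\<phi> z) - log_kernel b' (\<phi> z)) a \<le> ennreal \<epsilon>"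
    and N: "\<And>b. b \<in> N \<Longrightarrow> cmod b < 1"
    and \<epsilon>: "0 \<le> \<epsilon>" "(4 * \<epsilon>)\<^sup>2 \<le> 1 / 18"
    and M: "\<And>b z. b \<in> N \<Longrightarrow> cmod z < 1 \<Longrightarrow> cmod (log_kernel b z) \<le> M"
    and osc: "\<And>b c. b \<in> N \<Longrightarrow> c \<in> N \<Longrightarrow>
        mean_osc (\<lambda>z. log_kernel b (\<phi> z) - log_kernel c (\<phi> z)) a \<le> ennreal \<delta>"
    and \<delta>: "0 \<le> \<delta>" and a: "cmod a < 1" and b: "cmod b < 1" and r: "0 < r" "r < 1"
  shows "circle_avg r (\<lambda>z. 1 / (cmod (1 - cnj b * disc_aut (\<phi> a) (\<phi> (disc_aut a z))))\<^sup>2)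
    \<le> (1 + 16 * exp (16 * M) * \<delta>\<^sup>2) / 2 + exp (3 * (4 * \<epsilon>)\<^sup>2) / 2"
proof -
  have \<phi>1: "cmod (\<phi> z) < 1" if "cmod z < 1" for z using \<phi>(2) that by (auto simp: image_subset_iff)
  define c where "c = \<phi> a"
  have c: "cmod c < 1" unfolding c_def by (rule \<phi>1[OF a])
  define b' where "b' = disc_aut c b"
  have b': "cmod b' < 1" unfolding b'_def by (rule norm_disc_aut_less[OF c b])
  define K where "K = (\<lambda>b z. log_kernel b (\<phi> z))"
  have K: "K b holomorphic_on unit_disc" if "cmod b < 1" for b
    using holomorphic_on_compose_gen[OF \<phi>(1) log_kernel_holomorphic[OF that] \<phi>(2)] by (simp add: K_def o_def)
  obtain i where i: "i \<in> N" "\<And>a. cmod a < 1 \<Longrightarrow> mean_osc (\<lambda>z. K b' z - K i z) a \<le> ennreal \<epsilon>"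
    using net[OF b'] unfolding K_def by blast
  obtain j where j: "j \<in> N" "\<And>a. cmod a < 1 \<Longrightarrow> mean_osc (\<lambda>z. K c z - K j z) a \<le> ennreal \<epsilon>"
    using net[OF c] unfolding K_def by blast
  define g where "g = (\<lambda>z. K i z - K j z)"
  define e where "e = (\<lambda>z. (K b' z - K i z) - (K c z - K j z))"
  have hol: "g holomorphic_on unit_disc" "e holomorphic_on unit_disc" "(\<lambda>z. 2 * e z) holomorphic_on unit_disc"
    unfolding g_def e_def by (intro holomorphic_intros K b' c N i j)+
  have osc_e: "mean_osc (\<lambda>z. 2 * e z) x \<le> ennreal (4 * \<epsilon>)" if "cmod x < 1" for x
  proof -
    have "mean_osc e x \<le> ennreal (\<epsilon> + \<epsilon>)"
      unfolding e_def by (intro mean_osc_diff_le holomorphic_intros K b' c N i j that \<epsilon>)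
    from mean_osc_double[OF this] show ?thesis using \<epsilon> by simp
  qed
  have osc_g: "mean_osc g a \<le> ennreal \<delta>"
    using osc[OF i(1) j(1)] by (simp add: g_def K_def)
  have "cmod (g z) \<le> 2 * M" if "cmod z < 1" for z
    using norm_triangle_ineq4[of "K i z" "K j z"] M[OF i(1) \<phi>1[OF that]] M[OF j(1) \<phi>1[OF that]]
    by (simp add: g_def K_def)
  then have avg_g: "circle_avg r (\<lambda>z. exp (4 * Re (g (disc_aut a z) - g a))) \<le> 1 + 16 * exp (16 * M) * \<delta>\<^sup>2"
    using circle_avg_exp_bounded[OF hol(1) _ osc_g \<delta> a r, of "2 * M"] by simp
  have avg_e: "circle_avg r (\<lambda>z. exp (2 * Re (2 * e (disc_aut a z) - 2 * e a))) \<le> exp (3 * (4 * \<epsilon>)\<^sup>2)"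
    using mean_osc_exp_bound[OF hol(3) _ \<epsilon>(2) osc_e a r] \<epsilon>(1) by simp
  note cont = recentred_continuous[OF hol(1) a r] recentred_continuous[OF hol(2) a r]
  have cont_K: "continuous_on (sphere 0 r) (\<lambda>z. 1 / (cmod (1 - cnj b * disc_aut (\<phi> a) (\<phi> (disc_aut a z))))\<^sup>2)"
  proof -
    have "continuous_on (sphere 0 r) (\<lambda>z. disc_aut (\<phi> a) (\<phi> (disc_aut a z)))"
      by (rule continuous_on_subset[OF holomorphic_on_imp_continuous_on[OF disc_map_aut_holomorphic(1)[OF \<phi> a]]])
        (use r in auto)
    then show ?thesis
      using disc_aut_denominator[OF b disc_map_aut_holomorphic(2)[OF \<phi> a]] r
      by (intro continuous_intros) auto
  qed
  have "circle_avg r (\<lambda>z. 1 / (cmod (1 - cnj b * disc_aut (\<phi> a) (\<phi> (disc_aut a z))))\<^sup>2)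
      \<le> circle_avg r (\<lambda>z. (1/2) * exp (4 * Re (g (disc_aut a z) - g a))
          + (1/2) * exp (2 * Re (2 * e (disc_aut a z) - 2 * e a)))"
  proof (rule circle_avg_mono[OF cont_K _ r(1)])
    show "continuous_on (sphere 0 r) (\<lambda>z. (1/2) * exp (4 * Re (g (disc_aut a z) - g a))
          + (1/2) * exp (2 * Re (2 * e (disc_aut a z) - 2 * e a)))"
      by (intro continuous_intros cont)
    fix z assume "cmod z = r"
    then have z: "cmod (disc_aut a z) < 1" using r by (intro norm_disc_aut_less a) auto
    define x where "x = Re (g (disc_aut a z) - g a)"
    define y where "y = Re (e (disc_aut a z) - e a)"
    have "1 / (cmod (1 - cnj b * disc_aut (\<phi> a) (\<phi> (disc_aut a z))))\<^sup>2 = exp (2 * (x + y))"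
      using log_kernel_disc_aut[OF b c \<phi>1[OF z]]
      by (simp add: x_def y_def g_def e_def K_def c_def b'_def algebra_simps)
    also have "\<dots> = exp (2 * x) * exp (2 * y)" by (simp add: exp_add distrib_left)
    also have "\<dots> \<le> (1/2) * (exp (2 * x))\<^sup>2 + (1/2) * (exp (2 * y))\<^sup>2"
      using sum_squares_bound[of "exp (2 * x)" "exp (2 * y)"] by simp
    also have "\<dots> = (1/2) * exp (4 * x) + (1/2) * exp (4 * y)"
      by (simp add: exp_double[symmetric])
    finally show "1 / (cmod (1 - cnj b * disc_aut (\<phi> a) (\<phi> (disc_aut a z))))\<^sup>2
        \<le> (1/2) * exp (4 * Re (g (disc_aut a z) - g a)) + (1/2) * exp (2 * Re (2 * e (disc_aut a z) - 2 * e a))"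
      by (simp add: x_def y_def right_diff_distrib)
  qed
  also have "\<dots> = (1/2) * circle_avg r (\<lambda>z. exp (4 * Re (g (disc_aut a z) - g a)))
      + (1/2) * circle_avg r (\<lambda>z. exp (2 * Re (2 * e (disc_aut a z) - 2 * e a)))"
    unfolding circle_avg_cmult[symmetric] by (intro circle_avg_add continuous_intros cont r)
  also have "\<dots> \<le> (1/2) * (1 + 16 * exp (16 * M) * \<delta>\<^sup>2) + (1/2) * exp (3 * (4 * \<epsilon>)\<^sup>2)"
    by (intro add_mono mult_left_mono avg_g avg_e) auto
  finally show ?thesis by simp
qed

section \<open>From kernel averages to the hyperbolic density\<close>

text \<open>Up to the factor \<open>1 - s\<^sup>2 |u|\<^sup>2\<close> the integrand is the Poisson kernel of the unit circle at \<open>s u\<close>, which has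
  integral 1.\<close>

lemma circle_avg_geometric_kernel:
  assumes s: "0 < s" "s < 1" and u: "cmod u < 1"
  shows "circle_avg s (\<lambda>b. 1 / (cmod (1 - cnj b * u))\<^sup>2) = 1 / (1 - s\<^sup>2 * (cmod u)\<^sup>2)"
proof -
  have su: "cmod (of_real s * u) < 1"
    using s u mult_strict_mono'[of s 1 "cmod u" 1] by (simp add: norm_mult)
  then have pos: "0 < 1 - s\<^sup>2 * (cmod u)\<^sup>2"
    using power_less_one_iff[of "cmod (of_real s * u)" 2] s by (simp add: norm_mult power_mult_distrib)
  have P: "poisson 1 (of_real s * u) t = (1 - s\<^sup>2 * (cmod u)\<^sup>2) * (1 / (cmod (1 - cnj (of_real s * cis t) * u))\<^sup>2)" for t
  proof -
    have "cis t * (1 - cnj (of_real s * cis t) * u) = cis t - of_real s * u"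
      by (simp add: algebra_simps cis_cnj cis_mult)
    then have "cmod (cis t - of_real s * u) = cmod (cis t * (1 - cnj (of_real s * cis t) * u))" by simp
    then have "cmod (cis t - of_real s * u) = cmod (1 - cnj (of_real s * cis t) * u)"
      by (simp only: norm_mult norm_cis mult_1)
    then show ?thesis using s by (simp add: poisson_def norm_mult power_mult_distrib)
  qed
  have "1 = poisson_int 1 (\<lambda>w. Re 1) (of_real s * u)"
    using poisson_int_Re[of "\<lambda>_. 1" 1 "of_real s * u"] su by simp
  also have "\<dots> = (1 - s\<^sup>2 * (cmod u)\<^sup>2) * circle_avg s (\<lambda>b. 1 / (cmod (1 - cnj b * u))\<^sup>2)"
    unfolding poisson_int_def P circle_avg_cmult[symmetric] unfolding circle_avg_def by simp
  finally show ?thesis using pos by (simp add: field_simps)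
qed

lemma circle_avg_swap:
  assumes "continuous_on (sphere 0 s \<times> sphere 0 r) (\<lambda>(b, z). k b z :: real)" "0 < s" "0 < r"
  shows "circle_avg s (\<lambda>b. circle_avg r (\<lambda>z. k b z)) = circle_avg r (\<lambda>z. circle_avg s (\<lambda>b. k b z))"
proof -
  have "continuous_on (cbox (0, 0) (2*pi, 2*pi)) (\<lambda>(x, y). k (of_real s * cis x) (of_real r * cis y))"
  proof -
    have "continuous_on (cbox (0, 0) (2*pi, 2*pi)) (\<lambda>p. (of_real s * cis (fst p), of_real r * cis (snd p)) :: complex \<times> complex)"
      by (intro continuous_intros)
    from continuous_on_compose2[OF assms(1) this] show ?thesis
      using assms(2,3) by (simp add: case_prod_beta image_subset_iff norm_mult)
  qed
  from integral_swap_continuous[OF this] show ?thesis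
    by (simp add: circle_avg_def cbox_interval)
qed

text \<open>Average the hypothesis over \<open>|b| = s\<close> and let \<open>s\<close> tend to 1. On the circle, \<open>|\<psi>|\<^sup>2\<close> stays below some
  \<open>m < 1\<close>, and then the factor \<open>(1 - s\<^sup>2 m) / (1 - m)\<close> dominates the ratio of the limiting density to the
  averaged one. This factor tends to 1, which makes the passage to the limit uniform.\<close>

lemma circle_avg_hyperbolic_le:
  assumes \<psi>: "continuous_on (sphere 0 r) \<psi>" "\<And>z. cmod z = r \<Longrightarrow> cmod (\<psi> z) < 1" and r: "0 < r"
    and bd: "\<And>b. cmod b < 1 \<Longrightarrow> circle_avg r (\<lambda>z. 1 / (cmod (1 - cnj b * \<psi> z))\<^sup>2) \<le> C"
  shows "circle_avg r (\<lambda>z. 1 / (1 - (cmod (\<psi> z))\<^sup>2)) \<le> C"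
proof -
  define A where "A = insert 0 ((\<lambda>z. (cmod (\<psi> z))\<^sup>2) ` sphere 0 r)"
  have "compact A"
    unfolding A_def by (intro compact_insert compact_continuous_image continuous_intros \<psi>) auto
  moreover have "A \<noteq> {}" by (simp add: A_def)
  ultimately obtain m where m: "m \<in> A" "\<forall>x\<in>A. x \<le> m" by (metis compact_attains_sup)
  have m1: "m < 1" using m(1) \<psi>(2) by (auto simp: A_def power_less_one_iff)
  have sq: "0 \<le> (cmod (\<psi> z))\<^sup>2 \<and> (cmod (\<psi> z))\<^sup>2 \<le> m" if "cmod z = r" for z
    using m(2) that by (auto simp: A_def)
  have step: "circle_avg r (\<lambda>z. 1 / (1 - (cmod (\<psi> z))\<^sup>2)) \<le> (1 - s\<^sup>2 * m) / (1 - m) * C" if s: "0 < s" "s < 1" for s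
  proof -
    have s2: "s\<^sup>2 < 1" "0 \<le> s\<^sup>2" using s by (auto simp: power_less_one_iff)
    have nz: "1 - cnj b * \<psi> z \<noteq> 0" if "cmod b = s" "cmod z = r" for b z
      using disc_aut_denominator[of b "\<psi> z"] that s \<psi>(2) by auto
    have pos: "0 < 1 - s\<^sup>2 * (cmod (\<psi> z))\<^sup>2" "0 < 1 - (cmod (\<psi> z))\<^sup>2" if "cmod z = r" for z
    proof -
      have "s\<^sup>2 * (cmod (\<psi> z))\<^sup>2 \<le> 1 * (cmod (\<psi> z))\<^sup>2" using s2 by (intro mult_right_mono) auto
      then show "0 < 1 - s\<^sup>2 * (cmod (\<psi> z))\<^sup>2" "0 < 1 - (cmod (\<psi> z))\<^sup>2" using sq[OF that] m1 by auto
    qed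
    have ck: "continuous_on (sphere 0 s \<times> sphere 0 r) (\<lambda>(b, z). 1 / (cmod (1 - cnj b * \<psi> z))\<^sup>2)"
      unfolding case_prod_beta
      by (intro continuous_intros continuous_on_compose2[OF \<psi>(1)]) (use nz in \<open>force+\<close>)
    have c1: "continuous_on (sphere 0 r) (\<lambda>z. 1 / (1 - s\<^sup>2 * (cmod (\<psi> z))\<^sup>2))"
      "continuous_on (sphere 0 r) (\<lambda>z. 1 / (1 - (cmod (\<psi> z))\<^sup>2))"
      using pos by (intro continuous_intros \<psi>; force)+
    have "circle_avg r (\<lambda>z. 1 / (1 - (cmod (\<psi> z))\<^sup>2))
        \<le> circle_avg r (\<lambda>z. (1 - s\<^sup>2 * m) / (1 - m) * (1 / (1 - s\<^sup>2 * (cmod (\<psi> z))\<^sup>2)))"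
    proof (intro circle_avg_mono continuous_on_mult continuous_on_const c1 r)
      fix z assume z: "cmod z = r"
      let ?x = "(cmod (\<psi> z))\<^sup>2"
      have "0 \<le> (1 - s\<^sup>2) * (m - ?x)" using s2 sq[OF z] by (intro mult_nonneg_nonneg) auto
      then have "(1 - m) * (1 - s\<^sup>2 * ?x) \<le> (1 - s\<^sup>2 * m) * (1 - ?x)"
        by (simp add: algebra_simps)
      then show "1 / (1 - ?x) \<le> (1 - s\<^sup>2 * m) / (1 - m) * (1 / (1 - s\<^sup>2 * ?x))"
        using pos[OF z] m1 by (simp add: divide_simps mult_ac)
    qed
    also have "\<dots> = (1 - s\<^sup>2 * m) / (1 - m) * circle_avg r (\<lambda>z. circle_avg s (\<lambda>b. 1 / (cmod (1 - cnj b * \<psi> z))\<^sup>2))"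
      unfolding circle_avg_cmult
      by (intro arg_cong2[where f="(*)"] refl circle_avg_cong r) (simp add: circle_avg_geometric_kernel s \<psi>)
    also have "circle_avg r (\<lambda>z. circle_avg s (\<lambda>b. 1 / (cmod (1 - cnj b * \<psi> z))\<^sup>2))
        = circle_avg s (\<lambda>b. circle_avg r (\<lambda>z. 1 / (cmod (1 - cnj b * \<psi> z))\<^sup>2))"
      by (rule circle_avg_swap[OF ck s(1) r, symmetric])
    also have "(1 - s\<^sup>2 * m) / (1 - m) * \<dots> \<le> (1 - s\<^sup>2 * m) / (1 - m) * C"
    proof (rule mult_left_mono)
      have "continuous_on (sphere 0 s) (\<lambda>b. circle_avg r (\<lambda>z. 1 / (cmod (1 - cnj b * \<psi> z))\<^sup>2))"
        unfolding circle_avg_def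
      proof (intro continuous_intros integral_continuous_on_param[of _ 0 "2*pi", unfolded cbox_interval])
        have "continuous_on (sphere (0::complex) s \<times> {0..2*pi}) (\<lambda>p. (fst p, of_real r * cis (snd p)) :: complex \<times> complex)"
          by (intro continuous_intros)
        from continuous_on_compose2[OF ck this]
        show "continuous_on (sphere 0 s \<times> {0..2 * pi}) (\<lambda>(b, t). 1 / (cmod (1 - cnj b * \<psi> (of_real r * cis t)))\<^sup>2)"
          using r by (simp add: case_prod_beta image_subset_iff norm_mult)
      qed auto
      then have "circle_avg s (\<lambda>b. circle_avg r (\<lambda>z. 1 / (cmod (1 - cnj b * \<psi> z))\<^sup>2)) \<le> circle_avg s (\<lambda>b. C)"
        using s by (intro circle_avg_mono continuous_intros bd) auto
      then show "circle_avg s (\<lambda>b. circle_avg r (\<lambda>z. 1 / (cmod (1 - cnj b * \<psi> z))\<^sup>2)) \<le> C"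
        by (simp add: circle_avg_const)
      have "0 \<le> m" using m(2) by (simp add: A_def)
      then have "s\<^sup>2 * m \<le> 1 * 1" using s2 m1 by (intro mult_mono) auto
      then show "0 \<le> (1 - s\<^sup>2 * m) / (1 - m)" using m1 by simp
    qed
    finally show ?thesis .
  qed
  have "((\<lambda>s. (1 - s\<^sup>2 * m) / (1 - m) * C) \<longlongrightarrow> (1 - 1\<^sup>2 * m) / (1 - m) * C) (at_left (1::real))"
    using m1 by (intro tendsto_intros) auto
  moreover have "\<forall>\<^sub>F s in at_left (1::real). circle_avg r (\<lambda>z. 1 / (1 - (cmod (\<psi> z))\<^sup>2)) \<le> (1 - s\<^sup>2 * m) / (1 - m) * C"
    unfolding eventually_at_left_field by (intro exI[of _ 0]) (use step in auto)
  ultimately have "circle_avg r (\<lambda>z. 1 / (1 - (cmod (\<psi> z))\<^sup>2)) \<le> (1 - 1\<^sup>2 * m) / (1 - m) * C"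
    by (intro tendsto_lowerbound) auto
  then show ?thesis using m1 by simp
qed

section \<open>Consequences of compactness on VMOA\<close>

lemma composition_op_log_kernel:
  assumes "\<phi> ` unit_disc \<subseteq> unit_disc" "cmod z < 1"
  shows "composition_op \<phi> (on_disc (log_kernel b)) z = log_kernel b (\<phi> z)"
  using assms by (auto simp: composition_op_def on_disc_def image_subset_iff)

lemma log_kernel_diff_mean_osc:
  assumes T: "compact_operator vmoa bmoa_norm vmoa bmoa_norm (composition_op \<phi>)"
    and \<phi>: "\<phi> ` unit_disc \<subseteq> unit_disc" and b: "cmod b < 1" "cmod c < 1"
  defines "d \<equiv> (\<lambda>z. composition_op \<phi> (on_disc (log_kernel b)) z - composition_op \<phi> (on_disc (log_kernel c)) z)"
  shows "d \<in> vmoa"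
    and "\<And>a. cmod a < 1 \<Longrightarrow> mean_osc d a = mean_osc (\<lambda>z. log_kernel b (\<phi> z) - log_kernel c (\<phi> z)) a"
proof -
  have "composition_op \<phi> ` vmoa \<subseteq> vmoa" using T by (simp add: compact_operator_def)
  then show "d \<in> vmoa" unfolding d_def using log_kernel_vmoa b by (intro vmoa_diff) auto
  show "mean_osc d a = mean_osc (\<lambda>z. log_kernel b (\<phi> z) - log_kernel c (\<phi> z)) a" if "cmod a < 1" for a
    by (intro mean_osc_cong that) (simp add: d_def composition_op_log_kernel[OF \<phi>])
qed

text \<open>Compactness enters here: the test functions are bounded in VMOA, so their images are totally bounded
  in the BMOA norm, which dominates every \<open>mean_osc\<close>.\<close>

lemma log_kernel_finite_net:
  assumes T: "compact_operator vmoa bmoa_norm vmoa bmoa_norm (composition_op \<phi>)"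
    and \<phi>: "\<phi> ` unit_disc \<subseteq> unit_disc" and \<epsilon>: "0 < \<epsilon>"
  obtains N where "finite N" "N \<subseteq> unit_disc"
    "\<And>b. cmod b < 1 \<Longrightarrow> \<exists>b'\<in>N. \<forall>a. cmod a < 1 \<longrightarrow>
        mean_osc (\<lambda>z. log_kernel b (\<phi> z) - log_kernel b' (\<phi> z)) a \<le> ennreal \<epsilon>"
proof -
  interpret V: Metric_space vmoa "norm_dist bmoa_norm" by (rule Metric_space_vmoa)
  define L where "L = (\<lambda>b. on_disc (log_kernel b))"
  define S where "S = L ` unit_disc"
  have "S \<subseteq> vmoa" using log_kernel_vmoa by (auto simp: S_def L_def)
  moreover have "bmoa_norm f \<le> 4 * (pi / 2)" if f: "f \<in> S" for f
  proof -
    obtain b where b: "cmod b < 1" "f = L b" using f by (auto simp: S_def)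
    have "mean_osc f a \<le> ennreal (4 * (pi / 2))" if "cmod a < 1" for a
      using mean_osc_le_of_Im_bounded[OF log_kernel_holomorphic[OF b(1)] log_kernel_Im[OF b(1)] that]
      by (simp add: mean_osc_on_disc[OF that] b(2) L_def)
    then have "bmoa_norm f \<le> cmod (f 0) + 4 * (pi / 2)" by (rule bmoa_norm_le) auto
    then show ?thesis by (simp add: b(2) L_def on_disc_def)
  qed
  ultimately have "compactin V.mtopology (V.mtopology closure_of (composition_op \<phi> ` S))"
    using T unfolding compact_operator_def by blast
  moreover have TS: "composition_op \<phi> ` S \<subseteq> vmoa"
    using T \<open>S \<subseteq> vmoa\<close> unfolding compact_operator_def by blast
  ultimately have "V.mtotally_bounded (composition_op \<phi> ` S)"
    by (rule V.compact_closure_of_imp_mtotally_bounded)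
  from this[unfolded V.mtotally_bounded_def, rule_format, OF \<epsilon>]
  obtain K where K: "finite K" "K \<subseteq> composition_op \<phi> ` S"
      "composition_op \<phi> ` S \<subseteq> (\<Union>x\<in>K. V.mball x \<epsilon>)"
    by (elim exE conjE)
  have "K \<subseteq> (\<lambda>b. composition_op \<phi> (L b)) ` unit_disc" using K(2) by (auto simp: S_def)
  then obtain N where N: "N \<subseteq> unit_disc" "finite N" "K = (\<lambda>b. composition_op \<phi> (L b)) ` N"
    using K(1) by (meson finite_subset_image)
  show thesis
  proof (rule that[OF N(2,1)])
    fix b assume b: "cmod b < 1"
    then have "composition_op \<phi> (L b) \<in> composition_op \<phi> ` S" by (auto simp: S_def)
    then have "composition_op \<phi> (L b) \<in> (\<Union>x\<in>K. V.mball x \<epsilon>)" using K(3) by (rule subsetD[rotated])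
    then obtain b' where b': "b' \<in> N" "norm_dist bmoa_norm (composition_op \<phi> (L b')) (composition_op \<phi> (L b)) < \<epsilon>"
      by (auto simp: N(3))
    then have b'1: "cmod b' < 1" using N(1) by auto
    have "bmoa_norm (\<lambda>z. composition_op \<phi> (L b) z - composition_op \<phi> (L b') z) \<le> \<epsilon>"
      using b'(2) by (subst (asm) V.commute) (simp add: norm_dist_def)
    note mean_osc_le_bmoa_norm[OF _ this]
    then have "mean_osc (\<lambda>z. log_kernel b (\<phi> z) - log_kernel b' (\<phi> z)) a \<le> ennreal \<epsilon>" if "cmod a < 1" for a
      using log_kernel_diff_mean_osc[OF T \<phi> b b'1] that by (simp add: vmoa_def L_def)
    then show "\<exists>b'\<in>N. \<forall>a. cmod a < 1 \<longrightarrow>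
        mean_osc (\<lambda>z. log_kernel b (\<phi> z) - log_kernel b' (\<phi> z)) a \<le> ennreal \<epsilon>"
      using b'(1) by blast
  qed
qed

text \<open>For \<open>r < 1\<close> the integrand is at least 1, with equality where \<open>\<phi>\<close> takes the value \<open>\<phi> a\<close>; the excess of the
  average over 1 measures the hyperbolic oscillation of a self-map \<open>\<phi>\<close> of the disc near \<open>a\<close>.\<close>

definition hyperbolic_avg :: "(complex \<Rightarrow> complex) \<Rightarrow> complex \<Rightarrow> real \<Rightarrow> real"
  where "hyperbolic_avg \<phi> a r = circle_avg r (\<lambda>z. 1 / (1 - (cmod (disc_aut (\<phi> a) (\<phi> (disc_aut a z))))\<^sup>2))"

text \<open>The net \<open>N\<close> belongs to the accuracy \<open>x\<close> and serves all \<open>a\<close> at once. What is left to estimate at \<open>a\<close>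
  is the oscillation of finitely many functions of VMOA.\<close>

lemma hyperbolic_avg_le_net:
  assumes \<phi>: "\<phi> holomorphic_on unit_disc" "\<phi> ` unit_disc \<subseteq> unit_disc"
    and T: "compact_operator vmoa bmoa_norm vmoa bmoa_norm (composition_op \<phi>)"
    and x: "0 < x" "x \<le> 1 / 18"
  obtains N M where "finite N" "\<And>b. b \<in> N \<Longrightarrow> cmod b < 1"
    "\<And>a r \<delta>. \<lbrakk>cmod a < 1; 0 < r; r < 1; 0 \<le> \<delta>;
        \<forall>b\<in>N. \<forall>c\<in>N. mean_osc (\<lambda>z. log_kernel b (\<phi> z) - log_kernel c (\<phi> z)) a \<le> ennreal \<delta>\<rbrakk>
      \<Longrightarrow> hyperbolic_avg \<phi> a r \<le> (1 + 16 * exp (16 * M) * \<delta>\<^sup>2) / 2 + exp (3 * x) / 2"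
proof -
  define \<epsilon> where "\<epsilon> = sqrt x / 4"
  have \<epsilon>: "0 < \<epsilon>" "(4 * \<epsilon>)\<^sup>2 = x" using x by (auto simp: \<epsilon>_def)
  obtain N where N: "finite N" "N \<subseteq> unit_disc"
    and net: "\<And>b. cmod b < 1 \<Longrightarrow> \<exists>b'\<in>N. \<forall>a. cmod a < 1 \<longrightarrow>
        mean_osc (\<lambda>z. log_kernel b (\<phi> z) - log_kernel b' (\<phi> z)) a \<le> ennreal \<epsilon>"
    using log_kernel_finite_net[OF T \<phi>(2) \<epsilon>(1)] by metis
  have N1: "cmod b < 1" if "b \<in> N" for b using N(2) that by auto
  obtain M where M: "\<And>b. b \<in> N \<Longrightarrow> 1 / (1 - cmod b) \<le> M"
    using bdd_above_finite[OF finite_imageI[OF N(1)], of "\<lambda>b. 1 / (1 - cmod b)"]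
    by (auto simp: bdd_above_def)
  have "cmod (log_kernel b z) \<le> M" if "b \<in> N" "cmod z < 1" for b z
  proof -
    have "cmod (log_kernel b z - log_kernel b 0) \<le> 1 / (1 - cmod b) * cmod (z - 0)"
      by (rule log_kernel_Lipschitz[OF N1[OF that(1)] that(2)]) simp
    also have "\<dots> \<le> 1 / (1 - cmod b) * 1"
      using N1[OF that(1)] that(2) by (intro mult_left_mono) auto
    finally show ?thesis using M[OF that(1)] by simp
  qed
  note est = circle_avg_kernel_le[OF \<phi> net N1 less_imp_le[OF \<epsilon>(1)] _ this, unfolded \<epsilon>(2), OF _ _ x(2)]
  show thesis
  proof (rule that[OF N(1) N1])
    fix a :: complex and r \<delta> :: real
    assume a: "cmod a < 1" and r: "0 < r" "r < 1" and \<delta>: "0 \<le> \<delta>"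
      and osc: "\<forall>b\<in>N. \<forall>c\<in>N.
        mean_osc (\<lambda>z. log_kernel b (\<phi> z) - log_kernel c (\<phi> z)) a \<le> ennreal \<delta>"
    show "hyperbolic_avg \<phi> a r \<le> (1 + 16 * exp (16 * M) * \<delta>\<^sup>2) / 2 + exp (3 * x) / 2"
      unfolding hyperbolic_avg_def
    proof (rule circle_avg_hyperbolic_le)
      show "continuous_on (sphere 0 r) (\<lambda>z. disc_aut (\<phi> a) (\<phi> (disc_aut a z)))"
        by (rule continuous_on_subset[OF holomorphic_on_imp_continuous_on[OF disc_map_aut_holomorphic(1)[OF \<phi> a]]])
          (use r in auto)
      show "cmod (disc_aut (\<phi> a) (\<phi> (disc_aut a z))) < 1" if "cmod z = r" for z
        using disc_map_aut_holomorphic(2)[OF \<phi> a] that r by simp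
    qed (use est osc \<delta> a r in auto)
  qed
qed

text \<open>One fixed accuracy is enough here, with the bound \<open>4 \<pi>\<close> for the oscillation of any difference of two test
  functions composed with \<open>\<phi>\<close>.\<close>

lemma hyperbolic_avg_bounded:
  assumes \<phi>: "\<phi> holomorphic_on unit_disc" "\<phi> ` unit_disc \<subseteq> unit_disc"
    and T: "compact_operator vmoa bmoa_norm vmoa bmoa_norm (composition_op \<phi>)"
  obtains C where "\<And>a r. cmod a < 1 \<Longrightarrow> 0 < r \<Longrightarrow> r < 1 \<Longrightarrow> hyperbolic_avg \<phi> a r \<le> C"
proof -
  have x: "0 < (1 / 18 :: real)" "(1 / 18 :: real) \<le> 1 / 18" by auto
  obtain N M where NM: "finite N" "\<And>b. b \<in> N \<Longrightarrow> cmod b < 1"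
    "\<And>a r \<delta>. \<lbrakk>cmod a < 1; 0 < r; r < 1; 0 \<le> \<delta>;
        \<forall>b\<in>N. \<forall>c\<in>N. mean_osc (\<lambda>z. log_kernel b (\<phi> z) - log_kernel c (\<phi> z)) a \<le> ennreal \<delta>\<rbrakk>
      \<Longrightarrow> hyperbolic_avg \<phi> a r \<le> (1 + 16 * exp (16 * M) * \<delta>\<^sup>2) / 2 + exp (3 * (1 / 18)) / 2"
    using hyperbolic_avg_le_net[OF \<phi> T x] by blast
  have hol: "(\<lambda>z. log_kernel b (\<phi> z)) holomorphic_on unit_disc" if "cmod b < 1" for b
    using holomorphic_on_compose_gen[OF \<phi>(1) log_kernel_holomorphic[OF that] \<phi>(2)] by (simp add: o_def)
  have osc: "mean_osc (\<lambda>z. log_kernel b (\<phi> z)) a \<le> ennreal (4 * (pi / 2))" if "cmod b < 1" "cmod a < 1" for a b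
    using \<phi>(2) that by (intro mean_osc_le_of_Im_bounded hol log_kernel_Im) (auto simp: image_subset_iff)
  have "\<forall>b\<in>N. \<forall>c\<in>N. mean_osc (\<lambda>z. log_kernel b (\<phi> z) - log_kernel c (\<phi> z)) a
      \<le> ennreal (4 * (pi / 2) + 4 * (pi / 2))" if "cmod a < 1" for a
    using NM(2) that by (intro ballI mean_osc_diff_le hol osc) auto
  from that[OF NM(3)[OF _ _ _ _ this]] show thesis by simp
qed

text \<open>The differences over the net are images of VMOA functions, hence in VMOA themselves. Being finitely many,
  they have uniformly small oscillation near the boundary.\<close>

lemma hyperbolic_avg_small:
  assumes \<phi>: "\<phi> holomorphic_on unit_disc" "\<phi> ` unit_disc \<subseteq> unit_disc"
    and T: "compact_operator vmoa bmoa_norm vmoa bmoa_norm (composition_op \<phi>)" and \<eta>: "0 < \<eta>"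
  shows "\<forall>\<^sub>F a in boundary_filter. \<forall>r. 0 < r \<longrightarrow> r < 1 \<longrightarrow> hyperbolic_avg \<phi> a r \<le> 1 + \<eta>"
proof -
  define x where "x = min (1 / 18) (ln (1 + \<eta>) / 3)"
  have x: "0 < x" "x \<le> 1 / 18" "exp (3 * x) \<le> 1 + \<eta>"
  proof -
    show "0 < x" "x \<le> 1 / 18" using \<eta> by (auto simp: x_def)
    have "3 * x \<le> ln (1 + \<eta>)" by (simp add: x_def)
    then have "exp (3 * x) \<le> exp (ln (1 + \<eta>))" by (simp only: exp_le_cancel_iff)
    then show "exp (3 * x) \<le> 1 + \<eta>" using \<eta> by simp
  qed
  obtain N M where NM: "finite N" "\<And>b. b \<in> N \<Longrightarrow> cmod b < 1"
    "\<And>a r \<delta>. \<lbrakk>cmod a < 1; 0 < r; r < 1; 0 \<le> \<delta>;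
        \<forall>b\<in>N. \<forall>c\<in>N. mean_osc (\<lambda>z. log_kernel b (\<phi> z) - log_kernel c (\<phi> z)) a \<le> ennreal \<delta>\<rbrakk>
      \<Longrightarrow> hyperbolic_avg \<phi> a r \<le> (1 + 16 * exp (16 * M) * \<delta>\<^sup>2) / 2 + exp (3 * x) / 2"
    using hyperbolic_avg_le_net[OF \<phi> T x(1,2)] by blast
  \<comment> \<open>Both halves of the bound in terms of the net become at most \<open>(1 + \<eta>) / 2\<close>.\<close>
  define \<delta> where "\<delta> = sqrt (\<eta> / (16 * exp (16 * M)))"
  have \<delta>: "0 < \<delta>" "16 * exp (16 * M) * \<delta>\<^sup>2 = \<eta>" using \<eta> by (auto simp: \<delta>_def)
  have "\<forall>\<^sub>F a in boundary_filter. mean_osc (\<lambda>z. log_kernel b (\<phi> z) - log_kernel c (\<phi> z)) a \<le> ennreal \<delta>"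
    if "b \<in> N" "c \<in> N" for b c
    using vmoa_small[OF log_kernel_diff_mean_osc(1)[OF T \<phi>(2) NM(2)[OF that(1)] NM(2)[OF that(2)]] \<delta>(1)]
      eventually_boundary_disc
    by eventually_elim
      (simp add: log_kernel_diff_mean_osc(2)[OF T \<phi>(2) NM(2)[OF that(1)] NM(2)[OF that(2)]])
  then have "\<forall>\<^sub>F a in boundary_filter. \<forall>b\<in>N. \<forall>c\<in>N.
      mean_osc (\<lambda>z. log_kernel b (\<phi> z) - log_kernel c (\<phi> z)) a \<le> ennreal \<delta>"
    using NM(1) by (intro eventually_ball_finite ballI)
  with eventually_boundary_disc show ?thesis
  proof eventually_elim
    case (elim a)
    have "hyperbolic_avg \<phi> a r \<le> 1 + \<eta>" if r: "0 < r" "r < 1" for r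
    proof -
      have "hyperbolic_avg \<phi> a r \<le> (1 + 16 * exp (16 * M) * \<delta>\<^sup>2) / 2 + exp (3 * x) / 2"
        by (rule NM(3)[OF elim(1) r less_imp_le[OF \<delta>(1)]]) (rule elim(2))
      then show ?thesis using x(3) unfolding \<delta>(2) by (simp add: field_simps)
    qed
    then show ?case by blast
  qed
qed

section \<open>Growth of Bloch functions\<close>

lemma disc_aut_has_derivative:
  assumes "cmod c < 1" "cmod z < 1"
  shows "(disc_aut c has_field_derivative - of_real (1 - (cmod c)\<^sup>2) / (1 - cnj c * z)\<^sup>2) (at z)"
proof -
  have "((\<lambda>z. (c - z) / (1 - cnj c * z)) has_field_derivative
      ((- 1) * (1 - cnj c * z) - (c - z) * (- cnj c)) / ((1 - cnj c * z) * (1 - cnj c * z))) (at z)"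
    using disc_aut_denominator[OF assms] by (auto intro!: derivative_eq_intros)
  also have "(- 1) * (1 - cnj c * z) - (c - z) * (- cnj c) = - of_real (1 - (cmod c)\<^sup>2)"
    unfolding of_real_diff complex_norm_square by (simp add: algebra_simps)
  finally show ?thesis
    unfolding disc_aut_def[abs_def] power2_eq_square[of "1 - cnj c * z"] .
qed

lemma one_minus_norm_disc_aut:
  assumes "cmod c < 1" "cmod z < 1"
  shows "1 - (cmod (disc_aut c z))\<^sup>2 = (1 - (cmod c)\<^sup>2) * (1 - (cmod z)\<^sup>2) / (cmod (1 - cnj c * z))\<^sup>2"
proof -
  have "cmod (1 - cnj c * z) \<noteq> 0" using disc_aut_denominator[OF assms] by simp
  moreover have "(cmod (1 - cnj c * z))\<^sup>2 - (cmod (c - z))\<^sup>2 = (1 - (cmod c)\<^sup>2) * (1 - (cmod z)\<^sup>2)"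
    unfolding cmod_power2 by (simp add: power2_eq_square algebra_simps)
  ultimately show ?thesis by (simp add: disc_aut_def norm_divide power_divide field_simps)
qed

text \<open>The automorphisms are isometries of the hyperbolic metric; this is the equality case of the
  Schwarz-Pick inequality.\<close>

lemma norm_deriv_disc_aut:
  assumes "cmod c < 1" "cmod z < 1"
  shows "cmod (- of_real (1 - (cmod c)\<^sup>2) / (1 - cnj c * z)\<^sup>2) = (1 - (cmod (disc_aut c z))\<^sup>2) / (1 - (cmod z)\<^sup>2)"
proof -
  have "0 < 1 - (cmod c)\<^sup>2" "0 < 1 - (cmod z)\<^sup>2" using assms by (auto simp: power_less_one_iff)
  then show ?thesis
    unfolding one_minus_norm_disc_aut[OF assms] by (simp add: norm_divide norm_power del: of_real_diff)
qed

text \<open>The Bloch seminorm is invariant under \<open>\<sigma>\<^sub>c\<close>, so it suffices to integrate \<open>B / (1 - |z|\<^sup>2)\<close> along the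
  radius from 0 to \<open>\<sigma>\<^sub>c w\<close>.\<close>

lemma bloch_growth:
  assumes f: "f holomorphic_on unit_disc" and B: "\<And>z. cmod z < 1 \<Longrightarrow> cmod (deriv f z) * (1 - (cmod z)\<^sup>2) \<le> B"
    and c: "cmod c < 1" and w: "cmod w < 1"
  shows "cmod (f w - f c) \<le> B * artanh (cmod (disc_aut c w))"
proof -
  define u where "u = disc_aut c w"
  have u: "cmod u < 1" unfolding u_def by (rule norm_disc_aut_less[OF c w])
  define g where "g = (\<lambda>z. f (disc_aut c z))"
  define g' where "g' = (\<lambda>z. deriv f (disc_aut c z) * (- of_real (1 - (cmod c)\<^sup>2) / (1 - cnj c * z)\<^sup>2))"
  have Dg: "(g has_field_derivative g' z) (at z)" if "cmod z < 1" for z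
  proof -
    have "(f has_field_derivative deriv f (disc_aut c z)) (at (disc_aut c z))"
      using norm_disc_aut_less[OF c that] by (intro holomorphic_derivI[OF f]) auto
    from DERIV_chain2[OF this disc_aut_has_derivative[OF c that]] show ?thesis
      unfolding g_def g'_def .
  qed
  have g': "cmod (g' z) \<le> B / (1 - (cmod z)\<^sup>2)" if z: "cmod z < 1" for z
  proof -
    have "0 < 1 - (cmod z)\<^sup>2" using z by (simp add: power_less_one_iff)
    moreover have "cmod (g' z) = cmod (deriv f (disc_aut c z)) * (1 - (cmod (disc_aut c z))\<^sup>2) / (1 - (cmod z)\<^sup>2)"
      unfolding g'_def norm_mult norm_deriv_disc_aut[OF c z] by simp
    ultimately show ?thesis
      using B[OF norm_disc_aut_less[OF c z]] by (simp add: divide_right_mono)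
  qed
  have tu: "cmod (of_real t * u) < 1" if "0 \<le> t" "t \<le> 1" for t
  proof -
    have "t * cmod u \<le> 1 * cmod u" using that by (intro mult_right_mono) auto
    then show ?thesis using u that by (simp add: norm_mult)
  qed
  have tu': "t * cmod u < 1" "- 1 < t * cmod u" if "0 \<le> t" "t \<le> 1" for t
  proof -
    show "t * cmod u < 1" using tu[OF that] that by (simp add: norm_mult)
    have "0 \<le> t * cmod u" using that by simp
    then show "- 1 < t * cmod u" by linarith
  qed
  have D1: "((\<lambda>t. g (of_real t * u)) has_vector_derivative u * g' (of_real t * u)) (at t)" if "0 \<le> t" "t \<le> 1" for t
  proof -
    have "((\<lambda>t. of_real t * u) has_vector_derivative u) (at t)"
      by (auto intro!: derivative_eq_intros simp: has_vector_derivative_def scaleR_conv_of_real)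
    from field_vector_diff_chain_at[OF this Dg[OF tu[OF that]]] show ?thesis by (simp add: o_def)
  qed
  have D2: "((\<lambda>t. B * artanh (t * cmod u)) has_vector_derivative B * (cmod u / (1 - (t * cmod u)\<^sup>2))) (at t)"
    if "0 \<le> t" "t \<le> 1" for t
  proof -
    have "(artanh has_real_derivative 1 / (1 - (t * cmod u)\<^sup>2)) (at (t * cmod u))"
      using tu'[OF that] by (intro artanh_real_has_field_derivative) auto
    moreover have "((\<lambda>t. t * cmod u) has_real_derivative cmod u) (at t)"
      by (auto intro!: derivative_eq_intros)
    ultimately have "((\<lambda>t. artanh (t * cmod u)) has_real_derivative 1 / (1 - (t * cmod u)\<^sup>2) * cmod u) (at t)"
      by (rule DERIV_chain2)
    from DERIV_cmult[OF this, of B] show ?thesis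
      unfolding has_real_derivative_iff_has_vector_derivative[symmetric] by simp
  qed
  have "cmod (g (of_real 1 * u) - g (of_real 0 * u)) \<le> B * artanh (1 * cmod u) - B * artanh (0 * cmod u)"
  proof (rule differentiable_bound_general[where f' = "\<lambda>t. u * g' (of_real t * u)"
        and \<phi>' = "\<lambda>t. B * (cmod u / (1 - (t * cmod u)\<^sup>2))"])
    show "continuous_on {0..1} (\<lambda>t. g (of_real t * u))"
      by (intro continuous_at_imp_continuous_on ballI has_vector_derivative_continuous[OF D1]) auto
    show "continuous_on {0..1} (\<lambda>t. B * artanh (t * cmod u))"
      by (intro continuous_at_imp_continuous_on ballI has_vector_derivative_continuous[OF D2]) auto
    show "cmod (u * g' (of_real t * u)) \<le> B * (cmod u / (1 - (t * cmod u)\<^sup>2))" if "0 < t" "t < 1" for t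
      using mult_left_mono[OF g'[OF tu[of t]], of "cmod u"] that by (simp add: norm_mult mult_ac)
  qed (use D1 D2 in auto)
  moreover have "disc_aut c u = w" unfolding u_def by (rule disc_aut_involution[OF c w])
  ultimately show ?thesis by (simp add: g_def disc_aut_at_0 u_def[symmetric])
qed

lemma artanh_nonneg: "0 \<le> x \<Longrightarrow> x < 1 \<Longrightarrow> 0 \<le> artanh (x::real)"
  by (simp add: artanh_def)

text \<open>Comparing derivatives, \<open>1 / (1 - t\<^sup>2) \<le> (1 - t\<^sup>2) powr (- 3 / 2)\<close>, gives \<open>artanh x \<le> x / sqrt (1 - x\<^sup>2)\<close>.\<close>

lemma artanh_square_le:
  fixes x :: real
  assumes "0 \<le> x" "x < 1" shows "(artanh x)\<^sup>2 \<le> 1 / (1 - x\<^sup>2) - 1"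
proof -
  have pos: "0 < 1 - t\<^sup>2" if "0 \<le> t" "t \<le> x" for t using that assms by (simp add: power_less_one_iff)
  have D: "((\<lambda>t. t / sqrt (1 - t\<^sup>2) - artanh t) has_real_derivative
      (1 / sqrt (1 - t\<^sup>2) - 1) / (1 - t\<^sup>2)) (at t)" if t: "0 \<le> t" "t \<le> x" for t
  proof -
    define s where "s = sqrt (1 - t\<^sup>2)"
    have s: "0 < s" "s\<^sup>2 = 1 - t\<^sup>2" using pos[OF t] by (auto simp: s_def)
    have "((\<lambda>t. t / sqrt (1 - t\<^sup>2) - artanh t) has_real_derivative
      (1 * s - t * ((- (2 * t)) * (inverse s / 2))) / (s * s) - 1 / (1 - t\<^sup>2)) (at t)"
      unfolding s_def using t assms pos[OF t]
      by (auto intro!: derivative_eq_intros simp: numeral_2_eq_2)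
    also have "(1 * s - t * ((- (2 * t)) * (inverse s / 2))) / (s * s) - 1 / (1 - t\<^sup>2) = (1 / s - 1) / (1 - t\<^sup>2)"
    proof -
      have "1 * s - t * ((- (2 * t)) * (inverse s / 2)) = (s\<^sup>2 + t\<^sup>2) / s"
        using s(1) by (simp add: field_simps power2_eq_square)
      also have "\<dots> = 1 / s" using s(2) by simp
      finally show ?thesis unfolding power2_eq_square[symmetric] s(2) by (simp add: diff_divide_distrib)
    qed
    finally show ?thesis unfolding s_def .
  qed
  have "0 / sqrt (1 - 0\<^sup>2) - artanh 0 \<le> x / sqrt (1 - x\<^sup>2) - artanh x"
  proof (rule DERIV_nonneg_imp_nondecreasing[OF assms(1)])
    fix t assume t: "0 \<le> t" "t \<le> x"
    have "sqrt (1 - t\<^sup>2) \<le> 1" "0 < sqrt (1 - t\<^sup>2)" using pos[OF t] by auto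
    then have "0 \<le> (1 / sqrt (1 - t\<^sup>2) - 1) / (1 - t\<^sup>2)" using pos[OF t] by simp
    then show "\<exists>y. ((\<lambda>t. t / sqrt (1 - t\<^sup>2) - artanh t) has_real_derivative y) (at t) \<and> 0 \<le> y"
      using D[OF t] by blast
  qed
  then have "artanh x \<le> x / sqrt (1 - x\<^sup>2)" by simp
  then have "(artanh x)\<^sup>2 \<le> (x / sqrt (1 - x\<^sup>2))\<^sup>2"
    using artanh_nonneg[OF assms] by (intro power_mono)
  also have "\<dots> = 1 / (1 - x\<^sup>2) - 1"
    using pos[OF assms(1)] by (simp add: power_divide field_simps)
  finally show ?thesis .
qed

text \<open>With \<open>u = (1 + x) / (1 - x)\<close>, the crude bound \<open>ln u \<le> 4 u powr (1 / 4)\<close> yields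
  \<open>artanh\<^sup>2 x (1 - x\<^sup>2) \<le> 4 sqrt (8 (1 - x))\<close>, whose right side is at most \<open>\<eta>\<close>
  as soon as \<open>1 - x \<le> \<eta>\<^sup>2 / 128\<close>.\<close>

lemma artanh_square_small:
  assumes "0 < \<eta>"
  obtains \<delta> :: real where "0 \<le> \<delta>" "\<delta> < 1" "\<And>x. \<delta> < x \<Longrightarrow> x < 1 \<Longrightarrow> (artanh x)\<^sup>2 \<le> \<eta> * (1 / (1 - x\<^sup>2))"
proof (rule that)
  let ?\<delta> = "max 0 (1 - \<eta>\<^sup>2 / 128)"
  show "0 \<le> ?\<delta>" "?\<delta> < 1" using assms by auto
  fix x assume x: "?\<delta> < x" "x < 1"
  then have x0: "0 < x" by simp
  define u where "u = (1 + x) / (1 - x)"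
  have u: "0 < u" "1 \<le> u" using x x0 by (auto simp: u_def)
  have "ln u = 4 * ln (sqrt (sqrt u))" using u by (simp add: ln_sqrt)
  also have "ln (sqrt (sqrt u)) \<le> sqrt (sqrt u)"
    using ln_le_minus_one[of "sqrt (sqrt u)"] u by simp
  finally have "artanh x \<le> 2 * sqrt (sqrt u)" by (simp add: artanh_def u_def)
  then have "(artanh x)\<^sup>2 \<le> (2 * sqrt (sqrt u))\<^sup>2"
    using artanh_nonneg[of x] x x0 by (intro power_mono) auto
  then have a: "(artanh x)\<^sup>2 \<le> 4 * sqrt u" using u by (simp add: power_mult_distrib)
  have p: "0 < 1 - x\<^sup>2" using x x0 by (simp add: power_less_one_iff)
  have "4 * sqrt u * (1 - x\<^sup>2) = 4 * sqrt (u * (1 - x\<^sup>2)\<^sup>2)"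
    using p by (simp add: real_sqrt_mult)
  also have "u * (1 - x\<^sup>2)\<^sup>2 = (1 + x) ^ 3 * (1 - x)"
  proof -
    have "1 - x\<^sup>2 = (1 + x) * (1 - x)" by (simp add: power2_eq_square algebra_simps)
    then show ?thesis unfolding u_def using x by (simp add: field_simps power2_eq_square power3_eq_cube)
  qed
  also have "sqrt ((1 + x) ^ 3 * (1 - x)) \<le> sqrt (8 * (\<eta>\<^sup>2 / 128))"
  proof (intro real_sqrt_le_mono mult_mono)
    show "(1 + x) ^ 3 \<le> 8" using power_mono[of "1 + x" 2 3] x x0 by simp
  qed (use x in auto)
  also have "sqrt (8 * (\<eta>\<^sup>2 / 128)) = \<eta> / 4"
    using assms by (intro real_sqrt_unique) (auto simp: power_divide)
  finally have "4 * sqrt u * (1 - x\<^sup>2) \<le> \<eta>" by simp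
  with a p have "(artanh x)\<^sup>2 * (1 - x\<^sup>2) \<le> \<eta>" by (meson mult_right_mono less_imp_le order_trans)
  then show "(artanh x)\<^sup>2 \<le> \<eta> * (1 / (1 - x\<^sup>2))" using p by (simp add: field_simps)
qed

section \<open>VMOA inside the Bloch space\<close>

text \<open>For \<open>k = f \<circ> \<sigma>\<^sub>a - f a\<close> the derivative at 0 has modulus \<open>|f' a| (1 - |a|\<^sup>2)\<close>, and it is the value at 0 of
  the holomorphic function \<open>k z / z\<close>, to which the mean value inequality for \<open>|k z / z|\<^sup>2\<close> applies.\<close>

lemma norm_deriv_le_mean_osc:
  assumes f: "f holomorphic_on unit_disc" and a: "cmod a < 1" and osc: "mean_osc f a \<le> ennreal B" and B: "0 \<le> B"
  shows "cmod (deriv f a) * (1 - (cmod a)\<^sup>2) \<le> B"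
proof -
  let ?k = "\<lambda>z. f (disc_aut a z) - f a"
  define q where "q = (\<lambda>z. if z = 0 then deriv ?k 0 else (?k z - ?k 0) / (z - 0))"
  have k: "?k holomorphic_on unit_disc" using f a by (intro holomorphic_disc_aut) auto
  have q: "q holomorphic_on unit_disc"
    unfolding q_def by (rule pole_lemma[OF k]) simp
  have "(f has_field_derivative deriv f a) (at (disc_aut a 0))"
    unfolding disc_aut_at_0 using a by (intro holomorphic_derivI[OF f]) auto
  from DERIV_chain2[OF this disc_aut_has_derivative[OF a, of 0]]
  have "(?k has_field_derivative deriv f a * (- of_real (1 - (cmod a)\<^sup>2) / (1 - cnj a * 0)\<^sup>2) - 0) (at 0)"
    by (intro DERIV_diff DERIV_const) auto
  then have "deriv ?k 0 = - deriv f a * of_real (1 - (cmod a)\<^sup>2)"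
    by (intro DERIV_imp_deriv) (simp add: algebra_simps)
  moreover have a1: "0 \<le> 1 - (cmod a)\<^sup>2" using a by (simp add: power_le_one)
  ultimately have q0: "cmod (q 0) = cmod (deriv f a) * (1 - (cmod a)\<^sup>2)"
    by (simp add: q_def norm_mult del: of_real_diff)
  have "r * cmod (q 0) \<le> B" if r: "0 < r" "r < 1" for r
  proof -
    have qr: "q holomorphic_on cball 0 r" by (rule holomorphic_on_subset[OF q]) (use r in auto)
    have "(cmod (q 0))\<^sup>2 \<le> circle_avg r (\<lambda>z. (cmod (q z))\<^sup>2)"
      using norm_square_le_poisson_int[OF qr, of 0] r by (simp add: poisson_int_0)
    then have "r\<^sup>2 * (cmod (q 0))\<^sup>2 \<le> r\<^sup>2 * circle_avg r (\<lambda>z. (cmod (q z))\<^sup>2)"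
      by (rule mult_left_mono) simp
    also have "\<dots> = circle_avg r (\<lambda>z. (cmod (?k z))\<^sup>2)"
      unfolding circle_avg_cmult[symmetric]
      by (rule circle_avg_cong[OF r(1)]) (use r in \<open>auto simp: q_def norm_divide power_divide disc_aut_at_0\<close>)
    also have "\<dots> \<le> B\<^sup>2" using osc r by (simp add: mean_osc_le_iff[OF B])
    finally have "(r * cmod (q 0))\<^sup>2 \<le> B\<^sup>2" by (simp add: power_mult_distrib)
    then show ?thesis using B by (rule power2_le_imp_le)
  qed
  then have "\<forall>\<^sub>F r in at_left (1::real). r * cmod (q 0) \<le> B"
    unfolding eventually_at_left_field by (intro exI[of _ 0]) auto
  moreover have "((\<lambda>r. r * cmod (q 0)) \<longlongrightarrow> 1 * cmod (q 0)) (at_left 1)"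
    by (intro tendsto_intros)
  ultimately have "1 * cmod (q 0) \<le> B" by (intro tendsto_upperbound) auto
  then show ?thesis by (simp add: q0)
qed

lemma vmoa_bloch:
  assumes "f \<in> vmoa" shows "f \<in> bloch" "bloch_norm f \<le> bmoa_norm f"
proof -
  have f: "f \<in> bmoa" "f \<in> analytic_disc" "f holomorphic_on unit_disc"
    using assms by (auto simp: vmoa_def bmoa_def analytic_disc_def)
  define B where "B = enn2real (bmoa_seminorm f)"
  have Bs: "bmoa_seminorm f = ennreal B" using f(1) by (simp add: B_def bmoa_def)
  have "cmod (deriv f a) * (1 - (cmod a)\<^sup>2) \<le> B" if "cmod a < 1" for a
  proof (rule norm_deriv_le_mean_osc[OF f(3) that])
    show "mean_osc f a \<le> ennreal B"
      unfolding Bs[symmetric] bmoa_seminorm_def using that by (intro SUP_upper) auto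
  qed (simp add: B_def)
  then have s: "bloch_seminorm f \<le> ennreal B"
    unfolding bloch_seminorm_def by (intro SUP_least ennreal_leI) auto
  then show "f \<in> bloch" using f(2) by (auto simp: bloch_def less_top[symmetric] top_unique)
  have "enn2real (bloch_seminorm f) \<le> B" using s by (simp add: enn2real_leI B_def)
  then show "bloch_norm f \<le> bmoa_norm f" by (simp add: bloch_norm_def bmoa_norm_def B_def)
qed

lemma bloch_norm_growth:
  assumes f: "f \<in> bloch" "bloch_norm f \<le> B" and cw: "cmod c < 1" "cmod w < 1"
  shows "cmod (f w - f c) \<le> B * artanh (cmod (disc_aut c w))"
proof (rule bloch_growth)
  show "f holomorphic_on unit_disc" using f by (simp add: bloch_def analytic_disc_def)
  show "cmod (deriv f z) * (1 - (cmod z)\<^sup>2) \<le> B" if "cmod z < 1" for z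
  proof -
    have "ennreal (cmod (deriv f z) * (1 - (cmod z)\<^sup>2)) \<le> bloch_seminorm f"
      unfolding bloch_seminorm_def using that by (intro SUP_upper) auto
    also have "\<dots> = ennreal (enn2real (bloch_seminorm f))"
      using f(1) by (simp add: bloch_def)
    finally have "cmod (deriv f z) * (1 - (cmod z)\<^sup>2) \<le> enn2real (bloch_seminorm f)"
      by (simp add: ennreal_le_iff)
    also have "\<dots> \<le> B" using f(2) norm_ge_zero[of "f 0"] unfolding bloch_norm_def by linarith
    finally show ?thesis .
  qed
qed (fact cw)+

section \<open>Compactness on the Bloch space\<close>

text \<open>For analytic functions this is equivalent to the Bloch condition. Unlike a bound on the derivative, it
  passes to pointwise limits at once.\<close>

definition hyperbolic_Lipschitz :: "real \<Rightarrow> (complex \<Rightarrow> complex) \<Rightarrow> bool"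
  where "hyperbolic_Lipschitz B f \<longleftrightarrow>
    (\<forall>c w. cmod c < 1 \<longrightarrow> cmod w < 1 \<longrightarrow> cmod (f w - f c) \<le> B * artanh (cmod (disc_aut c w)))"

lemma hyperbolic_LipschitzD:
  "hyperbolic_Lipschitz B f \<Longrightarrow> cmod c < 1 \<Longrightarrow> cmod w < 1
    \<Longrightarrow> cmod (f w - f c) \<le> B * artanh (cmod (disc_aut c w))"
  by (simp add: hyperbolic_Lipschitz_def)

lemma hyperbolic_Lipschitz_diff:
  assumes "hyperbolic_Lipschitz A f" "hyperbolic_Lipschitz B g"
  shows "hyperbolic_Lipschitz (A + B) (\<lambda>z. f z - g z)"
  unfolding hyperbolic_Lipschitz_def
proof (intro allI impI)
  fix c w :: complex assume cw: "cmod c < 1" "cmod w < 1"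
  have "cmod ((f w - g w) - (f c - g c)) = cmod ((f w - f c) - (g w - g c))" by (simp add: algebra_simps)
  also have "\<dots> \<le> cmod (f w - f c) + cmod (g w - g c)" by (rule norm_triangle_ineq4)
  also have "\<dots> \<le> A * artanh (cmod (disc_aut c w)) + B * artanh (cmod (disc_aut c w))"
    using assms cw by (intro add_mono hyperbolic_LipschitzD)
  finally show "cmod ((f w - g w) - (f c - g c)) \<le> (A + B) * artanh (cmod (disc_aut c w))"
    by (simp add: distrib_right)
qed

lemma hyperbolic_Lipschitz_square:
  assumes "hyperbolic_Lipschitz B f" "cmod c < 1" "cmod w < 1"
  shows "(cmod (f w - f c))\<^sup>2 \<le> B\<^sup>2 * (artanh (cmod (disc_aut c w)))\<^sup>2"
proof -
  have "(cmod (f w - f c))\<^sup>2 \<le> (B * artanh (cmod (disc_aut c w)))\<^sup>2"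
    using hyperbolic_LipschitzD[OF assms] by (intro power_mono) auto
  then show ?thesis by (simp add: power_mult_distrib)
qed

lemma composition_holomorphic:
  assumes "\<phi> holomorphic_on unit_disc" "\<phi> ` unit_disc \<subseteq> unit_disc" "f holomorphic_on unit_disc"
  shows "(\<lambda>z. f (\<phi> z)) holomorphic_on unit_disc"
  using holomorphic_on_compose_gen[OF assms(1,3,2)] by (simp add: o_def)

lemma hyperbolic_density_continuous:
  assumes "\<phi> holomorphic_on unit_disc" "\<phi> ` unit_disc \<subseteq> unit_disc" "cmod a < 1" "0 < r" "r < 1"
  shows "continuous_on (sphere 0 r) (\<lambda>z. 1 / (1 - (cmod (disc_aut (\<phi> a) (\<phi> (disc_aut a z))))\<^sup>2))"
proof -
  have c: "continuous_on (sphere 0 r) (\<lambda>z. disc_aut (\<phi> a) (\<phi> (disc_aut a z)))"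
    by (rule continuous_on_subset[OF holomorphic_on_imp_continuous_on[OF disc_map_aut_holomorphic(1)[OF assms(1-3)]]])
      (use assms in auto)
  have "1 - (cmod (disc_aut (\<phi> a) (\<phi> (disc_aut a z))))\<^sup>2 \<noteq> 0" if "z \<in> sphere 0 r" for z
  proof -
    have "(cmod (disc_aut (\<phi> a) (\<phi> (disc_aut a z))))\<^sup>2 < 1"
      using disc_map_aut_holomorphic(2)[OF assms(1-3), of z] that assms by (simp add: power_less_one_iff)
    then show ?thesis by simp
  qed
  then show ?thesis by (intro continuous_intros c) auto
qed

text \<open>The constants \<open>K\<close> and \<open>D\<close> allow for two uses: with \<open>D = - K\<close> the bound is proportional to the excess of the
  averages over 1, which is small near the boundary; in the interior, \<open>K\<close> is small and \<open>D\<close> accounts for a compact set on which the function is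
  small.\<close>

lemma mean_osc_composition_le:
  assumes \<phi>: "\<phi> holomorphic_on unit_disc" "\<phi> ` unit_disc \<subseteq> unit_disc"
    and f: "f holomorphic_on unit_disc" and a: "cmod a < 1"
    and C: "\<And>r. 0 < r \<Longrightarrow> r < 1 \<Longrightarrow> hyperbolic_avg \<phi> a r \<le> C" and K: "0 \<le> K" "0 \<le> K * C + D"
    and bd: "\<And>w. cmod w < 1 \<Longrightarrow> (cmod (f w - f (\<phi> a)))\<^sup>2 \<le> K * (1 / (1 - (cmod (disc_aut (\<phi> a) w))\<^sup>2)) + D"
  shows "mean_osc (\<lambda>z. f (\<phi> z)) a \<le> ennreal (sqrt (K * C + D))"
proof -
  have "circle_avg r (\<lambda>z. (cmod (f (\<phi> (disc_aut a z)) - f (\<phi> a)))\<^sup>2) \<le> K * C + D"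
    if r: "0 < r" "r < 1" for r
  proof -
    note c = recentred_continuous[OF composition_holomorphic[OF \<phi> f] a r]
    note d = hyperbolic_density_continuous[OF \<phi> a r]
    have "circle_avg r (\<lambda>z. (cmod (f (\<phi> (disc_aut a z)) - f (\<phi> a)))\<^sup>2)
      \<le> circle_avg r (\<lambda>z. K * (1 / (1 - (cmod (disc_aut (\<phi> a) (\<phi> (disc_aut a z))))\<^sup>2)) + D)"
    proof (rule circle_avg_mono)
      show "(cmod (f (\<phi> (disc_aut a z)) - f (\<phi> a)))\<^sup>2
          \<le> K * (1 / (1 - (cmod (disc_aut (\<phi> a) (\<phi> (disc_aut a z))))\<^sup>2)) + D" if "cmod z = r" for z
      proof (rule bd)
        have "disc_aut a z \<in> unit_disc" using disc_aut_in_disc[of a z] a that r by simp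
        then have "\<phi> (disc_aut a z) \<in> unit_disc" using \<phi>(2) by blast
        then show "cmod (\<phi> (disc_aut a z)) < 1" by simp
      qed
      show "continuous_on (sphere 0 r) (\<lambda>z. K * (1 / (1 - (cmod (disc_aut (\<phi> a) (\<phi> (disc_aut a z))))\<^sup>2)) + D)"
        by (intro continuous_on_add continuous_on_mult continuous_on_const d)
    qed (use r in \<open>auto intro!: continuous_intros c\<close>)
    also have "\<dots> = K * hyperbolic_avg \<phi> a r + D"
      unfolding hyperbolic_avg_def circle_avg_cmult[symmetric]
      using circle_avg_add[OF continuous_on_mult[OF continuous_on_const d] continuous_on_const r(1)]
      by (simp only: circle_avg_const)
    also have "\<dots> \<le> K * C + D"
      by (intro add_right_mono mult_left_mono C r K)
    finally show ?thesis .
  qed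
  then show ?thesis using K by (simp add: mean_osc_le_iff)
qed

lemma mean_osc_composition_Lipschitz:
  assumes \<phi>: "\<phi> holomorphic_on unit_disc" "\<phi> ` unit_disc \<subseteq> unit_disc"
    and f: "f holomorphic_on unit_disc" "hyperbolic_Lipschitz B f" and a: "cmod a < 1"
    and \<eta>: "\<And>r. 0 < r \<Longrightarrow> r < 1 \<Longrightarrow> hyperbolic_avg \<phi> a r \<le> 1 + \<eta>" "0 \<le> \<eta>"
  shows "mean_osc (\<lambda>z. f (\<phi> z)) a \<le> ennreal (\<bar>B\<bar> * sqrt \<eta>)"
proof -
  have c: "cmod (\<phi> a) < 1" using \<phi>(2) a by (auto simp: image_subset_iff)
  have "mean_osc (\<lambda>z. f (\<phi> z)) a \<le> ennreal (sqrt (B\<^sup>2 * (1 + \<eta>) + - B\<^sup>2))"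
  proof (rule mean_osc_composition_le[OF \<phi> f(1) a \<eta>(1)])
    fix w :: complex assume w: "cmod w < 1"
    have "(artanh (cmod (disc_aut (\<phi> a) w)))\<^sup>2 \<le> 1 / (1 - (cmod (disc_aut (\<phi> a) w))\<^sup>2) - 1"
      using norm_disc_aut_less[OF c w] by (intro artanh_square_le) auto
    from mult_left_mono[OF this, of "B\<^sup>2"] hyperbolic_Lipschitz_square[OF f(2) c w]
    show "(cmod (f w - f (\<phi> a)))\<^sup>2 \<le> B\<^sup>2 * (1 / (1 - (cmod (disc_aut (\<phi> a) w))\<^sup>2)) + - B\<^sup>2"
      by (simp add: right_diff_distrib)
  qed (use \<eta>(2) in \<open>auto simp: distrib_left\<close>)
  also have "sqrt (B\<^sup>2 * (1 + \<eta>) + - B\<^sup>2) = \<bar>B\<bar> * sqrt \<eta>"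
    by (simp add: distrib_left real_sqrt_mult)
  finally show ?thesis .
qed

lemma composition_op_Lipschitz_vmoa:
  assumes \<phi>: "\<phi> holomorphic_on unit_disc" "\<phi> ` unit_disc \<subseteq> unit_disc"
    and C: "\<And>a r. cmod a < 1 \<Longrightarrow> 0 < r \<Longrightarrow> r < 1 \<Longrightarrow> hyperbolic_avg \<phi> a r \<le> C"
    and small: "\<And>\<eta>. 0 < \<eta> \<Longrightarrow>
        \<forall>\<^sub>F a in boundary_filter. \<forall>r. 0 < r \<longrightarrow> r < 1 \<longrightarrow> hyperbolic_avg \<phi> a r \<le> 1 + \<eta>"
    and f: "f holomorphic_on unit_disc" "hyperbolic_Lipschitz B f"
  shows "composition_op \<phi> f \<in> vmoa"
proof -
  have eq: "composition_op \<phi> f = on_disc (\<lambda>z. f (\<phi> z))" by (simp add: composition_op_def o_def)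
  show ?thesis
    unfolding eq
  proof (rule vmoaI)
    show "on_disc (\<lambda>z. f (\<phi> z)) \<in> analytic_disc"
      by (rule on_disc_analytic[OF composition_holomorphic[OF \<phi> f(1)]])
    show "mean_osc (on_disc (\<lambda>z. f (\<phi> z))) a \<le> ennreal (\<bar>B\<bar> * sqrt \<bar>C\<bar>)" if a: "cmod a < 1" for a
    proof -
      have "hyperbolic_avg \<phi> a r \<le> 1 + \<bar>C\<bar>" if "0 < r" "r < 1" for r
        using C[OF a that] by linarith
      from mean_osc_composition_Lipschitz[OF \<phi> f a this] show ?thesis
        by (simp add: mean_osc_on_disc a)
    qed
    fix e :: real assume e: "0 < e"
    define \<eta> where "\<eta> = (e / (\<bar>B\<bar> + 1))\<^sup>2"
    have \<eta>: "0 < \<eta>" "\<bar>B\<bar> * sqrt \<eta> \<le> e"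
    proof -
      show "0 < \<eta>" using e by (simp add: \<eta>_def)
      have "\<bar>B\<bar> * sqrt \<eta> = e * (\<bar>B\<bar> / (\<bar>B\<bar> + 1))" using e by (simp add: \<eta>_def)
      also have "\<dots> \<le> e * 1" using e by (intro mult_left_mono) auto
      finally show "\<bar>B\<bar> * sqrt \<eta> \<le> e" by simp
    qed
    show "\<forall>\<^sub>F a in boundary_filter. mean_osc (on_disc (\<lambda>z. f (\<phi> z))) a \<le> ennreal e"
      using small[OF \<eta>(1)] eventually_boundary_disc
    proof eventually_elim
      case (elim a)
      have "mean_osc (\<lambda>z. f (\<phi> z)) a \<le> ennreal (\<bar>B\<bar> * sqrt \<eta>)"
        using elim \<eta>(1) by (intro mean_osc_composition_Lipschitz[OF \<phi> f]) auto
      also have "\<dots> \<le> ennreal e" by (intro ennreal_leI \<eta>)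
      finally show ?case by (simp add: mean_osc_on_disc elim)
    qed
  qed
qed

text \<open>Points \<open>a\<close> near the boundary are dealt with by the smallness of the hyperbolic averages, for all \<open>q\<close> at
  once. For the remaining \<open>a\<close>, which form a compact set, \<open>q\<close> is small on the hyperbolic discs
  \<open>|\<sigma>\<^sub>c w| \<le> \<delta>\<close> with \<open>c = \<phi> a\<close>, whose union is the compact set \<open>L\<close>. Off these discs the growth bound
  \<open>artanh\<^sup>2\<close> is a small multiple \<open>\<kappa>\<close> of the density, whose averages are bounded.\<close>

lemma composition_uniformly_small:
  assumes \<phi>: "\<phi> holomorphic_on unit_disc" "\<phi> ` unit_disc \<subseteq> unit_disc"
    and C: "\<And>a r. cmod a < 1 \<Longrightarrow> 0 < r \<Longrightarrow> r < 1 \<Longrightarrow> hyperbolic_avg \<phi> a r \<le> C"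
    and small: "\<And>\<eta>. 0 < \<eta> \<Longrightarrow>
        \<forall>\<^sub>F a in boundary_filter. \<forall>r. 0 < r \<longrightarrow> r < 1 \<longrightarrow> hyperbolic_avg \<phi> a r \<le> 1 + \<eta>"
    and e: "0 < e" and B: "0 < B"
  obtains L m where "compact L" "L \<subseteq> unit_disc" "0 < m"
    "\<forall>q. q holomorphic_on unit_disc \<and> hyperbolic_Lipschitz B q \<and> (\<forall>z\<in>L. cmod (q z) \<le> m)
      \<longrightarrow> bmoa_norm (composition_op \<phi> q) \<le> e"
proof -
  have \<phi>1: "cmod (\<phi> z) < 1" if "cmod z < 1" for z using \<phi>(2) that by (auto simp: image_subset_iff)
  define \<eta> where "\<eta> = (e / (2 * B))\<^sup>2"
  have \<eta>: "0 < \<eta>" "\<bar>B\<bar> * sqrt \<eta> = e / 2" using e B by (auto simp: \<eta>_def)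
  obtain \<rho>0 where \<rho>0: "\<rho>0 < 1"
    "\<And>a r. \<rho>0 < cmod a \<Longrightarrow> cmod a < 1 \<Longrightarrow> 0 < r \<Longrightarrow> r < 1 \<Longrightarrow> hyperbolic_avg \<phi> a r \<le> 1 + \<eta>"
    using small[OF \<eta>(1)] unfolding eventually_boundary_iff by blast
  define \<rho> where "\<rho> = max 0 \<rho>0"
  have \<rho>: "0 \<le> \<rho>" "\<rho> < 1" using \<rho>0(1) by (auto simp: \<rho>_def)
  define C' where "C' = \<bar>C\<bar> + 1"
  have C': "0 < C'" "\<And>a r. cmod a < 1 \<Longrightarrow> 0 < r \<Longrightarrow> r < 1 \<Longrightarrow> hyperbolic_avg \<phi> a r \<le> C'"
    using C by (force simp: C'_def)+
  \<comment> \<open>Chosen, like \<open>m = e / 8\<close> below, so that the squared oscillation \<open>B\<^sup>2 \<kappa> C' + (2 m)\<^sup>2\<close> is at most \<open>(e / 2)\<^sup>2\<close>.\<close>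
  define \<kappa> where "\<kappa> = e\<^sup>2 / (8 * B\<^sup>2 * C')"
  have \<kappa>: "0 < \<kappa>" "B\<^sup>2 * \<kappa> * C' = e\<^sup>2 / 8" using e B C'(1) by (auto simp: \<kappa>_def)
  obtain \<delta> where \<delta>: "0 \<le> \<delta>" "\<delta> < 1" "\<And>x. \<delta> < x \<Longrightarrow> x < 1 \<Longrightarrow> (artanh x)\<^sup>2 \<le> \<kappa> * (1 / (1 - x\<^sup>2))"
    using artanh_square_small[OF \<kappa>(1)] by blast
  define L where "L = (\<lambda>(a, u). disc_aut (\<phi> a) u) ` (cball 0 \<rho> \<times> cball 0 \<delta>)"
  have inL: "disc_aut (\<phi> a) u \<in> L" if "cmod a \<le> \<rho>" "cmod u \<le> \<delta>" for a u
    unfolding L_def using that by (intro image_eqI[of _ _ "(a, u)"]) auto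
  have "compact L"
    unfolding L_def
  proof (intro compact_continuous_image compact_Times compact_cball)
    have c\<phi>: "continuous_on (cball 0 \<rho> \<times> cball (0::complex) \<delta>) (\<lambda>p. \<phi> (fst p))"
      by (rule continuous_on_compose2[OF holomorphic_on_imp_continuous_on[OF \<phi>(1)] continuous_on_fst[OF continuous_on_id]])
        (use \<rho> in auto)
    have "1 - cnj (\<phi> a) * u \<noteq> 0" if "cmod a \<le> \<rho>" "cmod u \<le> \<delta>" for a u
      using that \<rho> \<delta> by (intro disc_aut_denominator \<phi>1) auto
    then show "continuous_on (cball 0 \<rho> \<times> cball 0 \<delta>) (\<lambda>(a, u). disc_aut (\<phi> a) u)"
      unfolding disc_aut_def case_prod_beta by (intro continuous_intros c\<phi>) auto
  qed
  moreover have "L \<subseteq> unit_disc"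
  proof
    fix z assume "z \<in> L"
    then obtain a u where au: "cmod a \<le> \<rho>" "cmod u \<le> \<delta>" "z = disc_aut (\<phi> a) u" by (auto simp: L_def)
    then have "cmod z < 1" using \<rho> \<delta> by (auto intro!: norm_disc_aut_less \<phi>1)
    then show "z \<in> unit_disc" by simp
  qed
  moreover define m where "m = e / 8"
  have "0 < m" using e by (simp add: m_def)
  moreover have "bmoa_norm (composition_op \<phi> q) \<le> e"
    if q: "q holomorphic_on unit_disc" "hyperbolic_Lipschitz B q" and qL: "\<And>z. z \<in> L \<Longrightarrow> cmod (q z) \<le> m" for q
  proof -
    have eq: "composition_op \<phi> q = on_disc (\<lambda>z. q (\<phi> z))" by (simp add: composition_op_def o_def)
    have "mean_osc (on_disc (\<lambda>z. q (\<phi> z))) a \<le> ennreal (e / 2)" if a: "cmod a < 1" for a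
    proof (cases "\<rho> < cmod a")
      case True
      then have "mean_osc (\<lambda>z. q (\<phi> z)) a \<le> ennreal (\<bar>B\<bar> * sqrt \<eta>)"
        using \<rho>0(2) a \<eta>(1) by (intro mean_osc_composition_Lipschitz[OF \<phi> q]) (auto simp: \<rho>_def)
      then show ?thesis by (simp only: \<eta>(2) mean_osc_on_disc[OF a])
    next
      case False
      note c = \<phi>1[OF a]
      have "mean_osc (\<lambda>z. q (\<phi> z)) a \<le> ennreal (sqrt (B\<^sup>2 * \<kappa> * C' + (2 * m)\<^sup>2))"
      proof (rule mean_osc_composition_le[OF \<phi> q(1) a C'(2)[OF a]])
        fix w :: complex assume w: "cmod w < 1"
        let ?x = "cmod (disc_aut (\<phi> a) w)"
        have x: "?x < 1" by (rule norm_disc_aut_less[OF c w])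
        have p: "0 \<le> B\<^sup>2 * \<kappa> * (1 / (1 - ?x\<^sup>2))"
          using x \<kappa>(1) by (intro mult_nonneg_nonneg) (auto simp: power_le_one)
        show "(cmod (q w - q (\<phi> a)))\<^sup>2 \<le> B\<^sup>2 * \<kappa> * (1 / (1 - ?x\<^sup>2)) + (2 * m)\<^sup>2"
        proof (cases "\<delta> < ?x")
          case True
          have "(cmod (q w - q (\<phi> a)))\<^sup>2 \<le> B\<^sup>2 * (artanh ?x)\<^sup>2"
            by (rule hyperbolic_Lipschitz_square[OF q(2) c w])
          also have "\<dots> \<le> B\<^sup>2 * (\<kappa> * (1 / (1 - ?x\<^sup>2)))"
            by (intro mult_left_mono \<delta>(3) True x) simp
          finally show ?thesis using zero_le_power2[of "2 * m"] unfolding mult.assoc by linarith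
        next
          case False
          then have w: "w \<in> L" using inL[of a "disc_aut (\<phi> a) w"] \<open>\<not> \<rho> < cmod a\<close> disc_aut_involution[OF c w] by simp
          have c: "\<phi> a \<in> L" using inL[of a 0] \<open>\<not> \<rho> < cmod a\<close> \<delta>(1) by (simp add: disc_aut_at_0)
          have "cmod (q w - q (\<phi> a)) \<le> 2 * m"
            using qL[OF w] qL[OF c] norm_triangle_ineq4[of "q w" "q (\<phi> a)"] by linarith
          then have "(cmod (q w - q (\<phi> a)))\<^sup>2 \<le> (2 * m)\<^sup>2" by (intro power_mono) auto
          then show ?thesis using p by linarith
        qed
      qed (use \<kappa>(1) C'(1) in \<open>auto intro!: add_nonneg_nonneg mult_nonneg_nonneg\<close>)
      also have "\<dots> \<le> ennreal (sqrt ((e / 2)\<^sup>2))"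
        unfolding \<kappa>(2) m_def by (intro ennreal_leI real_sqrt_le_mono) (simp add: power_divide field_simps)
      also have "sqrt ((e / 2)\<^sup>2) = e / 2" using e by simp
      finally show ?thesis by (simp only: mean_osc_on_disc[OF a])
    qed
    then have "bmoa_norm (on_disc (\<lambda>z. q (\<phi> z))) \<le> cmod (on_disc (\<lambda>z. q (\<phi> z)) 0) + e / 2"
      using e by (intro bmoa_norm_le) auto
    moreover have "cmod (q (\<phi> 0)) \<le> m"
      using inL[of 0 0] \<rho>(1) \<delta>(1) by (intro qL) (simp add: disc_aut_at_0)
    ultimately show ?thesis unfolding eq using e by (simp add: m_def on_disc_def)
  qed
  ultimately show thesis by (intro that) auto
qed

lemma hyperbolic_Lipschitz_subsequence:
  assumes f: "\<And>n. f n holomorphic_on unit_disc" "\<And>n. hyperbolic_Lipschitz B (f n)" "\<And>n. cmod (f n 0) \<le> B"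
  obtains g r where "g holomorphic_on unit_disc" "strict_mono (r :: nat \<Rightarrow> nat)" "hyperbolic_Lipschitz B g"
    "\<forall>K. compact K \<and> K \<subseteq> unit_disc \<longrightarrow> uniform_limit K (f \<circ> r) g sequentially"
proof -
  have bd: "cmod (f n z) \<le> B + B * artanh (cmod z)" if "cmod z < 1" for n z
  proof -
    have "cmod (f n z - f n 0) \<le> B * artanh (cmod z)"
      using hyperbolic_LipschitzD[OF f(2), of 0 z n] that by (simp add: disc_aut_0)
    then show ?thesis using f(3)[of n] norm_triangle_ineq2[of "f n z" "f n 0"] by linarith
  qed
  have locbd: "\<exists>M. \<forall>h\<in>range f. \<forall>z\<in>K. cmod (h z) \<le> M" if K: "compact K" "K \<subseteq> unit_disc" for K
  proof -
    have "continuous_on K (\<lambda>z. B + B * artanh (cmod z))"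
    proof -
      have "cmod ` K \<subseteq> {-1<..<1}" using K(2) by (force intro: less_le_trans[of "-1" 0])
      then have "continuous_on K (\<lambda>z. artanh (cmod z))"
        by (intro continuous_on_compose2[OF continuous_on_artanh[of "{-1<..<1}"]] continuous_intros) auto
      then show ?thesis by (intro continuous_intros)
    qed
    then have "bounded ((\<lambda>z. B + B * artanh (cmod z)) ` K)"
      by (intro compact_imp_bounded compact_continuous_image K)
    then obtain M where M: "\<And>z. z \<in> K \<Longrightarrow> \<bar>B + B * artanh (cmod z)\<bar> \<le> M"
      by (auto simp: bounded_iff)
    have "cmod (f n z) \<le> M" if "z \<in> K" for n z
      using bd[of z n] M[OF that] K(2) that by fastforce
    then show ?thesis by blast
  qed
  obtain g r where g: "g holomorphic_on unit_disc" "strict_mono (r :: nat \<Rightarrow> nat)"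
      "\<And>x. x \<in> unit_disc \<Longrightarrow> ((\<lambda>n. f (r n) x) \<longlongrightarrow> g x) sequentially"
      "\<And>K. \<lbrakk>compact K; K \<subseteq> unit_disc\<rbrakk> \<Longrightarrow> uniform_limit K (f \<circ> r) g sequentially"
    using Montel[OF open_ball _ locbd subset_refl] f(1) by blast
  have "hyperbolic_Lipschitz B g"
    unfolding hyperbolic_Lipschitz_def
  proof (intro allI impI)
    fix c w :: complex assume cw: "cmod c < 1" "cmod w < 1"
    have "(\<lambda>n. cmod (f (r n) w - f (r n) c)) \<longlonglongrightarrow> cmod (g w - g c)"
      using cw by (intro tendsto_intros g(3)) auto
    then show "cmod (g w - g c) \<le> B * artanh (cmod (disc_aut c w))"
      by (rule Lim_bounded[of _ _ 0]) (use hyperbolic_LipschitzD[OF f(2) cw] in auto)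
  qed
  with g show thesis by (intro that) auto
qed

text \<open>A bounded sequence in the Bloch space has a subsequence that converges locally uniformly to a
  hyperbolically Lipschitz function \<open>g\<close>, by Montel's theorem. The image of \<open>g\<close> is in VMOA, and
  \<open>composition_uniformly_small\<close> turns local uniform convergence into convergence of the images in norm.\<close>

lemma composition_op_bloch_compact:
  assumes \<phi>: "\<phi> holomorphic_on unit_disc" "\<phi> ` unit_disc \<subseteq> unit_disc"
    and C: "\<And>a r. cmod a < 1 \<Longrightarrow> 0 < r \<Longrightarrow> r < 1 \<Longrightarrow> hyperbolic_avg \<phi> a r \<le> C"
    and small: "\<And>\<eta>. 0 < \<eta> \<Longrightarrow>
        \<forall>\<^sub>F a in boundary_filter. \<forall>r. 0 < r \<longrightarrow> r < 1 \<longrightarrow> hyperbolic_avg \<phi> a r \<le> 1 + \<eta>"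
  shows "compact_operator bloch bloch_norm vmoa bmoa_norm (composition_op \<phi>)"
proof -
  interpret V: Metric_space vmoa "norm_dist bmoa_norm" by (rule Metric_space_vmoa)
  have hol: "f holomorphic_on unit_disc" if "f \<in> bloch" for f
    using that by (simp add: bloch_def analytic_disc_def)
  have lip: "hyperbolic_Lipschitz B f" if "f \<in> bloch" "bloch_norm f \<le> B" for f B
    unfolding hyperbolic_Lipschitz_def using bloch_norm_growth[OF that] by blast
  have T_vmoa: "composition_op \<phi> f \<in> vmoa" if "f holomorphic_on unit_disc" "hyperbolic_Lipschitz B f" for f B
    using C small by (rule composition_op_Lipschitz_vmoa[OF \<phi> _ _ that])
  have compact: "compactin V.mtopology (V.mtopology closure_of (composition_op \<phi> ` S))"
    if S: "S \<subseteq> bloch" "\<forall>f\<in>S. bloch_norm f \<le> B0" for S B0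
  proof -
    define B where "B = \<bar>B0\<bar> + 1"
    have B: "0 < B" "\<And>f. f \<in> S \<Longrightarrow> bloch_norm f \<le> B" using S(2) by (auto simp: B_def)
    have TS: "composition_op \<phi> ` S \<subseteq> vmoa"
      using S(1) lip[OF _ order_refl] by (auto intro!: T_vmoa hol)
    have "\<exists>l r. l \<in> vmoa \<and> strict_mono r \<and> limitin V.mtopology (\<sigma> \<circ> r) l sequentially"
      if \<sigma>: "range \<sigma> \<subseteq> composition_op \<phi> ` S" for \<sigma> :: "nat \<Rightarrow> complex \<Rightarrow> complex"
    proof -
      have "\<forall>n. \<exists>f. f \<in> S \<and> \<sigma> n = composition_op \<phi> f" using \<sigma> by blast
      then obtain f where f: "\<And>n. f n \<in> S" "\<And>n. \<sigma> n = composition_op \<phi> (f n)" by metis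
      have fb: "f n \<in> bloch" for n using f(1) S(1) by blast
      have f0: "cmod (f n 0) \<le> B" for n
        using B(2)[OF f(1)[of n]] enn2real_nonneg[of "bloch_seminorm (f n)"]
        unfolding bloch_norm_def by linarith
      obtain g r where g: "g holomorphic_on unit_disc" "strict_mono (r :: nat \<Rightarrow> nat)" "hyperbolic_Lipschitz B g"
        "\<forall>K. compact K \<and> K \<subseteq> unit_disc \<longrightarrow> uniform_limit K (f \<circ> r) g sequentially"
        by (rule hyperbolic_Lipschitz_subsequence[OF hol[OF fb] lip[OF fb B(2)[OF f(1)]] f0]) (rule that; assumption)
      have l: "composition_op \<phi> g \<in> vmoa" by (rule T_vmoa[OF g(1) g(3)])
      have "limitin V.mtopology (\<sigma> \<circ> r) (composition_op \<phi> g) sequentially"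
        unfolding V.limitin_metric
      proof (intro conjI l allI impI)
        fix e :: real assume e: "0 < e"
        have e2: "0 < e / 2" "0 < B + B" using e B by auto
        obtain L m where Lm: "compact L" "L \<subseteq> unit_disc" "0 < m"
          "\<forall>q. q holomorphic_on unit_disc \<and> hyperbolic_Lipschitz (B + B) q \<and> (\<forall>z\<in>L. cmod (q z) \<le> m)
            \<longrightarrow> bmoa_norm (composition_op \<phi> q) \<le> e / 2"
          by (rule composition_uniformly_small[OF \<phi> C small e2]; (assumption | (rule that; assumption)))
        have "uniform_limit L (f \<circ> r) g sequentially" using g(4) Lm(1,2) by blast
        then have "\<forall>\<^sub>F n in sequentially. \<forall>z\<in>L. dist ((f \<circ> r) n z) (g z) < m"
          using Lm(3) by (rule uniform_limitD)
        then show "\<forall>\<^sub>F n in sequentially. (\<sigma> \<circ> r) n \<in> vmoa \<and> norm_dist bmoa_norm ((\<sigma> \<circ> r) n) (composition_op \<phi> g) < e"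
        proof eventually_elim
          case (elim n)
          have "bmoa_norm (composition_op \<phi> (\<lambda>z. f (r n) z - g z)) \<le> e / 2"
          proof (rule Lm(4)[rule_format], intro conjI ballI)
            show "(\<lambda>z. f (r n) z - g z) holomorphic_on unit_disc"
              by (intro holomorphic_intros hol fb g(1))
            show "hyperbolic_Lipschitz (B + B) (\<lambda>z. f (r n) z - g z)"
              by (intro hyperbolic_Lipschitz_diff lip fb B f g(3))
            show "cmod (f (r n) z - g z) \<le> m" if "z \<in> L" for z
              using elim that by (auto simp: dist_norm less_imp_le)
          qed
          moreover have "composition_op \<phi> (\<lambda>z. f (r n) z - g z)
              = (\<lambda>z. (\<sigma> \<circ> r) n z - composition_op \<phi> g z)"
            by (auto simp: composition_op_def on_disc_def f(2))
          ultimately have "norm_dist bmoa_norm ((\<sigma> \<circ> r) n) (composition_op \<phi> g) < e"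
            using e by (simp add: norm_dist_def)
          moreover have "(\<sigma> \<circ> r) n \<in> vmoa" using TS f by auto
          ultimately show ?case by blast
        qed
      qed
      with l g(2) show ?thesis by blast
    qed
    then have "\<forall>T. T \<subseteq> composition_op \<phi> ` S \<and> infinite T \<longrightarrow> vmoa \<inter> V.mtopology derived_set_of T \<noteq> {}"
      using V.Bolzano_Weierstrass_property[OF TS TS] by blast
    then show ?thesis
      unfolding V.compact_closure_of_eq_Bolzano_Weierstrass by blast
  qed
  show ?thesis
    unfolding compact_operator_def
  proof (intro conjI allI ballI impI)
    show "composition_op \<phi> ` bloch \<subseteq> vmoa"
      using lip[OF _ order_refl] by (auto intro!: T_vmoa hol)
    show "compactin V.mtopology (V.mtopology closure_of (composition_op \<phi> ` S))"
      if "S \<subseteq> bloch \<and> (\<forall>f\<in>S. bloch_norm f \<le> B)" for S B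
      using compact that by blast
  qed (auto simp: composition_op_def on_disc_def)
qed

lemma compact_operator_bloch_imp_vmoa:
  assumes "compact_operator bloch bloch_norm Y n T"
  shows "compact_operator vmoa bmoa_norm Y n T"
proof -
  have sub: "vmoa \<subseteq> bloch" using vmoa_bloch(1) by blast
  note T = assms[unfolded compact_operator_def]
  show ?thesis
    unfolding compact_operator_def
  proof (intro conjI allI impI ballI)
    show "T ` vmoa \<subseteq> Y" using T sub by (meson image_mono order_trans)
    show "T (\<lambda>z. f z + g z) = (\<lambda>z. T f z + T g z)" if "f \<in> vmoa" "g \<in> vmoa" for f g
      using T that sub by (meson subsetD)
    show "T (\<lambda>z. c * f z) = (\<lambda>z. c * T f z)" if "f \<in> vmoa" for c f
      using T that sub by (meson subsetD)
    fix S B assume S: "S \<subseteq> vmoa \<and> (\<forall>f\<in>S. bmoa_norm f \<le> B)"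
    then have "S \<subseteq> bloch \<and> (\<forall>f\<in>S. bloch_norm f \<le> B)"
      using sub vmoa_bloch(2) by (meson order_trans subsetD)
    then show "compactin (Metric_space.mtopology Y (norm_dist n))
        (Metric_space.mtopology Y (norm_dist n) closure_of (T ` S))"
      using T by (elim conjE) metis
  qed
qed

theorem corollary14:
  fixes \<phi> :: "complex \<Rightarrow> complex"
  assumes "\<phi> holomorphic_on unit_disc"
    and "\<phi> ` unit_disc \<subseteq> unit_disc"
    and "on_disc \<phi> \<in> vmoa"
  shows "compact_operator vmoa bmoa_norm vmoa bmoa_norm (composition_op \<phi>) \<longleftrightarrow>
    compact_operator bloch bloch_norm vmoa bmoa_norm (composition_op \<phi>)"
proof
  assume T: "compact_operator vmoa bmoa_norm vmoa bmoa_norm (composition_op \<phi>)"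
  obtain C where "\<And>a r. cmod a < 1 \<Longrightarrow> 0 < r \<Longrightarrow> r < 1 \<Longrightarrow> hyperbolic_avg \<phi> a r \<le> C"
    using hyperbolic_avg_bounded[OF assms(1,2) T] by blast
  then show "compact_operator bloch bloch_norm vmoa bmoa_norm (composition_op \<phi>)"
    by (rule composition_op_bloch_compact[OF assms(1,2) _ hyperbolic_avg_small[OF assms(1,2) T]])
qed (rule compact_operator_bloch_imp_vmoa)

end
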